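(* Let $n\ge1$. The following statements are true: (1) For an admissible partition $\pi$ of $n$, $|A_\pi:\widehat A_\pi|$ is $1$ if $m_0=m_1=0$, and it is $2$ otherwise. (2) Every maximal elementary abelian $2$-subgroup of $B_n^+$ is conjugate in $B_n$ to $\widehat A_\pi$ for a unique relevant admissible partition $\pi$ of $n$. Conversely, $\widehat A_\pi$ is a maximal elementary abelian $2$-subgroup of $B_n^+$ if $\pi$ is a relevant admissible partition of $n$. (3) If $\pi$ is a relevant admissible partition of $n$, then $N_{B_n}(\widehat A_\pi)=N_{B_n}(A_\pi)$. (4) For all relevant admissible partitions $\pi$ of $n$, $|N_{B_n}(\widehat A_\pi):N_{B_n^+}(\widehat A_\pi)|$ is equal to $1$ if $m_0=m_1=m_2=0$, and to $2$ otherwise. (5) Let $\pi$ be a relevant admissible partition of $n$. If $m_0=m_1=m_2=0$, then the $B_n$-conjugacy class of $\widehat A_\pi$ contains exactly two $B_n^+$-conjugacy classes, represented by $\widehat A_\pi$ and its conjugate $\widehat A_\pi^{s_0}$ by $s_0$. Otherwise, the $B_n$- and $B_n^+$-conjugacy classes of $\widehat A_\pi$ coincide.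
   Context: $B_n=C_2^n\rtimes\Sigma_n$ is the group of signed permutations of $\{\pm1,\dots,\pm n\}$ (Coxeter group of type $B$, acting on $\mathbb R^n$); $s_0$ is the reflection negating the first coordinate. $\mathrm{sgn}:B_n\to\{\pm1\}$ is the homomorphism equal to $-1$ on every reflection, and $B_n^+=\ker(\mathrm{sgn})$. A partition $\pi$ of $n$ is admissible if all its parts are powers of $2$; $m_k=m_k(\pi)$ is the multiplicity of $2^k$ in $\pi$. An admissible partition is irrelevant if $m_0=2$ and $m_1=0$, and relevant otherwise. $V_k=\mathbb F_2^k$ is embedded in $\Sigma_{2^k}$ by its regular action on itself; $C_k\cong\mathbb F_2$ is the center of $B_{2^k}$, generated by the sign change of all coordinates; $A_{(2^k)}=C_k\times V_k\le B_{2^k}$. For $\pi=\{2^{k_1},\dots,2^{k_i}\}$ (parts in a chosen order), $A_\pi=\prod_jA_{(2^{k_j})}\le\prod_jB_{2^{k_j}}\le B_n$, and $\widehat A_\pi=A_\pi\cap B_n^+$. $N_G(H)$ is the normalizer of $H$ in $G$. *)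

theory Defs
  imports Complex_Main "HOL-Algebra.Algebra" "HOL-Library.Multiset" "HOL-Library.Z2"
begin

section \<open>The hyperoctahedral group\<close>

definition pm :: "nat \<Rightarrow> int set" where
  "pm n = {i. 1 \<le> \<bar>i\<bar> \<and> \<bar>i\<bar> \<le> int n}"

text \<open>Signed permutations are functions on all integers that are the identity outside
  \<open>pm n\<close>; the product is composition.\<close>

definition B :: "nat \<Rightarrow> (int \<Rightarrow> int) monoid" where
  "B n = \<lparr>carrier = {w. w permutes pm n \<and> (\<forall>i. w (- i) = - w i)}, monoid.mult = (\<circ>), one = id\<rparr>"

text \<open>A vector \<open>x\<close> of \<open>\<real>\<^sup>n\<close> is given by its coordinates \<open>x 1, \<dots>, x n\<close>. With
  \<open>b (- i) = - b i\<close> for the standard basis \<open>b\<close>, the action is \<open>w (b i) = b (w i)\<close>; in coordinates,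
  \<open>(w x) i = x (w\<^sup>-\<^sup>1 i)\<close> where \<open>x\<close> is extended to negative indices as an odd function.\<close>

definition odd_ext :: "(nat \<Rightarrow> real) \<Rightarrow> int \<Rightarrow> real" where
  "odd_ext x i = of_int (sgn i) * x (nat \<bar>i\<bar>)"

definition act :: "(int \<Rightarrow> int) \<Rightarrow> (nat \<Rightarrow> real) \<Rightarrow> nat \<Rightarrow> real" where
  "act w x i = odd_ext x (Hilbert_Choice.inv w (int i))"

definition dot :: "nat \<Rightarrow> (nat \<Rightarrow> real) \<Rightarrow> (nat \<Rightarrow> real) \<Rightarrow> real" where
  "dot n x y = (\<Sum>k=1..n. x k * y k)"

definition is_reflection :: "nat \<Rightarrow> (int \<Rightarrow> int) \<Rightarrow> bool" where
  "is_reflection n w \<longleftrightarrow> w \<in> carrier (B n) \<and>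
     (\<exists>a. (\<exists>i\<in>{1..n}. a i \<noteq> 0) \<and>
       (\<forall>x. \<forall>i\<in>{1..n}. act w x i = x i - 2 * dot n x a / dot n a a * a i))"

definition is_sgn :: "nat \<Rightarrow> ((int \<Rightarrow> int) \<Rightarrow> int) \<Rightarrow> bool" where
  "is_sgn n f \<longleftrightarrow> f \<in> hom (B n) sign_img \<and> f \<in> extensional (carrier (B n)) \<and>
     (\<forall>w. is_reflection n w \<longrightarrow> f w = -1)"

text \<open>Well defined by lemma \<open>ex1_is_sgn\<close> below.\<close>

definition sgn_B :: "nat \<Rightarrow> (int \<Rightarrow> int) \<Rightarrow> int" where
  "sgn_B n = (THE f. is_sgn n f)"

definition Bplus :: "nat \<Rightarrow> (int \<Rightarrow> int) monoid" where
  "Bplus n = (B n)\<lparr>carrier := kernel (B n) sign_img (sgn_B n)\<rparr>"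

definition s0 :: "int \<Rightarrow> int" where
  "s0 = transpose 1 (-1)"


section \<open>General group-theoretic notions\<close>

definition conj_set :: "('a, 'b) monoid_scheme \<Rightarrow> 'a \<Rightarrow> 'a set \<Rightarrow> 'a set" where
  "conj_set G g H = g <#\<^bsub>G\<^esub> H #>\<^bsub>G\<^esub> inv\<^bsub>G\<^esub> g"

definition conj_class :: "('a, 'b) monoid_scheme \<Rightarrow> 'a set \<Rightarrow> 'a set set" where
  "conj_class G H = (\<lambda>g. conj_set G g H) ` carrier G"

definition subgroup_index :: "('a, 'b) monoid_scheme \<Rightarrow> 'a set \<Rightarrow> 'a set \<Rightarrow> nat" where
  "subgroup_index G K H = card (rcosets\<^bsub>G\<lparr>carrier := K\<rparr>\<^esub> H)"

definition elem_ab_2_subgroup :: "('a, 'b) monoid_scheme \<Rightarrow> 'a set \<Rightarrow> bool" where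
  "elem_ab_2_subgroup G E \<longleftrightarrow> subgroup E G \<and>
     (\<forall>x\<in>E. \<forall>y\<in>E. x \<otimes>\<^bsub>G\<^esub> y = y \<otimes>\<^bsub>G\<^esub> x) \<and> (\<forall>x\<in>E. x [^]\<^bsub>G\<^esub> (2::nat) = \<one>\<^bsub>G\<^esub>)"

definition max_elem_ab_2_subgroup :: "('a, 'b) monoid_scheme \<Rightarrow> 'a set \<Rightarrow> bool" where
  "max_elem_ab_2_subgroup G E \<longleftrightarrow> elem_ab_2_subgroup G E \<and>
     (\<forall>F. elem_ab_2_subgroup G F \<and> E \<subseteq> F \<longrightarrow> F = E)"


section \<open>Admissible partitions\<close>

definition admissible :: "nat \<Rightarrow> nat multiset \<Rightarrow> bool" where
  "admissible n \<pi> \<longleftrightarrow> sum_mset \<pi> = n \<and> (\<forall>p\<in>#\<pi>. \<exists>k. p = 2 ^ k)"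

definition mult2 :: "nat \<Rightarrow> nat multiset \<Rightarrow> nat" where
  "mult2 k \<pi> = count \<pi> (2 ^ k)"

definition relevant :: "nat \<Rightarrow> nat multiset \<Rightarrow> bool" where
  "relevant n \<pi> \<longleftrightarrow> admissible n \<pi> \<and> \<not> (mult2 0 \<pi> = 2 \<and> mult2 1 \<pi> = 0)"


section \<open>The subgroups $A_\pi$ and $\widehat A_\pi$\<close>

text \<open>\<open>V k\<close> is \<open>\<bbbF>\<^sub>2\<^sup>k\<close>, as functions vanishing outside \<open>{..<k}\<close>.\<close>

definition V :: "nat \<Rightarrow> (nat \<Rightarrow> bit) set" where
  "V k = {v. \<forall>i\<ge>k. v i = 0}"

text \<open>Regarding permutations of \<open>V k\<close> as permutations of \<open>{1..2 ^ k}\<close> requires an enumeration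
  \<open>e k\<close> of \<open>V k\<close>, which is a parameter throughout.\<close>

definition enumeration :: "(nat \<Rightarrow> nat \<Rightarrow> nat \<Rightarrow> bit) \<Rightarrow> bool" where
  "enumeration e \<longleftrightarrow> (\<forall>k. bij_betw (e k) {1..2 ^ k} (V k))"

definition regular :: "(nat \<Rightarrow> nat \<Rightarrow> nat \<Rightarrow> bit) \<Rightarrow> nat \<Rightarrow> (nat \<Rightarrow> bit) \<Rightarrow> nat \<Rightarrow> nat" where
  "regular e k v i =
     (if i \<in> {1..2 ^ k} then inv_into {1..2 ^ k} (e k) (\<lambda>j. v j + e k i j) else i)"

definition signed :: "(nat \<Rightarrow> nat) \<Rightarrow> int \<Rightarrow> int" where
  "signed \<sigma> i = sgn i * int (\<sigma> (nat \<bar>i\<bar>))"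

definition neg_all :: "nat \<Rightarrow> int \<Rightarrow> int" where
  "neg_all n i = (if i \<in> pm n then - i else i)"

definition C_block :: "nat \<Rightarrow> (int \<Rightarrow> int) set" where
  "C_block k = generate (B (2 ^ k)) {neg_all (2 ^ k)}"

definition A_block :: "(nat \<Rightarrow> nat \<Rightarrow> nat \<Rightarrow> bit) \<Rightarrow> nat \<Rightarrow> (int \<Rightarrow> int) set" where
  "A_block e k = C_block k <#>\<^bsub>B (2 ^ k)\<^esub> ((\<lambda>v. signed (regular e k v)) ` V k)"

text \<open>The embedding of \<open>B a \<times> B b\<close> into \<open>B (a + b)\<close>: \<open>u\<close> acts on \<open>\<plusminus>{1..a}\<close> and \<open>v\<close>, shifted,
  on \<open>\<plusminus>{a+1..a+b}\<close>.\<close>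

definition block_sum :: "nat \<Rightarrow> (int \<Rightarrow> int) \<Rightarrow> (int \<Rightarrow> int) \<Rightarrow> int \<Rightarrow> int" where
  "block_sum a u v i =
     (if \<bar>i\<bar> \<le> int a then u i
      else let j = v (i - sgn i * int a) in j + sgn j * int a)"

text \<open>The list contains the exponents \<open>k\<^sub>1, k\<^sub>2, \<dots>\<close> of the parts in the chosen order.\<close>

fun A_list :: "(nat \<Rightarrow> nat \<Rightarrow> nat \<Rightarrow> bit) \<Rightarrow> nat list \<Rightarrow> (int \<Rightarrow> int) set" where
  "A_list e [] = {id}"
| "A_list e (k # ks) = {block_sum (2 ^ k) u v | u v. u \<in> A_block e k \<and> v \<in> A_list e ks}"

text \<open>\<open>parts\<close> chooses an order of the parts of each partition.\<close>

definition part_order :: "(nat multiset \<Rightarrow> nat list) \<Rightarrow> bool" where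
  "part_order parts \<longleftrightarrow>
     (\<forall>n \<pi>. admissible n \<pi> \<longrightarrow> mset (map (\<lambda>k. 2 ^ k) (parts \<pi>)) = \<pi>)"

definition A_part ::
    "(nat \<Rightarrow> nat \<Rightarrow> nat \<Rightarrow> bit) \<Rightarrow> (nat multiset \<Rightarrow> nat list) \<Rightarrow> nat multiset \<Rightarrow> (int \<Rightarrow> int) set" where
  "A_part e parts \<pi> = A_list e (parts \<pi>)"

definition A_hat ::
    "(nat \<Rightarrow> nat \<Rightarrow> nat \<Rightarrow> bit) \<Rightarrow> (nat multiset \<Rightarrow> nat list) \<Rightarrow> nat \<Rightarrow> nat multiset
      \<Rightarrow> (int \<Rightarrow> int) set" where
  "A_hat e parts n \<pi> = A_part e parts \<pi> \<inter> carrier (Bplus n)"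


section \<open>The sign homomorphism is well defined\<close>

definition rfl :: "int \<Rightarrow> int \<Rightarrow> int \<Rightarrow> int" where
  "rfl i j k = (if k = i then j else if k = j then i
     else if k = - i then - j else if k = - j then - i else k)"

lemma carrier_B: "w \<in> carrier (B n) \<longleftrightarrow> w permutes pm n \<and> (\<forall>i. w (- i) = - w i)"
  by (simp add: B_def)

lemma B_comp: "w \<in> carrier (B n) \<Longrightarrow> v \<in> carrier (B n) \<Longrightarrow> w \<circ> v \<in> carrier (B n)"
  by (auto simp: carrier_B permutes_compose)

lemma finite_pm [simp]: "finite (pm n)"
  by (rule finite_subset[of _ "{- int n..int n}"]) (auto simp: pm_def)

lemma rfl_rfl: "i \<noteq> 0 \<Longrightarrow> j \<noteq> 0 \<Longrightarrow> rfl i j (rfl i j k) = k"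
  by (auto simp: rfl_def)

lemma rfl_in_B: assumes "i \<in> pm n" "j \<in> pm n" shows "rfl i j \<in> carrier (B n)"
proof -
  have nz: "i \<noteq> 0" "j \<noteq> 0" using assms by (auto simp: pm_def)
  have "\<exists>!y. rfl i j y = x" for x using rfl_rfl[OF nz] by metis
  moreover have "rfl i j x = x" if "x \<notin> pm n" for x
    using that assms by (auto simp: rfl_def pm_def)
  ultimately have "rfl i j permutes pm n" by (auto simp: permutes_def)
  moreover have "rfl i j (- k) = - rfl i j k" for k using nz by (auto simp: rfl_def)
  ultimately show ?thesis by (simp add: carrier_B)
qed

lemma inv_rfl: "i \<noteq> 0 \<Longrightarrow> j \<noteq> 0 \<Longrightarrow> Hilbert_Choice.inv (rfl i j) = rfl i j"
  by (rule inv_unique_comp) (auto simp: rfl_rfl fun_eq_iff)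

lemma dot_root:
  assumes "p \<in> pm n" "q \<in> pm n"
  shows "dot n x (\<lambda>k. (if int k = p then 1 else 0) - (if int k = - p then 1 else 0)
            - (if int k = q then 1 else 0) + (if int k = - q then 1 else 0))
         = odd_ext x p - odd_ext x q"
proof -
  have one: "(\<Sum>k=1..n. x k * ((if int k = p then 1 else 0) - (if int k = - p then 1 else 0)))
      = odd_ext x p" if "p \<in> pm n" for p
  proof (cases "p > 0")
    case True
    then have "(\<Sum>k=1..n. x k * ((if int k = p then 1 else 0) - (if int k = - p then 1 else 0)))
       = (\<Sum>k=1..n. if k = nat p then x k else 0)"
      by (intro sum.cong) auto
    also have "\<dots> = x (nat p)" using that True by (subst sum.delta) (auto simp: pm_def)
    finally show ?thesis using True by (simp add: odd_ext_def)
  next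
    case False
    then have neg: "p < 0" using that by (auto simp: pm_def)
    then have "(\<Sum>k=1..n. x k * ((if int k = p then 1 else 0) - (if int k = - p then 1 else 0)))
       = (\<Sum>k=1..n. if k = nat (- p) then - x k else 0)"
      by (intro sum.cong) auto
    also have "\<dots> = - x (nat (- p))" using that neg by (subst sum.delta) (auto simp: pm_def)
    finally show ?thesis using neg by (simp add: odd_ext_def)
  qed
  have "dot n x (\<lambda>k. (if int k = p then 1 else 0) - (if int k = - p then 1 else 0)
            - (if int k = q then 1 else 0) + (if int k = - q then 1 else 0))
     = (\<Sum>k=1..n. x k * ((if int k = p then 1 else 0) - (if int k = - p then 1 else 0)))
     - (\<Sum>k=1..n. x k * ((if int k = q then 1 else 0) - (if int k = - q then 1 else 0)))"
    unfolding dot_def sum_subtractf[symmetric] by (intro sum.cong) (auto simp: algebra_simps)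
  then show ?thesis using one[OF assms(1)] one[OF assms(2)] by simp
qed

lemma rfl_is_reflection:
  assumes "i \<in> pm n" "j \<in> pm n" "i \<noteq> j"
  shows "is_reflection n (rfl i j)"
proof -
  have nz: "i \<noteq> 0" "j \<noteq> 0" using assms by (auto simp: pm_def)
  define a :: "nat \<Rightarrow> real" where
    "a = (\<lambda>k. (if int k = i then 1 else 0) - (if int k = - i then 1 else 0)
            - (if int k = j then 1 else 0) + (if int k = - j then 1 else 0))"
  have d: "dot n x a = odd_ext x i - odd_ext x j" for x
    unfolding a_def by (rule dot_root) (use assms in auto)
  have daa: "dot n a a = (if j = - i then 4 else 2)"
    unfolding d using nz assms(3) by (auto simp: a_def odd_ext_def sgn_if)
  have "nat \<bar>i\<bar> \<in> {1..n}" "a (nat \<bar>i\<bar>) \<noteq> 0"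
    using assms nz by (auto simp: pm_def a_def abs_if)
  moreover have "act (rfl i j) x k = x k - 2 * dot n x a / dot n a a * a k" if "k \<in> {1..n}" for x k
  proof -
    have neg: "odd_ext x (- m) = - odd_ext x m" for m by (simp add: odd_ext_def sgn_if)
    have pos: "odd_ext x (int k) = x k" using that by (simp add: odd_ext_def)
    have goal: "odd_ext x (rfl i j (int k))
        = odd_ext x (int k) - 2 * (odd_ext x i - odd_ext x j) / dot n a a * a k"
    proof (cases "j = - i")
      case True
      then have a: "a k = (if int k = i then 2 else if int k = - i then - 2 else 0)"
        using nz by (simp add: a_def)
      show ?thesis unfolding a daa using True by (simp add: rfl_def neg)
    next
      case False
      then have "a k = (if int k = i then 1 else if int k = j then - 1
          else if int k = - i then - 1 else if int k = - j then 1 else 0)"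
        using nz assms(3) by (simp add: a_def)
      then show ?thesis unfolding daa using False nz assms(3) by (simp add: rfl_def neg field_simps)
    qed
    show ?thesis using goal by (simp add: act_def inv_rfl[OF nz] d pos)
  qed
  ultimately show ?thesis
    unfolding is_reflection_def using rfl_in_B[OF assms(1,2)] by blast
qed

lemma is_reflection_rfl:
  assumes "is_reflection n w"
  obtains i j where "i \<in> pm n" "j \<in> pm n" "i \<noteq> j" "w = rfl i j"
proof -
  obtain a p where wB: "w \<in> carrier (B n)" and p: "p \<in> {1..n}" "a p \<noteq> 0"
    and w: "\<And>x i. i \<in> {1..n} \<Longrightarrow> act w x i = x i - 2 * dot n x a / dot n a a * a i"
    using assms unfolding is_reflection_def by blast
  define v where "v = Hilbert_Choice.inv w"
  have wp: "w permutes pm n" and wo: "\<And>i. w (- i) = - w i" using wB by (auto simp: carrier_B)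
  have vp: "v permutes pm n" unfolding v_def using wp by (rule permutes_inv)
  have wv: "w (v i) = i" for i using wp by (simp add: v_def permutes_inverses)
  have vw: "v (w i) = i" for i using wp by (simp add: v_def permutes_inverses)
  have vo: "v (- i) = - v i" for i by (metis wv vw wo)
  have vinj: "v i = v j \<longleftrightarrow> i = j" for i j by (metis wv)
  define c where "c = 2 / dot n a a"
  have "dot n a a > 0"
    unfolding dot_def by (rule sum_pos2[of _ p]) (use p in \<open>auto simp: zero_less_mult_iff neq_iff\<close>)
  then have c: "c > 0" "c * dot n a a = 2" by (auto simp: c_def)
  have main: "odd_ext x (v i) = odd_ext x i - c * dot n x a * odd_ext a i" if "i \<in> pm n" for x i
  proof (cases "i > 0")
    case True
    then have "nat i \<in> {1..n}" using that by (auto simp: pm_def)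
    from w[OF this, of x] show ?thesis using True by (simp add: act_def v_def c_def odd_ext_def)
  next
    case False
    then have i: "i < 0" using that by (auto simp: pm_def)
    then have "nat (- i) \<in> {1..n}" using that by (auto simp: pm_def)
    from w[OF this, of x] have "odd_ext x (v (- i)) = x (nat (- i)) - c * dot n x a * a (nat (- i))"
      using i by (simp add: act_def v_def c_def)
    then show ?thesis using i by (simp add: vo odd_ext_def)
  qed
  have aneg: "odd_ext a (v i) = - odd_ext a i" if "i \<in> pm n" for i
    using main[OF that, of a] c by simp
  define P where "P = int p"
  define q where "q = v P"
  have Pm: "P \<in> pm n" "P > 0" and aP: "odd_ext a P = a p"
    using p by (auto simp: P_def pm_def odd_ext_def)
  have qm: "q \<in> pm n" unfolding q_def using Pm vp by (simp add: permutes_in_image)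
  have aq: "odd_ext a q = - a p" unfolding q_def using aneg Pm aP by simp
  have qP: "q \<noteq> P" using aq aP p by auto
  have fix_pos: "v k = k" if k: "k \<in> pm n" "k > 0" "k \<noteq> P" "k \<noteq> \<bar>q\<bar>" for k
  proof -
    define x :: "nat \<Rightarrow> real" where "x = (\<lambda>m. if m = nat k then 1 else 0)"
    have "dot n x a = (\<Sum>m=1..n. if m = nat k then a m else 0)"
      unfolding dot_def x_def by (intro sum.cong) auto
    also have "\<dots> = a (nat k)" using k by (subst sum.delta) (auto simp: pm_def)
    finally have 1: "dot n x a = a (nat k)" .
    have "odd_ext x q = 0" "odd_ext x P = 0"
      using k Pm by (auto simp: odd_ext_def x_def)
    then have "c * dot n x a * a p = 0"
      using main[OF Pm(1), of x] aP by (simp add: q_def)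
    then have ak: "odd_ext a k = 0" using 1 c p k by (simp add: odd_ext_def)
    have "odd_ext real i = of_int i" for i
      by (auto simp: odd_ext_def sgn_if)
    then show ?thesis using main[OF k(1), of real] ak by simp
  qed
  have vfix: "v k = k" if k: "k \<noteq> P" "k \<noteq> - P" "k \<noteq> q" "k \<noteq> - q" for k
  proof (cases "k \<in> pm n")
    case True
    show ?thesis
    proof (cases "k > 0")
      case True
      with \<open>k \<in> pm n\<close> k show ?thesis by (intro fix_pos) auto
    next
      case False
      with \<open>k \<in> pm n\<close> k have "v (- k) = - k" by (intro fix_pos) (auto simp: pm_def)
      then show ?thesis by (simp add: vo)
    qed
  next
    case False then show ?thesis using vp by (simp add: permutes_def)
  qed
  have vq: "v q = P"
  proof (rule ccontr)
    assume ne: "v q \<noteq> P"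
    have 1: "v q \<noteq> q" using qP vinj q_def by metis
    have 2: "v q \<noteq> - P" using aneg[OF qm] aq aP p Pm by (auto simp: odd_ext_def sgn_if split: if_splits)
    have 3: "v q \<noteq> - q"
    proof
      assume "v q = - q"
      then have "v q = v (- P)" by (simp add: vo q_def)
      then have "q = - P" by (simp add: vinj)
      with \<open>v q = - q\<close> ne show False by simp
    qed
    from vfix[OF ne 2 1 3] have "v q = q" by (simp add: vinj)
    with 1 show False by simp
  qed
  have "v = rfl P q"
  proof
    fix k show "v k = rfl P q k"
      using vfix[of k] vq vo[of P] vo[of q] by (auto simp: rfl_def q_def)
  qed
  moreover have "Hilbert_Choice.inv v = w"
    unfolding v_def using wp by (simp add: permutes_inv_inv)
  ultimately have "w = rfl P q"
    using inv_rfl[of P q] Pm qm by (auto simp: pm_def)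
  then show ?thesis using that[of P q] Pm qm qP by auto
qed

definition absp :: "(int \<Rightarrow> int) \<Rightarrow> int \<Rightarrow> int" where
  "absp w i = (if i > 0 then \<bar>w i\<bar> else i)"

lemma B_nz: "w \<in> carrier (B n) \<Longrightarrow> w i = 0 \<longleftrightarrow> i = 0"
  unfolding carrier_B by (metis neg_equal_zero neg_0_equal_iff_equal permutes_inverses(2))

lemma B_abs: "w \<in> carrier (B n) \<Longrightarrow> \<bar>w \<bar>i\<bar>\<bar> = \<bar>w i\<bar>"
  unfolding carrier_B by (cases "i \<ge> 0") (auto simp: abs_if)

lemma absp_comp: assumes "w \<in> carrier (B n)" "v \<in> carrier (B n)"
  shows "absp (w \<circ> v) = absp w \<circ> absp v"
proof
  fix i
  show "absp (w \<circ> v) i = (absp w \<circ> absp v) i"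
    using B_nz[OF assms(2), of i] B_abs[OF assms(1), of "v i"] by (auto simp: absp_def)
qed

lemma absp_permutes: assumes "w \<in> carrier (B n)" shows "absp w permutes {1..int n}"
proof (rule bij_imp_permutes)
  have w: "w permutes pm n" and wo: "\<And>i. w (- i) = - w i" using assms by (auto simp: carrier_B)
  have im: "absp w i \<in> {1..int n}" if "i \<in> {1..int n}" for i
  proof -
    have "w i \<in> pm n" using w that by (subst permutes_in_image) (auto simp: pm_def)
    then show ?thesis using that by (auto simp: absp_def pm_def)
  qed
  have inj: "inj_on (absp w) {1..int n}"
  proof (rule inj_onI)
    fix i j assume ij: "i \<in> {1..int n}" "j \<in> {1..int n}" "absp w i = absp w j"
    then have "w i = w j \<or> w i = - w j" by (auto simp: absp_def abs_eq_iff)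
    then have "w i = w j \<or> w i = w (- j)" by (simp add: wo)
    then have "i = j \<or> i = - j" using permutes_inj[OF w] by (auto dest: injD)
    then show "i = j" using ij by auto
  qed
  show "bij_betw (absp w) {1..int n} {1..int n}"
    unfolding bij_betw_def using inj im by (intro conjI endo_inj_surj image_subsetI) simp_all
next
  fix x assume "x \<notin> {1..int n}"
  then have "x > 0 \<Longrightarrow> x \<notin> pm n" by (auto simp: pm_def)
  then show "absp w x = x" using assms by (auto simp: absp_def carrier_B permutes_def)
qed

lemma ex_is_sgn: "\<exists>f. is_sgn n f"
proof -
  define f where "f = restrict (\<lambda>w. sign (absp w) * sign w) (carrier (B n))"
  have pw: "permutation w" if "w \<in> carrier (B n)" for w
    using that by (auto simp: carrier_B permutation_permutes intro: finite_pm)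
  have pa: "permutation (absp w)" if "w \<in> carrier (B n)" for w
    using absp_permutes[OF that] by (auto simp: permutation_permutes intro: finite_atLeastAtMost_int)
  have "f \<in> hom (B n) sign_img"
  proof (rule homI)
    fix w assume "w \<in> carrier (B n)"
    then show "f w \<in> carrier sign_img" by (auto simp: f_def sign_img_def sign_def)
  next
    fix w v assume wv: "w \<in> carrier (B n)" "v \<in> carrier (B n)"
    have "w \<otimes>\<^bsub>B n\<^esub> v = w \<circ> v" by (simp add: B_def)
    then show "f (w \<otimes>\<^bsub>B n\<^esub> v) = f w \<otimes>\<^bsub>sign_img\<^esub> f v"
      using wv B_comp[OF wv] pw pa
      by (simp add: f_def sign_img_def absp_comp[OF wv] sign_compose)
  qed
  moreover have "f w = -1" if "is_reflection n w" for w
  proof -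
    obtain i j where ij: "i \<in> pm n" "j \<in> pm n" "i \<noteq> j" and w: "w = rfl i j"
      using is_reflection_rfl[OF \<open>is_reflection n w\<close>] by metis
    have nz: "i \<noteq> 0" "j \<noteq> 0" using ij by (auto simp: pm_def)
    have wB: "w \<in> carrier (B n)" using that by (simp add: is_reflection_def)
    have "sign (absp w) * sign w = -1"
    proof (cases "j = - i")
      case True
      have "absp w = id" using True nz by (auto simp: absp_def w rfl_def fun_eq_iff)
      moreover have "w = transpose i j"
        using True nz by (auto simp: w rfl_def transpose_def fun_eq_iff)
      ultimately show ?thesis using ij by (simp add: sign_swap_id)
    next
      case False
      have "absp w = transpose \<bar>i\<bar> \<bar>j\<bar>"
        using False nz ij(3) by (auto simp: absp_def w rfl_def transpose_def fun_eq_iff abs_if)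
      moreover have "\<bar>i\<bar> \<noteq> \<bar>j\<bar>" using False ij(3) by (auto simp: abs_if split: if_splits)
      moreover have "w = transpose i j \<circ> transpose (- i) (- j)"
        using False nz ij(3) by (auto simp: w rfl_def transpose_def fun_eq_iff)
      ultimately show ?thesis using ij
        by (simp add: sign_swap_id sign_compose permutation_swap_id)
    qed
    then show ?thesis using wB by (simp add: f_def)
  qed
  moreover have "f \<in> extensional (carrier (B n))" by (simp add: f_def)
  ultimately have "is_sgn n f" by (simp add: is_sgn_def)
  then show ?thesis by blast
qed

lemma is_sgn_unique:
  assumes f: "is_sgn n f" and g: "is_sgn n g"
  shows "f = g"
proof -
  have idB: "id \<in> carrier (B n)" by (simp add: carrier_B permutes_id)
  have one: "h id = 1" if "is_sgn n h" for h
  proof -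
    have h: "h \<in> hom (B n) sign_img" using that by (simp add: is_sgn_def)
    have "h (id \<otimes>\<^bsub>B n\<^esub> id) = h id * h id" using hom_mult[OF h idB idB] by (simp add: sign_img_def)
    moreover have "h id \<in> {-1, 1}" using hom_in_carrier[OF h idB] by (simp add: sign_img_def)
    ultimately show ?thesis by (auto simp: B_def)
  qed
  have step: "h (r \<circ> w) = - h w"
    if "is_sgn n h" "is_reflection n r" "w \<in> carrier (B n)" for h r w
  proof -
    have h: "h \<in> hom (B n) sign_img" using that by (simp add: is_sgn_def)
    have rB: "r \<in> carrier (B n)" using that by (simp add: is_reflection_def)
    show ?thesis using hom_mult[OF h rB that(3)] that(1,2)
      by (simp add: sign_img_def B_def is_sgn_def)
  qed
  have "f w = g w" if "w \<in> carrier (B n)" for w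
    using that
  proof (induction "card {i. w i \<noteq> i}" arbitrary: w rule: less_induct)
    case less
    have w: "w permutes pm n" and wo: "\<And>i. w (- i) = - w i" using less.prems by (auto simp: carrier_B)
    show ?case
    proof (cases "w = id")
      case True then show ?thesis using one[OF f] one[OF g] by simp
    next
      case False
      then obtain i where i: "w i \<noteq> i" by (auto simp: fun_eq_iff)
      then have im: "i \<in> pm n" using w by (auto simp: permutes_def)
      define j where "j = w i"
      have jm: "j \<in> pm n" unfolding j_def using im w by (simp add: permutes_in_image)
      have nz: "i \<noteq> 0" "j \<noteq> 0" using im jm by (auto simp: pm_def)
      define r where "r = rfl j i"
      have r: "is_reflection n r" unfolding r_def
        by (rule rfl_is_reflection) (use im jm i j_def in auto)
      have rw: "r \<circ> w \<in> carrier (B n)"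
        using r less.prems B_comp by (simp add: is_reflection_def)
      have "{k. (r \<circ> w) k \<noteq> k} \<subset> {k. w k \<noteq> k}"
      proof
        show "{k. (r \<circ> w) k \<noteq> k} \<subseteq> {k. w k \<noteq> k}"
        proof safe
          fix k assume k: "(r \<circ> w) k \<noteq> k" "w k = k"
          have "k \<noteq> i" using k i by auto
          moreover have "k \<noteq> - i" using k i wo by auto
          moreover have "k \<noteq> j" using k \<open>k \<noteq> i\<close> permutes_inj[OF w] by (metis injD j_def)
          moreover have "k \<noteq> - j" using k \<open>k \<noteq> - i\<close> permutes_inj[OF w] by (metis injD j_def wo)
          ultimately show False using k by (simp add: r_def rfl_def)
        qed
        have "(r \<circ> w) i = i" by (simp add: r_def rfl_def j_def)
        then have "i \<notin> {k. (r \<circ> w) k \<noteq> k}" by simp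
        with i show "{k. (r \<circ> w) k \<noteq> k} \<noteq> {k. w k \<noteq> k}" by blast
      qed
      moreover have "finite {k. w k \<noteq> k}"
        by (rule finite_subset[OF _ finite_pm[of n]]) (use w in \<open>auto simp: permutes_def\<close>)
      ultimately have "card {k. (r \<circ> w) k \<noteq> k} < card {k. w k \<noteq> k}"
        by (rule psubset_card_mono[rotated])
      from less.hyps[OF this rw] show ?thesis
        using step[OF f r less.prems] step[OF g r less.prems] by simp
    qed
  qed
  then show ?thesis using f g by (intro extensionalityI[of f "carrier (B n)" g]) (auto simp: is_sgn_def)
qed

lemma ex1_is_sgn: "\<exists>!f. is_sgn n f"
  using ex_is_sgn is_sgn_unique by blast

end

theory Submission
  imports Defs
begin

text \<open>
  Everything is read off from the action of an elementary abelian 2-group \<open>A\<close> of signed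
  permutations on the set \<open>pm n\<close>. Because \<open>A\<close> is abelian, it acts regularly on each of its orbits.
  If moreover it contains \<open>-1\<close>, an orbit is closed under negation and has \<open>2 ^ (k + 1)\<close> elements for
  some \<open>k\<close>, and these exponents \<open>k\<close> form an admissible partition, the orbit type. A group is called
  saturated if it contains \<open>-1\<close> and every signed permutation that commutes with it and preserves its
  orbits. Every elementary abelian \<open>E\<close> lies in a saturated group, \<open>localize n E\<close>, and the groups
  \<open>A_part e parts \<pi>\<close> are saturated of orbit type \<open>\<pi>\<close>. Choosing coordinates in the orbits shows that
  saturated groups of the same type are conjugate (\<open>saturated_conjugate\<close>). So a maximal elementary
  abelian subgroup of \<open>Bplus n\<close> is the even part, that is, the intersection with \<open>Bplus n\<close>, of a
  conjugate of some \<open>A_part e parts \<pi>\<close>.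

  The sign enters through the roots. The sign of \<open>w\<close> counts the positive roots that become negative,
  for any choice of one root from each opposite pair. If \<open>w\<close> normalises \<open>A\<close>, choose the positive roots in
  each \<open>A\<close>-orbit by means of a character of \<open>A\<close>. Then whether \<open>w\<close> reverses a root is again given by a
  character on that orbit, so all, none or half of the roots are reversed, and divisibility of the
  orbit sizes by powers of 2 makes the count even. In this way an element of \<open>A\<close> that moves only points
  in orbits of size at least 8 has sign 1 (\<open>sgn_elem\<close>), and a signed permutation that normalises \<open>A\<close>
  has sign 1 if all orbits have size at least 16 (\<open>sgn_normalizing\<close>). Conversely, an orbit of size 2 or 4
  supports a reflection in \<open>A\<close>, and an orbit of size 8 supports a reflection that normalises \<open>A\<close>. As a
  part \<open>2 ^ k\<close> of the type is an orbit of size \<open>2 ^ (k + 1)\<close>, this gives the two indices and decides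
  when a conjugacy class splits.

  It remains to compare \<open>A\<close> with its even part \<open>H\<close>. If \<open>A\<close> has a reflection that fixes a point, then \<open>H\<close>
  has the same orbit through that point as \<open>A\<close>. Hence the orbits of \<open>H\<close> and \<open>A\<close> agree up to sign,
  and \<open>A = localize n H\<close>, except in the special case where one orbit has size 4 and all others have size at
  least 8. In the special case \<open>localize n H\<close> splits the orbit of size 4 into two orbits of size 2, so
  that its type is irrelevant. Therefore \<open>H\<close> determines \<open>A\<close> among the saturated groups of relevant type
  (\<open>even_part_determines\<close>), which yields both the uniqueness of the partition and the equality of the
  normalisers. The even part of a group of relevant type is maximal (\<open>even_part_maximal\<close>), and a maximal
  subgroup whose localisation has irrelevant type is enlarged by a reflection that merges the two orbits
  of size 2 (\<open>maximal_is_even_part\<close>).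
\<close>

section \<open>Elementary abelian 2-groups of functions\<close>

text \<open>Elementary abelian 2-groups are sets of pairwise commuting involutive functions, on an arbitrary
  type: they act on the points \<open>\<plusminus>1, \<dots>, \<plusminus>n\<close> as well as on the roots.\<close>

locale elab =
  fixes A :: "('x \<Rightarrow> 'x) set"
  assumes id_in: "id \<in> A"
    and comp_in: "a \<in> A \<Longrightarrow> b \<in> A \<Longrightarrow> a \<circ> b \<in> A"
    and comm: "a \<in> A \<Longrightarrow> b \<in> A \<Longrightarrow> a (b x) = b (a x)"
    and sq: "a \<in> A \<Longrightarrow> a (a x) = x"

definition orb :: "('x \<Rightarrow> 'x) set \<Rightarrow> 'x \<Rightarrow> 'x set" where
  "orb A x = (\<lambda>a. a x) ` A"

lemma orbI: "a \<in> A \<Longrightarrow> a x \<in> orb A x"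
  by (auto simp: orb_def)

lemma orbE: "y \<in> orb A x \<Longrightarrow> (\<And>a. a \<in> A \<Longrightarrow> y = a x \<Longrightarrow> P) \<Longrightarrow> P"
  by (auto simp: orb_def)

context elab
begin

lemma orb_self: "x \<in> orb A x"
  using orbI[OF id_in] by simp

lemma orb_apply: assumes "a \<in> A" shows "orb A (a x) = orb A x"
proof -
  have "b (a x) \<in> orb A x" if "b \<in> A" for b
    using orbI[OF comp_in[OF that assms], of x] by simp
  moreover have "b x \<in> orb A (a x)" if "b \<in> A" for b
    using orbI[OF comp_in[OF that assms], of "a x"] sq[OF assms, of x] by simp
  ultimately show ?thesis by (auto elim!: orbE)
qed

lemma orb_eq: "y \<in> orb A x \<Longrightarrow> orb A y = orb A x"
  by (erule orbE) (simp add: orb_apply)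

lemma orb_avoid: "z \<notin> orb A x \<Longrightarrow> p \<in> orb A z \<Longrightarrow> p \<notin> orb A x"
  using orb_eq[of p x] orb_eq[of p z] orb_self[of z] by auto

text \<open>The action on an orbit is regular: the value at one point determines the restriction to the orbit.\<close>

lemma agree_on_orb:
  assumes "a \<in> A" "b \<in> A" "a x = b x" "y \<in> orb A x"
  shows "a y = b y"
proof -
  obtain c where c: "c \<in> A" "y = c x" using assms(4) by (rule orbE)
  then show ?thesis using comm[OF assms(1) c(1), of x] comm[OF assms(2) c(1), of x] assms(3) by simp
qed

lemma inj_elem: "a \<in> A \<Longrightarrow> inj a"
  using inj_on_inverseI[of UNIV a a] sq by simp

end

lemma even_card_free_involution:
  assumes "finite S" "\<And>x. x \<in> S \<Longrightarrow> f x \<in> S \<and> f (f x) = x \<and> f x \<noteq> x"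
  shows "even (card S)"
  using assms
proof (induction "card S" arbitrary: S rule: less_induct)
  case less
  show ?case
  proof (cases "S = {}")
    case False
    then obtain x where x: "x \<in> S" by blast
    let ?T = "S - {x, f x}"
    have fx: "f x \<in> S" "f x \<noteq> x" "f (f x) = x" using less.prems(2)[OF x] by auto
    have c: "card S = card ?T + 2"
      using x fx less.prems(1) card_mono[of S "{x, f x}"] by (subst card_Diff_subset) auto
    have "even (card ?T)"
    proof (rule less.hyps)
      show "card ?T < card S" using c by simp
      show "finite ?T" using less.prems(1) by simp
      fix y assume y: "y \<in> ?T"
      then have "f y \<in> S" "f (f y) = y" "f y \<noteq> y" using less.prems(2) by auto
      then show "f y \<in> ?T \<and> f (f y) = y \<and> f y \<noteq> y" using y fx by auto
    qed
    then show ?thesis using c by simp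
  qed simp
qed

text \<open>Used both to grow a subgroup towards a hyperplane and to enlarge a subgroup by a reflection.\<close>

lemma elab_adjoin:
  assumes A: "elab A" and s: "\<And>x. s (s x) = x" "\<And>a x. a \<in> A \<Longrightarrow> s (a x) = a (s x)"
  shows "elab (A \<union> (\<lambda>a. s \<circ> a) ` A)"
proof -
  interpret elab A by (rule A)
  let ?K = "A \<union> (\<lambda>a. s \<circ> a) ` A"
  have KI: "a \<in> ?K" "s \<circ> a \<in> ?K" if "a \<in> A" for a using that by auto
  have KE: thesis if k: "k \<in> ?K" and "k \<in> A \<Longrightarrow> thesis" "\<And>a. a \<in> A \<Longrightarrow> k = s \<circ> a \<Longrightarrow> thesis" for k thesis
    using that by auto
  have 1: "a \<circ> (s \<circ> b) = s \<circ> (a \<circ> b)" if "a \<in> A" for a b using s(2)[OF that] by (simp add: fun_eq_iff)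
  have 2: "s \<circ> (s \<circ> b) = b" for b using s(1) by (simp add: fun_eq_iff)
  have 3: "(s \<circ> a) \<circ> b = s \<circ> (a \<circ> b)" for a b by (simp add: comp_assoc)
  have comm': "a \<circ> b = b \<circ> a" if "a \<in> A" "b \<in> A" for a b using comm[OF that] by (simp add: fun_eq_iff)
  have mult: "k \<circ> l \<in> ?K \<and> k \<circ> l = l \<circ> k" if k: "k \<in> ?K" and l: "l \<in> ?K" for k l
  proof (rule KE[OF k]; rule KE[OF l])
    assume "k \<in> A" "l \<in> A"
    then show ?thesis using KI(1)[OF comp_in] comm' by simp
  next
    fix b assume "k \<in> A" "b \<in> A" "l = s \<circ> b"
    then show ?thesis using KI(2)[OF comp_in, of k b] comm'[of k b] by (simp only: 1 3)
  next
    fix a assume "a \<in> A" "k = s \<circ> a" "l \<in> A"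
    then show ?thesis using KI(2)[OF comp_in, of a l] comm'[of a l] by (simp only: 1 3)
  next
    fix a b assume "a \<in> A" "k = s \<circ> a" "b \<in> A" "l = s \<circ> b"
    then show ?thesis using KI(1)[OF comp_in, of a b] comm'[of a b] by (simp only: 1 2 3)
  qed
  show ?thesis
  proof
    show "id \<in> ?K" using KI(1)[OF id_in] .
    show "k \<circ> l \<in> ?K" if "k \<in> ?K" "l \<in> ?K" for k l using conjunct1[OF mult[OF that]] .
    show "k (l x) = l (k x)" if "k \<in> ?K" "l \<in> ?K" for k l x
      using conjunct2[OF mult[OF that]] by (simp add: fun_eq_iff)
    show "k (k x) = x" if k: "k \<in> ?K" for k x
    proof (rule KE[OF k])
      assume "k \<in> A" then show ?thesis by (rule sq)
    next
      fix a assume a: "a \<in> A" "k = s \<circ> a"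
      show ?thesis using s(1) s(2)[OF a(1)] sq[OF a(1)] by (simp add: a(2))
    qed
  qed
qed

text \<open>A maximal subgroup among those that do not move \<open>x\<close> to \<open>m x\<close> is a hyperplane modulo the
  stabiliser of \<open>x\<close>: it is the kernel of a linear character that is nontrivial on \<open>m\<close>.\<close>

lemma (in elab) ex_hyperplane:
  assumes fin: "finite A" and m: "m \<in> A" "m x \<noteq> x"
  shows "\<exists>H \<subseteq> A. elab H \<and> (\<forall>h\<in>H. h x \<noteq> m x) \<and> (\<forall>a\<in>A. \<exists>h\<in>H. a x = h x \<or> a x = m (h x))"
proof -
  define F where "F = {H. H \<subseteq> A \<and> elab H \<and> (\<forall>h\<in>H. h x \<noteq> m x)}"
  have "finite F" unfolding F_def by (rule finite_subset[of _ "Pow A"]) (use fin in auto)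
  moreover have "{id} \<in> F" using m id_in by (auto simp: F_def elab_def)
  ultimately obtain H where H: "H \<in> F" and mx: "\<And>K. K \<in> F \<Longrightarrow> H \<subseteq> K \<Longrightarrow> H = K"
    using finite_has_maximal[of F] by (metis empty_iff)
  have HA: "\<And>h. h \<in> H \<Longrightarrow> h \<in> A" using H by (auto simp: F_def)
  interpret H: elab H using H by (simp add: F_def)
  have "\<exists>h\<in>H. a x = h x \<or> a x = m (h x)" if a: "a \<in> A" for a
  proof (rule ccontr)
    assume no: "\<not> ?thesis"
    define K where "K = H \<union> (\<lambda>h. a \<circ> h) ` H"
    have KA: "K \<subseteq> A" unfolding K_def using HA comp_in[OF a] by auto
    have "elab K" unfolding K_def
      by (rule elab_adjoin[OF H.elab_axioms sq[OF a] comm[OF a HA]])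
    moreover have "k x \<noteq> m x" if kK: "k \<in> K" for k
    proof
      assume eq: "k x = m x"
      have "k \<notin> H" using eq H by (auto simp: F_def)
      then obtain h where h: "h \<in> H" "k = a \<circ> h" using kK by (auto simp: K_def)
      have "a x = h (k x)" using h comm[OF a HA[OF h(1)]] sq[OF HA[OF h(1)]] by simp
      also have "\<dots> = m (h x)" using eq comm[OF m(1) HA[OF h(1)]] by simp
      finally show False using no h(1) by auto
    qed
    ultimately have "H = K" using KA by (intro mx) (auto simp: F_def K_def)
    moreover have "a \<in> K" unfolding K_def using image_eqI[of a "\<lambda>h. a \<circ> h" id H] H.id_in by simp
    ultimately have "a \<in> H" by simp
    then show False using no by auto
  qed
  then show ?thesis using H unfolding F_def by (intro exI[of _ H]) simp
qed

text \<open>On every orbit, \<open>\<chi>\<close> is a character that takes the value \<open>-1\<close> at \<open>m\<close>, transported to the orbit by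
  a base point. The last identity expresses this without mentioning base points or characters.\<close>

lemma (in elab) ex_sign_character:
  assumes fin: "finite A" and m: "m \<in> A" and S: "\<And>x. x \<in> S \<Longrightarrow> m x \<noteq> x"
  shows "\<exists>\<chi>::'x \<Rightarrow> int. (\<forall>x. \<chi> x = 1 \<or> \<chi> x = -1) \<and> (\<forall>x\<in>S. \<chi> (m x) = - \<chi> x) \<and>
     (\<forall>x\<in>S. \<forall>a\<in>A. \<forall>b\<in>A. \<chi> (a (b x)) * \<chi> x = \<chi> (a x) * \<chi> (b x))"
proof -
  define rep where "rep x = (SOME y. y \<in> orb A x)" for x
  have rep: "rep x \<in> orb A x" for x unfolding rep_def by (rule someI, rule orb_self)
  define good where "good y H \<longleftrightarrow> H \<subseteq> A \<and> elab H \<and> (\<forall>h\<in>H. h y \<noteq> m y) \<and>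
    (\<forall>a\<in>A. \<exists>h\<in>H. a y = h y \<or> a y = m (h y))" for y H
  define H where "H y = (SOME H. good y H)" for y
  have good: "good y (H y)" if "m y \<noteq> y" for y
    unfolding H_def by (rule someI_ex) (use ex_hyperplane[OF fin m that] in \<open>auto simp: good_def\<close>)
  define \<chi> where "\<chi> x = (if \<exists>h\<in>H (rep x). x = h (rep x) then 1 else -1 :: int)" for x
  have main: "\<chi> (m x) = - \<chi> x \<and> (\<forall>a\<in>A. \<forall>b\<in>A. \<chi> (a (b x)) * \<chi> x = \<chi> (a x) * \<chi> (b x))"
    if "x \<in> S" for x
  proof -
    define y where "y = rep x"
    obtain c where c: "c \<in> A" "x = c y" using rep[of x] orbE[of y A x] sq unfolding y_def by metis
    have my: "m y \<noteq> y" using S[OF that] c(2) comm[OF m c(1)] by metis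
    have g: "H y \<subseteq> A" "elab (H y)" "\<And>h. h \<in> H y \<Longrightarrow> h y \<noteq> m y"
      "\<And>a. a \<in> A \<Longrightarrow> \<exists>h\<in>H y. a y = h y \<or> a y = m (h y)"
      using good[OF my] by (auto simp: good_def)
    \<comment> \<open>As a function of the group element, \<open>\<chi>\<close> is the character with kernel \<open>H y\<close>.\<close>
    define P where "P a = (if \<exists>h\<in>H y. a y = h y then 1 else -1 :: int)" for a
    have P: "\<chi> (a y) = P a" if "a \<in> A" for a
    proof -
      have "orb A (a y) = orb A x" using orb_apply[OF that, of y] orb_apply[OF c(1), of y] c(2) by simp
      then have "rep (a y) = y" by (simp add: rep_def y_def)
      then show ?thesis by (simp add: \<chi>_def P_def)
    qed
    have hh: "h (h' z) = h' (h z)" "h (h z) = z" if "h \<in> H y" "h' \<in> A" for h h' z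
    proof -
      have "h \<in> A" using that g(1) by blast
      then show "h (h' z) = h' (h z)" "h (h z) = z" by (rule comm[OF _ that(2)], rule sq)
    qed
    have mult: "h \<circ> h' \<in> H y" if "h \<in> H y" "h' \<in> H y" for h h'
      using that g(2) by (simp add: elab.comp_in)
    have P1: "P a = 1" if "a \<in> A" "h \<in> H y" "a y = h y" for a h using that by (auto simp: P_def)
    have Pm1: "P a = -1" if "a \<in> A" "h \<in> H y" "a y = m (h y)" for a h
    proof -
      have False if h': "h' \<in> H y" "a y = h' y" for h'
      proof -
        have "(h \<circ> h') y = h (m (h y))" using h' \<open>a y = m (h y)\<close> by simp
        also have "\<dots> = m y" using hh(1)[OF \<open>h \<in> H y\<close> m] hh(2)[OF \<open>h \<in> H y\<close> m] by simp
        finally show False using g(3)[OF mult[OF \<open>h \<in> H y\<close> h'(1)]] by simp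
      qed
      then show ?thesis by (auto simp: P_def)
    qed
    have Pm: "P (m \<circ> a) = - P a" if a: "a \<in> A" for a
    proof -
      obtain h where h: "h \<in> H y" "a y = h y \<or> a y = m (h y)" using g(4)[OF a] by auto
      have ma: "m \<circ> a \<in> A" using m a comp_in by blast
      from h(2) show ?thesis
      proof
        assume e: "a y = h y"
        then show ?thesis using P1[OF a h(1) e] Pm1[OF ma h(1)] by simp
      next
        assume e: "a y = m (h y)"
        then show ?thesis using Pm1[OF a h(1) e] P1[OF ma h(1)] sq[OF m] by simp
      qed
    qed
    have Pmult: "P (a \<circ> b) = P a * P b" if a: "a \<in> A" and b: "b \<in> A" for a b
    proof -
      obtain h where h: "h \<in> H y" "a y = h y \<or> a y = m (h y)" using g(4)[OF a] by auto
      obtain k where k: "k \<in> H y" "b y = k y \<or> b y = m (k y)" using g(4)[OF b] by blast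
      have ab: "a \<circ> b \<in> A" using a b comp_in by blast
      have kA: "k \<in> A" "h \<in> A" using k h g(1) by auto
      have e1: "a (k z) = k (a z)" "a (m z) = m (a z)" "k (m z) = m (k z)" "m (m z) = z" "k (h z) = h (k z)" for z
        by (rule comm[OF a kA(1)], rule comm[OF a m], rule comm[OF kA(1) m], rule sq[OF m], rule comm[OF kA])
      have "P (a \<circ> b) = 1" if "(a \<circ> b) y = (h \<circ> k) y"
        using P1[OF ab mult[OF h(1) k(1)] that] .
      moreover have "P (a \<circ> b) = -1" if "(a \<circ> b) y = m ((h \<circ> k) y)"
        using Pm1[OF ab mult[OF h(1) k(1)] that] .
      moreover have "P a = 1" if "a y = h y" using P1[OF a h(1) that] .
      moreover have "P a = -1" if "a y = m (h y)" using Pm1[OF a h(1) that] .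
      moreover have "P b = 1" if "b y = k y" using P1[OF b k(1) that] .
      moreover have "P b = -1" if "b y = m (k y)" using Pm1[OF b k(1) that] .
      moreover have "(a \<circ> b) y = (h \<circ> k) y" if "a y = h y" "b y = k y" using that e1 by simp
      moreover have "(a \<circ> b) y = (h \<circ> k) y" if "a y = m (h y)" "b y = m (k y)" using that e1 by simp
      moreover have "(a \<circ> b) y = m ((h \<circ> k) y)" if "a y = h y" "b y = m (k y)" using that e1 by simp
      moreover have "(a \<circ> b) y = m ((h \<circ> k) y)" if "a y = m (h y)" "b y = k y" using that e1 by simp
      ultimately show ?thesis using h(2) k(2) by (elim disjE) simp_all
    qed
    have e2: "\<chi> (a x) = P a * P c" if "a \<in> A" for a
      using P[OF comp_in[OF that c(1)]] Pmult[OF that c(1)] c(2) by simp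
    have Pc: "\<chi> x = P c" using P[OF c(1)] c(2) by simp
    have Pcc: "P c * P c = 1" by (simp add: P_def)
    have "\<chi> (m x) = - \<chi> x" using P[OF comp_in[OF m c(1)]] Pm[OF c(1)] c(2) Pc by simp
    moreover have "\<chi> (a (b x)) * \<chi> x = \<chi> (a x) * \<chi> (b x)" if ab: "a \<in> A" "b \<in> A" for a b
      using e2[OF comp_in[OF ab]] Pmult[OF ab] e2[OF ab(1)] e2[OF ab(2)] Pc Pcc by (simp add: mult_ac)
    ultimately show ?thesis by blast
  qed
  have "\<forall>x. \<chi> x = 1 \<or> \<chi> x = -1" by (simp add: \<chi>_def)
  with main show ?thesis by (intro exI[of _ \<chi>] conjI) simp_all
qed

definition vadd :: "(nat \<Rightarrow> bit) \<Rightarrow> (nat \<Rightarrow> bit) \<Rightarrow> nat \<Rightarrow> bit" where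
  "vadd u v = (\<lambda>j. u j + v j)"

text \<open>The first basis vector; in coordinates on an orbit it will stand for negation.\<close>

definition e0 :: "nat \<Rightarrow> bit" where
  "e0 = (\<lambda>j. if j = 0 then 1 else 0)"

lemma V_0: "V 0 = {\<lambda>_. 0}" by (auto simp: V_def)

lemma V_Suc: "V (Suc k) = V k \<union> (\<lambda>v. v(k := 1)) ` V k"
proof -
  have "v \<in> V k \<union> (\<lambda>v. v(k := 1)) ` V k" if v: "v \<in> V (Suc k)" for v
  proof (cases "v k = 0")
    case True
    have "v i = 0" if "i \<ge> k" for i
      using that v True by (cases "i = k") (auto simp: V_def)
    then show ?thesis by (simp add: V_def)
  next
    case False
    then have "v = (v(k := 0))(k := 1)" by (auto simp: fun_eq_iff)
    moreover have "(v(k := 0)) \<in> V k" using v by (auto simp: V_def)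
    ultimately show ?thesis by blast
  qed
  then show ?thesis by (auto simp: V_def)
qed

lemma card_V: "finite (V k) \<and> card (V k) = 2 ^ k"
proof (induction k)
  case 0 then show ?case by (simp add: V_0)
next
  case (Suc k)
  have inj: "inj_on (\<lambda>v. v(k := 1)) (V k)"
  proof (rule inj_onI)
    fix u v assume uv: "u \<in> V k" "v \<in> V k" "u(k := 1) = v(k := 1)"
    have "u k = v k" using uv by (simp add: V_def)
    then show "u = v" using uv(3) by (metis fun_upd_triv fun_upd_upd)
  qed
  have "V k \<inter> (\<lambda>v. v(k := 1)) ` V k = {}" by (auto simp: V_def)
  then show ?case using Suc inj by (simp add: V_Suc card_Un_disjoint card_image)
qed

lemma vadd_V: "u \<in> V k \<Longrightarrow> v \<in> V k \<Longrightarrow> vadd u v \<in> V k"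
  by (auto simp: V_def vadd_def)

text \<open>A transitive elementary abelian 2-group is regular, so that it can be coordinatised by \<open>V m\<close>;
  the first basis vector can be any prescribed fixed-point-free element \<open>c\<close>.\<close>

lemma (in elab) ex_chart:
  assumes fin: "finite A" and c: "c \<in> A" "c x \<noteq> x"
  shows "\<exists>m \<phi>. e0 \<in> V m \<and> \<phi> ` V m \<subseteq> A \<and> \<phi> e0 = c \<and>
     (\<forall>u\<in>V m. \<forall>v\<in>V m. \<phi> (vadd u v) = \<phi> u \<circ> \<phi> v) \<and> bij_betw (\<lambda>v. \<phi> v x) (V m) (orb A x)"
proof -
  define good where "good m \<phi> \<longleftrightarrow> e0 \<in> V m \<and> \<phi> ` V m \<subseteq> A \<and> \<phi> e0 = c \<and>
     (\<forall>u\<in>V m. \<forall>v\<in>V m. \<phi> (vadd u v) = \<phi> u \<circ> \<phi> v) \<and> inj_on (\<lambda>v. \<phi> v x) (V m)" for m \<phi>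
  have fo: "finite (orb A x)" using fin by (simp add: orb_def)
  have bound: "m \<le> card (orb A x)" if g: "good m \<phi>" for m \<phi>
  proof -
    have "(\<lambda>v. \<phi> v x) ` V m \<subseteq> orb A x" using g by (auto simp: good_def orb_def)
    then have "2 ^ m \<le> card (orb A x)"
      using g card_V[of m] card_image[of "\<lambda>v. \<phi> v x" "V m"] card_mono[OF fo, of "(\<lambda>v. \<phi> v x) ` V m"]
      by (simp add: good_def)
    then show ?thesis using less_exp[of m] by linarith
  qed
  have "good 1 (\<lambda>v. if v 0 = 1 then c else id)"
  proof -
    have "(\<lambda>_. 0 :: bit)(0 := 1) = e0" by (simp add: e0_def fun_eq_iff)
    then have V1: "V 1 = {\<lambda>_. 0, e0}" using V_Suc[of 0] by (simp add: V_0 insert_commute)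
    have cc: "c \<circ> c = id" using sq[OF c(1)] by (simp add: fun_eq_iff)
    have e00: "e0 0 = 1" by (simp add: e0_def)
    show ?thesis unfolding good_def V1
    proof (intro conjI)
      show "inj_on (\<lambda>v. (if v 0 = 1 then c else id) x) {\<lambda>_. 0, e0}"
        using c(2) by (simp add: inj_on_def e00)
      show "\<forall>u\<in>{\<lambda>_. 0, e0}. \<forall>v\<in>{\<lambda>_. 0, e0}. (if vadd u v 0 = 1 then c else id)
          = (if u 0 = 1 then c else id) \<circ> (if v 0 = 1 then c else id)"
        using cc by (simp add: e00 vadd_def)
    qed (use c id_in e00 in auto)
  qed
  then have ex: "\<exists>\<phi>. good 1 \<phi>" by (rule exI[where P = "good 1"])
  \<comment> \<open>A partial coordinatisation that misses a point \<open>a x\<close> extends by \<open>a\<close> as a new basis vector, so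
    that one of maximal dimension covers the orbit.\<close>
  define M where "M = (GREATEST m. \<exists>\<phi>. good m \<phi>)"
  have "\<exists>\<phi>. good M \<phi>" unfolding M_def
    by (rule GreatestI_nat[where k = 1 and b = "card (orb A x)"], rule ex) (elim exE, rule bound)
  then obtain \<phi> where \<phi>: "good M \<phi>" by (rule exE)
  have "orb A x \<subseteq> (\<lambda>v. \<phi> v x) ` V M"
  proof (rule ccontr)
    assume "\<not> ?thesis"
    then obtain z where z: "z \<in> orb A x" "z \<notin> (\<lambda>v. \<phi> v x) ` V M" unfolding subset_iff by auto
    obtain a where a: "a \<in> A" "z = a x" using z(1) by (rule orbE)
    have nz: "a x \<noteq> \<phi> v x" if "v \<in> V M" for v using z(2) a(2) that by auto
    define \<psi> where "\<psi> v = (if v M = 1 then a \<circ> \<phi> (v(M := 0)) else \<phi> v)" for v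
    have \<phi>A: "\<And>v. v \<in> V M \<Longrightarrow> \<phi> v \<in> A" and \<phi>e: "\<phi> e0 = c" and eV: "e0 \<in> V M"
      and \<phi>m: "\<And>u v. u \<in> V M \<Longrightarrow> v \<in> V M \<Longrightarrow> \<phi> (vadd u v) = \<phi> u \<circ> \<phi> v"
      and \<phi>i: "inj_on (\<lambda>v. \<phi> v x) (V M)"
      using \<phi> by (auto simp: good_def)
    have low: "v(M := 0) \<in> V M" if "v \<in> V (Suc M)" for v
    proof -
      have "(v(M := 0)) i = 0" if "i \<ge> M" for i
        using that \<open>v \<in> V (Suc M)\<close> by (cases "i = M") (auto simp: V_def)
      then show ?thesis by (simp add: V_def)
    qed
    have \<psi>: "\<psi> v = (if v M = 1 then a else id) \<circ> \<phi> (v(M := 0))" for v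
      by (auto simp: \<psi>_def fun_upd_idem)
    have \<psi>A: "\<psi> v \<in> A" if "v \<in> V (Suc M)" for v
      unfolding \<psi> using a(1) id_in \<phi>A[OF low[OF that]] comp_in by auto
    have "good (Suc M) \<psi>" unfolding good_def
    proof (intro conjI ballI)
      show "e0 \<in> V (Suc M)" using eV by (auto simp: V_def)
      show "\<psi> ` V (Suc M) \<subseteq> A" using \<psi>A by auto
      have "e0 M = 0" using eV by (simp add: V_def)
      then show "\<psi> e0 = c" using \<phi>e by (simp add: \<psi>_def)
    next
      fix u v assume uv: "u \<in> V (Suc M)" "v \<in> V (Suc M)"
      have 1: "(vadd u v)(M := 0) = vadd (u(M := 0)) (v(M := 0))" by (auto simp: vadd_def)
      have "\<phi> (u(M := 0)) (a z) = a (\<phi> (u(M := 0)) z)" for z by (rule comm[OF \<phi>A[OF low[OF uv(1)]] a(1)])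
      then show "\<psi> (vadd u v) = \<psi> u \<circ> \<psi> v"
        unfolding \<psi> 1 \<phi>m[OF low[OF uv(1)] low[OF uv(2)]] using sq[OF a(1)]
        by (cases "u M"; cases "v M") (simp_all add: fun_eq_iff vadd_def)
    next
      have key: False if u: "u \<in> V (Suc M)" "u M = 1" and v: "v \<in> V (Suc M)" "v M \<noteq> 1"
        and eq: "\<psi> u x = \<psi> v x" for u v
      proof -
        let ?u = "u(M := 0)" and ?v = "v(M := 0)"
        have e: "\<phi> ?v x = a (\<phi> ?u x)" using eq u v by (simp add: \<psi>)
        have "a x = \<phi> ?u (a (\<phi> ?u x))"
          using comm[OF a(1) \<phi>A[OF low[OF u(1)]], of x] sq[OF \<phi>A[OF low[OF u(1)]], of "a x"] by simp
        also have "\<dots> = \<phi> (vadd ?u ?v) x" using \<phi>m[OF low[OF u(1)] low[OF v(1)]] e by simp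
        finally show False using nz[OF vadd_V[OF low[OF u(1)] low[OF v(1)]]] by simp
      qed
      show "inj_on (\<lambda>v. \<psi> v x) (V (Suc M))"
      proof (rule inj_onI)
        fix u v assume uv: "u \<in> V (Suc M)" "v \<in> V (Suc M)" "\<psi> u x = \<psi> v x"
        have M: "u M = v M" using key[of u v] key[of v u] uv by (cases "u M"; cases "v M") auto
        then have "\<phi> (u(M := 0)) x = \<phi> (v(M := 0)) x"
          using uv(3) inj_elem[OF a(1)] by (auto simp: \<psi> dest: injD split: if_splits)
        then have "u(M := 0) = v(M := 0)" using \<phi>i low[OF uv(1)] low[OF uv(2)] by (auto dest: inj_onD)
        then show "u = v" using M by (metis fun_upd_triv fun_upd_upd)
      qed
    qed
    then have "\<exists>\<phi>. good (Suc M) \<phi>" by (rule exI[where P = "good (Suc M)"])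
    then have "Suc M \<le> M" unfolding M_def
      by (rule Greatest_le_nat[where b = "card (orb A x)"]) (elim exE, rule bound)
    then show False by simp
  qed
  moreover have "(\<lambda>v. \<phi> v x) ` V M \<subseteq> orb A x" using \<phi> by (auto simp: good_def orb_def)
  ultimately have "(\<lambda>v. \<phi> v x) ` V M = orb A x" by (rule subset_antisym[rotated])
  then show ?thesis using \<phi> unfolding good_def bij_betw_def
    by (intro exI[of _ M] exI[of _ \<phi>]) simp
qed

lemma (in elab) card_orb:
  assumes "finite A" "c \<in> A" "c x \<noteq> x"
  shows "\<exists>m\<ge>1. card (orb A x) = 2 ^ m"
proof -
  obtain m \<phi> where m: "e0 \<in> V m" "bij_betw (\<lambda>v. (\<phi> v :: 'x \<Rightarrow> 'x) x) (V m) (orb A x)"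
    using ex_chart[OF assms] by (elim exE conjE) (rule that)
  have "e0 0 \<noteq> 0" by (simp add: e0_def)
  then have "m \<noteq> 0" using m(1) by (auto simp: V_def)
  moreover have "card (orb A x) = 2 ^ m" using bij_betw_same_card[OF m(2)] card_V[of m] by simp
  ultimately show ?thesis by (intro exI[of _ m]) simp
qed

section \<open>The hyperoctahedral group and its sign\<close>

abbreviation finv :: "(int \<Rightarrow> int) \<Rightarrow> int \<Rightarrow> int" where
  "finv \<equiv> Hilbert_Choice.inv"

lemma B_mult [simp]: "w \<otimes>\<^bsub>B n\<^esub> v = w \<circ> v" by (simp add: B_def)

lemma B_one [simp]: "\<one>\<^bsub>B n\<^esub> = id" by (simp add: B_def)

lemma finite_B: "finite (carrier (B n))"
  by (rule finite_subset[OF _ finite_permutations[OF finite_pm]]) (auto simp: carrier_B)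

lemma id_B: "id \<in> carrier (B n)" by (simp add: carrier_B permutes_id)

lemma B_permutes: "w \<in> carrier (B n) \<Longrightarrow> w permutes pm n" by (simp add: carrier_B)

lemma B_odd: "w \<in> carrier (B n) \<Longrightarrow> w (- i) = - w i" by (simp add: carrier_B)

lemma B_inj: "w \<in> carrier (B n) \<Longrightarrow> w i = w j \<longleftrightarrow> i = j"
  using permutes_inj[OF B_permutes] by (auto dest: injD)

lemma B_bij: "w \<in> carrier (B n) \<Longrightarrow> bij w"
  using permutes_bij[OF B_permutes] .

lemma B_pm: "w \<in> carrier (B n) \<Longrightarrow> w i \<in> pm n \<longleftrightarrow> i \<in> pm n"
  using permutes_in_image[OF B_permutes] .

lemma B_fix: "w \<in> carrier (B n) \<Longrightarrow> i \<notin> pm n \<Longrightarrow> w i = i"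
  using B_permutes by (auto simp: permutes_def)

lemma finv_right: "w \<in> carrier (B n) \<Longrightarrow> w (finv w i) = i"
  by (simp add: permutes_inverses(1)[OF B_permutes])

lemma finv_left: "w \<in> carrier (B n) \<Longrightarrow> finv w (w i) = i"
  by (simp add: permutes_inverses(2)[OF B_permutes])

lemma finv_B: assumes w: "w \<in> carrier (B n)" shows "finv w \<in> carrier (B n)"
proof -
  have "finv w (- i) = - finv w i" for i
    by (metis finv_right finv_left B_odd w)
  then show ?thesis using permutes_inv[OF B_permutes[OF w]] by (simp add: carrier_B)
qed

lemma finv_finv: "w \<in> carrier (B n) \<Longrightarrow> finv (finv w) = w"
  using permutes_inv_inv[OF B_permutes] .

lemma comp_finv: "w \<in> carrier (B n) \<Longrightarrow> w \<circ> finv w = id"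
  by (simp add: fun_eq_iff finv_right)

lemma finv_comp: "w \<in> carrier (B n) \<Longrightarrow> finv w \<circ> w = id"
  by (simp add: fun_eq_iff finv_left)

lemma finv_comp_distrib: "u \<in> carrier (B n) \<Longrightarrow> w \<in> carrier (B n) \<Longrightarrow> finv (u \<circ> w) = finv w \<circ> finv u"
  using o_inv_distrib[OF B_bij B_bij] .

lemma group_B: "group (B n)"
proof (rule groupI)
  fix x assume x: "x \<in> carrier (B n)"
  show "\<exists>y\<in>carrier (B n). y \<otimes>\<^bsub>B n\<^esub> x = \<one>\<^bsub>B n\<^esub>"
    using finv_B[OF x] finv_comp[OF x] by auto
qed (auto simp: B_comp id_B comp_assoc)

lemma inv_B: "w \<in> carrier (B n) \<Longrightarrow> inv\<^bsub>B n\<^esub> w = finv w"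
  by (rule group.inv_equality[OF group_B]) (auto simp: finv_comp finv_B)

lemma pm_uminus [simp]: "- i \<in> pm n \<longleftrightarrow> i \<in> pm n" by (auto simp: pm_def)

lemma inj_in_B:
  assumes "inj_on w (pm n)" "\<And>i. i \<in> pm n \<Longrightarrow> w i \<in> pm n" "\<And>i. i \<notin> pm n \<Longrightarrow> w i = i"
    "\<And>i. w (- i) = - w i"
  shows "w \<in> carrier (B n)"
proof -
  have "w ` pm n = pm n" by (rule endo_inj_surj[OF finite_pm _ assms(1)]) (use assms(2) in auto)
  then have "bij_betw w (pm n) (pm n)" using assms(1) by (simp add: bij_betw_def)
  then have "w permutes pm n" using assms(3) by (rule bij_imp_permutes)
  then show ?thesis using assms(4) by (simp add: carrier_B)
qed

lemma involution_in_B: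
  assumes "\<And>i. w (w i) = i" "\<And>i. i \<notin> pm n \<Longrightarrow> w i = i" "\<And>i. w (- i) = - w i"
  shows "w \<in> carrier (B n)"
proof -
  have "\<exists>!j. w j = i" for i using assms(1) by metis
  then show ?thesis using assms(2,3) by (simp add: carrier_B permutes_def)
qed

lemma neg_all_B: "neg_all n \<in> carrier (B n)"
  by (rule involution_in_B) (simp_all add: neg_all_def)

lemma pm_nz: "i \<in> pm n \<Longrightarrow> i \<noteq> 0" by (auto simp: pm_def)

lemma is_sgn_sgn_B: "is_sgn n (sgn_B n)"
  unfolding sgn_B_def by (rule theI'[OF ex1_is_sgn])

lemma sgn_unique: "is_sgn n f \<Longrightarrow> f = sgn_B n"
  using ex1_is_sgn is_sgn_sgn_B by blast

lemma sgn_comp: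
  "w \<in> carrier (B n) \<Longrightarrow> v \<in> carrier (B n) \<Longrightarrow> sgn_B n (w \<circ> v) = sgn_B n w * sgn_B n v"
  using is_sgn_sgn_B[of n] hom_mult[of "sgn_B n" "B n" sign_img w v] by (simp add: is_sgn_def sign_img_def)

lemma sgn_cases: "w \<in> carrier (B n) \<Longrightarrow> sgn_B n w = 1 \<or> sgn_B n w = -1"
  using is_sgn_sgn_B[of n] hom_in_carrier[of "sgn_B n" "B n" sign_img w] by (auto simp: is_sgn_def sign_img_def)

lemma sgn_rfl: "i \<in> pm n \<Longrightarrow> j \<in> pm n \<Longrightarrow> i \<noteq> j \<Longrightarrow> sgn_B n (rfl i j) = -1"
  using is_sgn_sgn_B[of n] rfl_is_reflection by (simp add: is_sgn_def)

lemma sgn_id: "sgn_B n id = 1"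
  using sgn_comp[OF id_B id_B, of n] sgn_cases[OF id_B, of n] by auto

lemma sgn_finv: "w \<in> carrier (B n) \<Longrightarrow> sgn_B n (finv w) = sgn_B n w"
  using sgn_comp[of w n "finv w"] sgn_cases[of w n] sgn_cases[of "finv w" n]
  by (auto simp: comp_finv sgn_id finv_B)

lemma sgn_conj: "g \<in> carrier (B n) \<Longrightarrow> w \<in> carrier (B n) \<Longrightarrow> sgn_B n (g \<circ> w \<circ> finv g) = sgn_B n w"
  using sgn_cases[of g n] by (auto simp: sgn_comp finv_B B_comp sgn_finv)

lemma carrier_Bplus: "w \<in> carrier (Bplus n) \<longleftrightarrow> w \<in> carrier (B n) \<and> sgn_B n w = 1"
  by (auto simp: Bplus_def kernel_def sign_img_def)

section \<open>Reading off the sign from the roots\<close>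

text \<open>\<open>rt i j\<close> is the root \<open>b i - b j\<close>, as the function that assigns to \<open>k\<close> the \<open>k\<close>-th coordinate.\<close>

definition rt :: "int \<Rightarrow> int \<Rightarrow> int \<Rightarrow> int" where
  "rt i j k = (if k = i then 1 else 0) - (if k = - i then 1 else 0)
     - (if k = j then 1 else 0) + (if k = - j then 1 else 0)"

text \<open>Roots of both lengths occur: \<open>j = - i\<close> gives \<open>2 b i\<close>.\<close>

definition rts :: "nat \<Rightarrow> (int \<Rightarrow> int) set" where
  "rts n = {rt i j | i j. i \<in> pm n \<and> j \<in> pm n \<and> i \<noteq> j}"

definition opp :: "(int \<Rightarrow> int) \<Rightarrow> int \<Rightarrow> int" where
  "opp r k = - r k"

lemma rt_opp: "opp (rt i j) = rt j i" by (auto simp: opp_def rt_def)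

lemma rt_flip: "rt (- j) (- i) = rt i j" by (auto simp: rt_def)

lemma rt_pos_iff:
  assumes "i \<noteq> 0" "j \<noteq> 0" "i \<noteq> j" shows "0 < rt i j x \<longleftrightarrow> x = i \<or> x = - j"
proof (cases "x = i \<or> x = - j")
  case True
  then have "x \<noteq> - i" "x \<noteq> j" using assms by auto
  then show ?thesis using True by (auto simp: rt_def)
qed (simp add: rt_def)

lemma rt_eq_iff:
  assumes "i \<noteq> 0" "j \<noteq> 0" "k \<noteq> 0" "l \<noteq> 0" "i \<noteq> j" "k \<noteq> l"
  shows "rt k l = rt i j \<longleftrightarrow> (k = i \<and> l = j) \<or> (k = - j \<and> l = - i)"
proof
  assume eq: "rt k l = rt i j"
  have "x = k \<or> x = - l \<longleftrightarrow> x = i \<or> x = - j" for x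
    using rt_pos_iff[of i j x] rt_pos_iff[of k l x] assms eq by simp
  from this[of k] this[of "- l"] this[of i] this[of "- j"]
  show "(k = i \<and> l = j) \<or> (k = - j \<and> l = - i)" by auto
next
  assume "(k = i \<and> l = j) \<or> (k = - j \<and> l = - i)"
  then show "rt k l = rt i j" using rt_flip by blast
qed

lemma rtsI: "i \<in> pm n \<Longrightarrow> j \<in> pm n \<Longrightarrow> i \<noteq> j \<Longrightarrow> rt i j \<in> rts n"
  unfolding rts_def by blast

lemma rtsE:
  assumes "r \<in> rts n"
  obtains i j where "i \<in> pm n" "j \<in> pm n" "i \<noteq> j" "r = rt i j"
  using assms unfolding rts_def by blast

lemma finite_rts: "finite (rts n)"
proof -
  have "rts n \<subseteq> (\<lambda>(i, j). rt i j) ` (pm n \<times> pm n)" by (auto simp: rts_def)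
  then show ?thesis by (rule finite_subset) auto
qed

lemma rt_act: assumes "w \<in> carrier (B n)" shows "rt i j \<circ> finv w = rt (w i) (w j)"
proof
  fix k
  have "finv w k = x \<longleftrightarrow> k = w x" for x by (metis assms finv_left finv_right)
  then show "(rt i j \<circ> finv w) k = rt (w i) (w j) k"
    by (simp add: rt_def B_odd[OF assms, symmetric])
qed

lemma rts_act: assumes w: "w \<in> carrier (B n)" and r: "r \<in> rts n" shows "r \<circ> finv w \<in> rts n"
proof -
  obtain i j where ij: "i \<in> pm n" "j \<in> pm n" "i \<noteq> j" "r = rt i j" using r by (rule rtsE)
  then show ?thesis using B_pm[OF w] B_inj[OF w] by (simp add: rt_act[OF w] rtsI)
qed

lemma rts_opp: "r \<in> rts n \<Longrightarrow> opp r \<in> rts n"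
  by (erule rtsE) (simp add: rt_opp rtsI)

lemma opp_opp: "opp (opp r) = r" by (simp add: opp_def fun_eq_iff)

lemma opp_comp: "opp r \<circ> g = opp (r \<circ> g)" by (auto simp: opp_def)

lemma opp_neq: "r \<in> rts n \<Longrightarrow> opp r \<noteq> r"
proof
  assume r: "r \<in> rts n" and eq: "opp r = r"
  obtain i j where ij: "i \<in> pm n" "j \<in> pm n" "i \<noteq> j" "r = rt i j" using r by (rule rtsE)
  then have "r i > 0" using rt_pos_iff[of i j i] pm_nz[of i n] pm_nz[of j n] by simp
  moreover have "- r i = r i" using eq by (metis opp_def)
  ultimately show False by simp
qed

lemma even_opp_closed:
  assumes "S \<subseteq> rts n" "\<And>r. r \<in> S \<Longrightarrow> opp r \<in> S" shows "even (card S)"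
  by (rule even_card_free_involution[where f = opp])
     (use assms finite_subset[OF assms(1) finite_rts] opp_opp opp_neq in auto)

lemma rfl_moved:
  assumes "rfl i j x \<noteq> x"
  shows "(x = i \<and> rfl i j x = j) \<or> (x = j \<and> rfl i j x = i) \<or>
     (x = - i \<and> rfl i j x = - j) \<or> (x = - j \<and> rfl i j x = - i)"
  using assms unfolding rfl_def by presburger

text \<open>For a sign function \<open>\<chi>\<close> on the roots, that is, a choice of positive roots, these are the roots whose
  sign is changed by \<open>w\<close>; there are two of them for each positive root that becomes negative.\<close>

definition flipped :: "nat \<Rightarrow> ((int \<Rightarrow> int) \<Rightarrow> int) \<Rightarrow> (int \<Rightarrow> int) \<Rightarrow> (int \<Rightarrow> int) set" where
  "flipped n \<chi> w = {r \<in> rts n. \<chi> (r \<circ> finv w) \<noteq> \<chi> r}"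

locale orientation =
  fixes n :: nat and \<chi> :: "(int \<Rightarrow> int) \<Rightarrow> int"
  assumes unit: "\<chi> r = 1 \<or> \<chi> r = -1"
    and odd: "r \<in> rts n \<Longrightarrow> \<chi> (opp r) = - \<chi> r"
begin

lemma finite_flipped: "finite (flipped n \<chi> w)"
  by (rule finite_subset[OF _ finite_rts[of n]]) (auto simp: flipped_def)

lemma flipped_opp:
  assumes "w \<in> carrier (B n)" "r \<in> flipped n \<chi> w" shows "opp r \<in> flipped n \<chi> w"
  using assms odd rts_act[OF assms(1)] by (auto simp: flipped_def rts_opp opp_comp)

lemma even_flipped: "w \<in> carrier (B n) \<Longrightarrow> even (card (flipped n \<chi> w))"
  by (rule even_opp_closed[of _ n]) (auto simp: flipped_opp, auto simp: flipped_def)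

text \<open>Up to the translate by \<open>w\<close>, the roots flipped by \<open>u \<circ> w\<close> form a symmetric difference. The intersection
  that is counted twice has even size, whence the congruence modulo 4.\<close>

lemma flipped_comp:
  assumes u: "u \<in> carrier (B n)" and w: "w \<in> carrier (B n)"
  shows "card (flipped n \<chi> (u \<circ> w)) mod 4 = (card (flipped n \<chi> u) + card (flipped n \<chi> w)) mod 4"
proof -
  define T where "T = {r \<in> rts n. r \<circ> finv w \<in> flipped n \<chi> u}"
  define W where "W = flipped n \<chi> w"
  have Trts: "T \<subseteq> rts n" by (auto simp: T_def)
  have "bij_betw (\<lambda>r. r \<circ> finv w) T (flipped n \<chi> u)"
  proof (rule bij_betw_byWitness[where f' = "\<lambda>r. r \<circ> w"])
    show "\<forall>r\<in>T. r \<circ> finv w \<circ> w = r" by (simp add: comp_assoc finv_comp[OF w])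
    show "\<forall>r\<in>flipped n \<chi> u. r \<circ> w \<circ> finv w = r" by (simp add: comp_assoc comp_finv[OF w])
    show "(\<lambda>r. r \<circ> finv w) ` T \<subseteq> flipped n \<chi> u" by (auto simp: T_def)
    have "r \<circ> w \<in> rts n" if "r \<in> rts n" for r
      using rts_act[OF finv_B[OF w] that] by (simp add: finv_finv[OF w])
    then show "(\<lambda>r. r \<circ> w) ` flipped n \<chi> u \<subseteq> T"
      by (auto simp: T_def comp_assoc comp_finv[OF w], auto simp: flipped_def)
  qed
  then have cT: "card T = card (flipped n \<chi> u)" by (rule bij_betw_same_card)
  have fin: "finite T" "finite W" using finite_subset[OF Trts finite_rts] finite_flipped by (auto simp: W_def)
  have "r \<in> flipped n \<chi> (u \<circ> w) \<longleftrightarrow> (r \<in> W) \<noteq> (r \<in> T)" for r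
    using unit[of r] unit[of "r \<circ> finv w"] unit[of "r \<circ> finv w \<circ> finv u"] rts_act[OF w, of r]
    by (auto simp: flipped_def W_def T_def finv_comp_distrib[OF u w] comp_assoc)
  then have fl: "flipped n \<chi> (u \<circ> w) = (W - T) \<union> (T - W)" by auto
  have e: "even (card (W \<inter> T))"
  proof (rule even_opp_closed)
    show "W \<inter> T \<subseteq> rts n" using Trts by auto
    fix r assume r: "r \<in> W \<inter> T"
    then show "opp r \<in> W \<inter> T" using flipped_opp[OF w, of r] flipped_opp[OF u, of "r \<circ> finv w"]
      by (auto simp: W_def T_def opp_comp rts_opp)
  qed
  have 1: "card (flipped n \<chi> (u \<circ> w)) = card (W - T) + card (T - W)"
    unfolding fl using fin by (intro card_Un_disjoint) auto
  have 2: "card W = card (W - T) + card (W \<inter> T)" "card T = card (T - W) + card (W \<inter> T)"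
    using fin card_Diff_subset_Int[of W T] card_Diff_subset_Int[of T W] card_mono[of W "W \<inter> T"]
      card_mono[of T "W \<inter> T"] by (auto simp: Int_commute)
  obtain q where "card (W \<inter> T) = 2 * q" using e by blast
  then have "card T + card W = card (flipped n \<chi> (u \<circ> w)) + 4 * q" using 1 2 by simp
  then show ?thesis unfolding cT W_def by simp
qed

text \<open>The root of the reflection and its opposite are flipped, and the other flipped roots come in
  quadruples.\<close>

lemma flipped_rfl:
  assumes i: "i \<in> pm n" and j: "j \<in> pm n" and ij: "i \<noteq> j"
  shows "\<not> 4 dvd card (flipped n \<chi> (rfl i j))"
proof -
  let ?s = "rfl i j" and ?F = "flipped n \<chi> (rfl i j)" and ?r = "rt i j"
  have nz: "i \<noteq> 0" "j \<noteq> 0" using i j pm_nz by auto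
  have s: "?s \<in> carrier (B n)" using rfl_in_B[OF i j] .
  have inv: "finv ?s = ?s" using inv_rfl[OF nz] .
  have r: "?r \<in> rts n" using i j ij by (rule rtsI)
  have "?s i = j" "?s j = i" by (auto simp: rfl_def)
  then have sr: "?r \<circ> ?s = opp ?r" using rt_act[OF s, of i j] by (simp add: inv rt_opp)
  have rF: "?r \<in> ?F" "opp ?r \<in> ?F"
    using r odd[OF r] unit[of ?r] by (auto simp: flipped_def inv sr opp_comp opp_opp rts_opp)
  let ?G = "{t \<in> ?F - {?r, opp ?r}. \<chi> t = 1}"
  \<comment> \<open>The reflection and the sign generate a four-group that acts freely on the other roots
    whose orientation is flipped.\<close>
  have fixed: "t = ?r \<or> t = opp ?r" if t: "t \<in> rts n" "opp (t \<circ> ?s) = t" for t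
  proof -
    obtain k l where kl: "k \<in> pm n" "l \<in> pm n" "k \<noteq> l" "t = rt k l" using t(1) by (rule rtsE)
    then have k0: "k \<noteq> 0" "l \<noteq> 0" using pm_nz by auto
    have e: "rt (?s l) (?s k) = rt k l" using t(2) rt_act[OF s, of k l] by (simp add: kl inv rt_opp)
    have "(?s l = k \<and> ?s k = l) \<or> (?s l = - l \<and> ?s k = - k)"
      using rt_eq_iff[of k l "?s l" "?s k"] e k0 kl(3) B_nz[OF s] B_inj[OF s] by simp
    then have "(k = i \<and> l = j) \<or> (k = j \<and> l = i) \<or> (k = - j \<and> l = - i) \<or> (k = - i \<and> l = - j)"
    proof
      assume lk: "?s l = k \<and> ?s k = l"
      then show ?thesis using rfl_moved[of i j l] kl(3) by auto
    next
      assume lk: "?s l = - l \<and> ?s k = - k"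
      then have "?s l \<noteq> l" "?s k \<noteq> k" using k0 by auto
      from rfl_moved[OF this(1)] rfl_moved[OF this(2)] lk kl(3) nz show ?thesis by auto
    qed
    then show ?thesis using rt_opp rt_flip kl(4) by metis
  qed
  have "even (card ?G)"
  proof (rule even_card_free_involution[where f = "\<lambda>t. opp (t \<circ> ?s)"])
    show "finite ?G" using finite_flipped by simp
    fix t assume t: "t \<in> ?G"
    then have tr: "t \<in> rts n" "\<chi> (t \<circ> ?s) \<noteq> \<chi> t" by (auto simp: flipped_def inv)
    have ss: "t \<circ> ?s \<circ> ?s = t" for t using rfl_rfl[OF nz] by (auto simp: fun_eq_iff)
    have ts: "t \<circ> ?s \<in> rts n" using rts_act[OF s tr(1)] by (simp add: inv)
    have invol: "opp (opp (t \<circ> ?s) \<circ> ?s) = t" by (simp add: opp_comp opp_opp ss)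
    have "opp (t \<circ> ?s) \<in> ?F" using tr ts odd[OF ts] odd[OF tr(1)] by (auto simp: flipped_def inv rts_opp opp_comp ss)
    moreover have "\<chi> (opp (t \<circ> ?s)) = 1" using odd[OF ts] tr(2) unit[of "t \<circ> ?s"] t by auto
    moreover have "opp (t \<circ> ?s) \<noteq> ?r" "opp (t \<circ> ?s) \<noteq> opp ?r"
    proof -
      have "t = ?r" if "opp (t \<circ> ?s) = ?r" using invol that sr opp_opp by metis
      then show "opp (t \<circ> ?s) \<noteq> ?r" using t by auto
      have "t = opp ?r" if "opp (t \<circ> ?s) = opp ?r" using invol that sr opp_opp opp_comp by metis
      then show "opp (t \<circ> ?s) \<noteq> opp ?r" using t by auto
    qed
    moreover have "opp (t \<circ> ?s) \<noteq> t" using fixed[OF tr(1)] t by auto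
    ultimately show "opp (t \<circ> ?s) \<in> ?G \<and> opp (opp (t \<circ> ?s) \<circ> ?s) = t \<and> opp (t \<circ> ?s) \<noteq> t"
      using invol by blast
  qed
  then obtain q where q: "card ?G = 2 * q" by blast
  let ?H = "{t \<in> ?F - {?r, opp ?r}. \<chi> t = -1}"
  have opp_in: "opp t \<in> ?F - {?r, opp ?r} \<and> \<chi> (opp t) = - \<chi> t" if "t \<in> ?F - {?r, opp ?r}" for t
  proof -
    have "opp t \<noteq> ?r" "opp t \<noteq> opp ?r" using that opp_opp by (metis Diff_iff insertCI)+
    then show ?thesis using that flipped_opp[OF s, of t] odd[of t] by (simp add: flipped_def)
  qed
  have "bij_betw opp ?G ?H"
    by (rule bij_betw_byWitness[where f' = opp]) (use opp_in opp_opp in auto)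
  then have "card ?H = 2 * q" using q bij_betw_same_card by fastforce
  moreover have "card (?F - {?r, opp ?r}) = card ?G + card ?H"
  proof -
    have un: "?F - {?r, opp ?r} = ?G \<union> ?H"
    proof (rule Set.set_eqI)
      show "t \<in> ?F - {?r, opp ?r} \<longleftrightarrow> t \<in> ?G \<union> ?H" for t using unit[of t] by auto
    qed
    have "card (?G \<union> ?H) = card ?G + card ?H"
    proof (rule card_Un_disjoint)
      show "finite ?G" "finite ?H" using finite_flipped by simp_all
      show "?G \<inter> ?H = {}" by (rule Int_emptyI) simp
    qed
    then show ?thesis by (subst un)
  qed
  moreover have "card ?F = card (?F - {?r, opp ?r}) + card {?r, opp ?r}"
    using card_Diff_subset[of "{?r, opp ?r}" ?F] card_mono[OF finite_flipped, of "{?r, opp ?r}"] rF by simp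
  moreover have "card {?r, opp ?r} = 2" using opp_neq[OF r] by simp
  ultimately have "card ?F = 4 * q + 2" using q by simp
  moreover have "\<not> 4 dvd 4 * q + 2" by presburger
  ultimately show ?thesis by simp
qed

text \<open>The number of flipped roots is always even, so that its residue modulo 4 defines a homomorphism to
  \<open>{1, -1}\<close>; on reflections it is \<open>-1\<close>, which characterises the sign.\<close>

lemma sgn_eq_1_iff:
  assumes "w \<in> carrier (B n)"
  shows "sgn_B n w = 1 \<longleftrightarrow> 4 dvd card (flipped n \<chi> w)"
proof -
  define f where "f = restrict (\<lambda>w. if 4 dvd card (flipped n \<chi> w) then 1 else -1 :: int) (carrier (B n))"
  have "is_sgn n f" unfolding is_sgn_def
  proof (intro conjI allI impI)
    show "f \<in> hom (B n) sign_img"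
    proof (rule homI)
      fix u v assume uv: "u \<in> carrier (B n)" "v \<in> carrier (B n)"
      have "(4 dvd card (flipped n \<chi> (u \<circ> v))) = (4 dvd (card (flipped n \<chi> u) + card (flipped n \<chi> v)))"
        using flipped_comp[OF uv] by (simp add: dvd_eq_mod_eq_0)
      also have "\<dots> = ((4 dvd card (flipped n \<chi> u)) = (4 dvd card (flipped n \<chi> v)))"
      proof -
        have "(4 dvd a + b) = ((4 dvd a) = (4 dvd b))" if "even a" "even b" for a b :: nat
          using that by presburger
        then show ?thesis using even_flipped[OF uv(1)] even_flipped[OF uv(2)] by blast
      qed
      finally show "f (u \<otimes>\<^bsub>B n\<^esub> v) = f u \<otimes>\<^bsub>sign_img\<^esub> f v"
        using uv by (simp add: f_def B_comp sign_img_def)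
    qed (simp add: f_def sign_img_def)
    show "f \<in> extensional (carrier (B n))" by (simp add: f_def)
    fix w assume w: "is_reflection n w"
    then obtain i j where "i \<in> pm n" "j \<in> pm n" "i \<noteq> j" "w = rfl i j" by (rule is_reflection_rfl)
    then show "f w = -1" using flipped_rfl w by (simp add: f_def is_reflection_def)
  qed
  then have "sgn_B n w = f w" using sgn_unique by metis
  then show ?thesis using assms by (simp add: f_def)
qed

end

lemma (in elab) dvd_card_by_orbits:
  assumes fin: "finite S" and closed: "\<And>s. s \<in> S \<Longrightarrow> orb A s \<subseteq> S"
    and d: "\<And>s. s \<in> S \<Longrightarrow> d dvd card {t \<in> orb A s. F t}"
  shows "d dvd card {t \<in> S. F t}"
proof -
  define part where "part Q = {t \<in> Q. F t}" for Q :: "'x set"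
  let ?I = "orb A ` S"
  have un: "{t \<in> S. F t} = (\<Union>Q\<in>?I. part Q)"
    using closed orb_self by (auto simp: part_def)
  have disj: "\<forall>P\<in>?I. \<forall>Q\<in>?I. P \<noteq> Q \<longrightarrow> part P \<inter> part Q = {}"
  proof (intro ballI impI)
    fix P Q assume PQ: "P \<in> ?I" "Q \<in> ?I" "P \<noteq> Q"
    obtain x y where xy: "P = orb A x" "Q = orb A y" using PQ(1,2) by auto
    have "P = Q" if "z \<in> P" "z \<in> Q" for z using orb_eq[of z x] orb_eq[of z y] that xy by simp
    then show "part P \<inter> part Q = {}" using PQ(3) by (auto simp: part_def)
  qed
  have "finite (part Q)" if "Q \<in> ?I" for Q
    using that finite_subset[OF closed fin] by (auto simp: part_def)
  then have "card {t \<in> S. F t} = (\<Sum>Q\<in>?I. card (part Q))"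
    unfolding un using fin disj by (intro card_UN_disjoint) auto
  also have "d dvd \<dots>" using d by (intro dvd_sum) (auto simp: part_def)
  finally show ?thesis .
qed

lemma pow2_dvd: "(2::nat) ^ k \<le> 2 ^ m \<Longrightarrow> 2 ^ k dvd (2::nat) ^ m"
  by (simp add: le_imp_power_dvd)

text \<open>Containing \<open>-1\<close> makes the orbits closed under negation and provides an element that moves every
  root to its opposite.\<close>

locale elab_neg = elab A for A :: "(int \<Rightarrow> int) set" +
  fixes n :: nat
  assumes sub: "A \<subseteq> carrier (B n)" and neg_in: "neg_all n \<in> A"
begin

lemma in_B: "a \<in> A \<Longrightarrow> a \<in> carrier (B n)"
  using sub by blast

lemma finite_A: "finite A"
  using finite_subset[OF sub finite_B] .

lemma finv_eq: assumes "a \<in> A" shows "finv a = a"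
  by (rule inv_unique_comp) (simp_all add: fun_eq_iff sq[OF assms])

lemma neg_apply: "x \<in> pm n \<Longrightarrow> neg_all n x = - x"
  by (simp add: neg_all_def)

lemma neg_orb: "x \<in> pm n \<Longrightarrow> - x \<in> orb A x"
  using orbI[OF neg_in, of x] by (simp add: neg_apply)

lemma orb_pm: "x \<in> pm n \<Longrightarrow> orb A x \<subseteq> pm n"
  using B_pm[OF in_B] by (auto elim!: orbE)

lemma finite_orb: "finite (orb A x)"
  unfolding orb_def using finite_A by simp

text \<open>The action on roots, where \<open>a\<close> is its own inverse.\<close>

definition root_group :: "((int \<Rightarrow> int) \<Rightarrow> int \<Rightarrow> int) set" where
  "root_group = (\<lambda>a r. r \<circ> a) ` A"

lemma rt_comp: assumes "a \<in> A" shows "rt i j \<circ> a = rt (a i) (a j)"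
  using rt_act[OF in_B[OF assms], of i j] finv_eq[OF assms] by simp

lemma elab_root_group: "elab root_group"
proof
  show "id \<in> root_group" unfolding root_group_def
    by (rule image_eqI[OF _ id_in]) (simp add: fun_eq_iff)
next
  fix f g assume "f \<in> root_group" "g \<in> root_group"
  then obtain a b where ab: "a \<in> A" "b \<in> A" "f = (\<lambda>r. r \<circ> a)" "g = (\<lambda>r. r \<circ> b)"
    unfolding root_group_def by (elim imageE)
  show "f \<circ> g \<in> root_group" unfolding root_group_def
    by (rule image_eqI[OF _ comp_in[OF ab(2,1)]]) (simp add: ab fun_eq_iff)
  show "f (g x) = g (f x)" for x using comm[OF ab(1,2)] by (simp add: ab fun_eq_iff)
next
  fix f assume "f \<in> root_group"
  then obtain a where a: "a \<in> A" "f = (\<lambda>r. r \<circ> a)" unfolding root_group_def by (elim imageE)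
  show "f (f x) = x" for x using sq[OF a(1)] by (simp add: a fun_eq_iff)
qed

lemma root_groupI: "a \<in> A \<Longrightarrow> (\<lambda>r. r \<circ> a) \<in> root_group"
  unfolding root_group_def by simp

lemma finite_root_group: "finite root_group"
  unfolding root_group_def using finite_A by simp

lemma opp_eq: assumes "r \<in> rts n" shows "r \<circ> neg_all n = opp r"
proof -
  obtain i j where "i \<in> pm n" "j \<in> pm n" "r = rt i j" using assms by (rule rtsE)
  then show ?thesis using rt_comp[OF neg_in, of i j] by (simp add: neg_apply rt_opp) (metis rt_flip)
qed

lemma rts_closed: assumes "a \<in> A" "r \<in> rts n" shows "r \<circ> a \<in> rts n"
  using rts_act[OF in_B[OF assms(1)] assms(2)] finv_eq[OF assms(1)] by simp

lemma root_orbE: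
  assumes "t \<in> orb root_group r" obtains a where "a \<in> A" "t = r \<circ> a"
  using assms unfolding orb_def root_group_def by auto

lemma orb_rt: "orb root_group (rt i j) = (\<lambda>a. rt (a i) (a j)) ` A"
  unfolding orb_def root_group_def image_image using rt_comp by (intro image_cong) auto

lemma card_root_orb:
  assumes r: "r \<in> rts n" shows "\<exists>m. card (orb root_group r) = 2 ^ m"
  using elab.card_orb[OF elab_root_group finite_root_group root_groupI[OF neg_in], of r]
    opp_eq[OF r] opp_neq[OF r] by auto

text \<open>A root is represented by only two pairs of points, so its orbit is at least half as large as the
  orbit of the pair \<open>(i, j)\<close>.\<close>

lemma root_orb_bound:
  assumes i: "i \<in> pm n" and j: "j \<in> pm n" and ij: "i \<noteq> j"
  shows "card (orb A i) \<le> 2 * card (orb root_group (rt i j))"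
    and "card (orb A j) \<le> 2 * card (orb root_group (rt i j))"
proof -
  let ?T = "orb root_group (rt i j)"
  define U where "U = (\<lambda>a. (a i, a j)) ` A"
  define fib where "fib t = {u \<in> U. rt (fst u) (snd u) = t}" for t
  have finU: "finite U" using finite_A by (simp add: U_def)
  have finT: "finite ?T" unfolding orb_rt using finite_A by simp
  have U: "p \<noteq> 0 \<and> q \<noteq> 0 \<and> p \<noteq> q" if pq: "(p, q) \<in> U" for p q
  proof -
    have "\<exists>a\<in>A. p = a i \<and> q = a j" using pq unfolding U_def by auto
    then obtain a where a: "a \<in> A" "p = a i" "q = a j" by (elim bexE conjE) (rule that)
    then show ?thesis using B_nz[OF in_B[OF a(1)]] B_inj[OF in_B[OF a(1)]] pm_nz[OF i] pm_nz[OF j] ij by simp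
  qed
  have fib: "card (fib t) \<le> 2" for t
  proof (cases "fib t = {}")
    case False
    then obtain p q where pq: "(p, q) \<in> U" "rt p q = t" by (auto simp: fib_def)
    have "fib t \<subseteq> {(p, q), (- q, - p)}"
    proof
      fix u assume u: "u \<in> fib t"
      then have "(fst u, snd u) \<in> U" "rt (fst u) (snd u) = rt p q" using pq by (auto simp: fib_def)
      then show "u \<in> {(p, q), (- q, - p)}" using rt_eq_iff[of p q "fst u" "snd u"] U[of p q] U[of "fst u" "snd u"] pq
        by (auto simp: prod_eq_iff)
    qed
    then have "card (fib t) \<le> card {(p, q), (- q, - p)}" by (rule card_mono[rotated]) simp
    also have "\<dots> \<le> 2" by (rule card_insert_le_m1) simp_all
    finally show ?thesis .
  qed simp
  have "U \<subseteq> (\<Union>t\<in>?T. fib t)" unfolding orb_rt by (auto simp: U_def fib_def)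
  then have "card U \<le> card (\<Union>t\<in>?T. fib t)" using finT finU by (intro card_mono) (auto simp: fib_def)
  also have "\<dots> \<le> (\<Sum>t\<in>?T. card (fib t))" using finT by (rule card_UN_le)
  also have "\<dots> \<le> (\<Sum>t\<in>?T. 2)" using fib by (intro sum_mono) simp
  finally have cU: "card U \<le> 2 * card ?T" by simp
  have "orb A i = fst ` U" "orb A j = snd ` U" by (simp_all add: U_def image_image orb_def)
  then show "card (orb A i) \<le> 2 * card ?T" "card (orb A j) \<le> 2 * card ?T"
    using card_image_le[OF finU, of fst] card_image_le[OF finU, of snd] cU by simp_all
qed

lemma root_orb_dvd:
  assumes "i \<in> pm n" "j \<in> pm n" "i \<noteq> j" "2 ^ Suc k \<le> card (orb A i) \<or> 2 ^ Suc k \<le> card (orb A j)"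
  shows "2 ^ k dvd card (orb root_group (rt i j))"
proof -
  obtain m where m: "card (orb root_group (rt i j)) = 2 ^ m"
    using card_root_orb[OF rtsI[OF assms(1-3)]] by blast
  have "2 * 2 ^ k \<le> 2 * card (orb root_group (rt i j))"
    using root_orb_bound[OF assms(1-3)] assms(4) by auto
  then have "(2::nat) ^ k \<le> 2 ^ m" unfolding m by linarith
  then show ?thesis unfolding m by (rule pow2_dvd)
qed

lemma ex_orientation:
  "\<exists>\<chi>. orientation n \<chi> \<and> (\<forall>r\<in>rts n. \<forall>a\<in>A. \<forall>b\<in>A. \<chi> (r \<circ> a \<circ> b) * \<chi> r = \<chi> (r \<circ> a) * \<chi> (r \<circ> b))"
proof -
  interpret R: elab root_group by (rule elab_root_group)
  obtain \<chi> :: "(int \<Rightarrow> int) \<Rightarrow> int" where \<chi>: "\<forall>r. \<chi> r = 1 \<or> \<chi> r = -1"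
    "\<forall>r\<in>rts n. \<chi> (r \<circ> neg_all n) = - \<chi> r"
    "\<forall>r\<in>rts n. \<forall>f\<in>root_group. \<forall>g\<in>root_group. \<chi> (f (g r)) * \<chi> r = \<chi> (f r) * \<chi> (g r)"
    using R.ex_sign_character[OF finite_root_group root_groupI[OF neg_in], of "rts n"] opp_eq opp_neq by auto
  have "orientation n \<chi>" by standard (use \<chi>(1,2) opp_eq in auto)
  moreover have "\<chi> (r \<circ> a \<circ> b) * \<chi> r = \<chi> (r \<circ> a) * \<chi> (r \<circ> b)" if "r \<in> rts n" "a \<in> A" "b \<in> A" for r a b
    using \<chi>(3)[rule_format, OF that(1) root_groupI[OF that(3)] root_groupI[OF that(2)]] by (simp add: mult_ac)
  ultimately show ?thesis by blast
qed

lemma sgn_by_root_orbits: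
  assumes \<chi>: "orientation n \<chi>" and w: "w \<in> carrier (B n)"
    and d: "\<And>i j. i \<in> pm n \<Longrightarrow> j \<in> pm n \<Longrightarrow> i \<noteq> j \<Longrightarrow>
      4 dvd card {t \<in> orb root_group (rt i j). \<chi> (t \<circ> finv w) \<noteq> \<chi> t}"
  shows "sgn_B n w = 1"
proof -
  have "4 dvd card {t \<in> rts n. \<chi> (t \<circ> finv w) \<noteq> \<chi> t}"
  proof (rule elab.dvd_card_by_orbits[OF elab_root_group finite_rts])
    fix s assume s: "s \<in> rts n"
    show "orb root_group s \<subseteq> rts n"
    proof
      fix t assume "t \<in> orb root_group s"
      then obtain a where "a \<in> A" "t = s \<circ> a" by (rule root_orbE)
      then show "t \<in> rts n" using rts_closed s by simp
    qed
    show "4 dvd card {t \<in> orb root_group s. \<chi> (t \<circ> finv w) \<noteq> \<chi> t}"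
      using s by (rule rtsE) (use d in simp)
  qed
  then show ?thesis using orientation.sgn_eq_1_iff[OF \<chi> w] by (simp add: flipped_def)
qed

text \<open>The proof shows that along the orbit of a root either all roots are flipped or none. If any are
  flipped, then one of the two points that represent the root moves, so that the orbit of the root has
  at least 4 elements.\<close>

lemma sgn_elem:
  assumes w: "w \<in> A" and big: "\<And>i. i \<in> pm n \<Longrightarrow> w i = i \<or> 8 \<le> card (orb A i)"
  shows "sgn_B n w = 1"
proof -
  obtain \<chi> where \<chi>: "orientation n \<chi>"
    and rel: "\<And>r a b. r \<in> rts n \<Longrightarrow> a \<in> A \<Longrightarrow> b \<in> A \<Longrightarrow> \<chi> (r \<circ> a \<circ> b) * \<chi> r = \<chi> (r \<circ> a) * \<chi> (r \<circ> b)"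
    using ex_orientation by blast
  have unit: "\<chi> r = 1 \<or> \<chi> r = -1" for r using orientation.unit[OF \<chi>] .
  show ?thesis
  proof (rule sgn_by_root_orbits[OF \<chi> in_B[OF w]])
    fix i j assume ij: "i \<in> pm n" "j \<in> pm n" "i \<noteq> j"
    let ?r = "rt i j" and ?T = "orb root_group (rt i j)"
    have r: "?r \<in> rts n" using rtsI[OF ij] .
    have const: "(\<chi> (t \<circ> finv w) \<noteq> \<chi> t) = (\<chi> (?r \<circ> w) \<noteq> \<chi> ?r)" if t: "t \<in> ?T" for t
    proof -
      obtain a where a: "a \<in> A" "t = ?r \<circ> a" using t by (rule root_orbE)
      have "\<chi> (t \<circ> w) * \<chi> ?r = \<chi> t * \<chi> (?r \<circ> w)" using rel[OF r a(1) w] a(2) by simp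
      then show ?thesis unfolding finv_eq[OF w]
        using unit[of t] unit[of "t \<circ> w"] unit[of ?r] unit[of "?r \<circ> w"] by auto
    qed
    show "4 dvd card {t \<in> ?T. \<chi> (t \<circ> finv w) \<noteq> \<chi> t}"
    proof (cases "\<chi> (?r \<circ> w) = \<chi> ?r")
      case True
      then have none: "{t \<in> ?T. \<chi> (t \<circ> finv w) \<noteq> \<chi> t} = {}" using const by simp
      show ?thesis unfolding none by simp
    next
      case False
      then have all: "{t \<in> ?T. \<chi> (t \<circ> finv w) \<noteq> \<chi> t} = ?T" using const by blast
      have "\<not> (w i = i \<and> w j = j)" using False rt_comp[OF w, of i j] by auto
      then have "2 ^ Suc 2 \<le> card (orb A i) \<or> 2 ^ Suc 2 \<le> card (orb A j)" using big[OF ij(1)] big[OF ij(2)] by auto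
      from root_orb_dvd[OF ij this] show ?thesis unfolding all by simp
    qed
  qed
qed

text \<open>Here a balanced orbit may occur as well, in which half of the roots are flipped; the orbits of roots
  have at least 8 elements, so half of them is still divisible by 4.\<close>

lemma sgn_normalizing:
  assumes w: "w \<in> carrier (B n)" and nm: "\<And>a. a \<in> A \<Longrightarrow> w \<circ> a \<circ> finv w \<in> A"
    and big: "\<And>i. i \<in> pm n \<Longrightarrow> 16 \<le> card (orb A i)"
  shows "sgn_B n w = 1"
proof -
  obtain \<chi> where \<chi>: "orientation n \<chi>"
    and rel: "\<And>r a b. r \<in> rts n \<Longrightarrow> a \<in> A \<Longrightarrow> b \<in> A \<Longrightarrow> \<chi> (r \<circ> a \<circ> b) * \<chi> r = \<chi> (r \<circ> a) * \<chi> (r \<circ> b)"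
    using ex_orientation by blast
  have unit: "\<chi> r = 1 \<or> \<chi> r = -1" for r using orientation.unit[OF \<chi>] .
  show ?thesis
  proof (rule sgn_by_root_orbits[OF \<chi> w])
    fix i j assume ij: "i \<in> pm n" "j \<in> pm n" "i \<noteq> j"
    let ?r = "rt i j" and ?T = "orb root_group (rt i j)"
    define F where "F t \<longleftrightarrow> \<chi> (t \<circ> finv w) \<noteq> \<chi> t" for t
    have r: "?r \<in> rts n" using rtsI[OF ij] .
    have s: "?r \<circ> finv w \<in> rts n" using rts_act[OF w r] .
    have T8: "8 dvd card ?T" using root_orb_dvd[OF ij, of 3] big[OF ij(1)] by simp
    have finT: "finite ?T" unfolding orb_rt using finite_A by simp
    \<comment> \<open>The discrepancy between the orientation and its \<open>w\<close>-translate is again a character of \<open>A\<close>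
      on each orbit, so that it is constant or balanced.\<close>
    have mult: "F (?r \<circ> b \<circ> a) = ((F ?r = F (?r \<circ> b)) = F (?r \<circ> a))" if a: "a \<in> A" and b: "b \<in> A" for a b
    proof -
      let ?a = "w \<circ> a \<circ> finv w" and ?b = "w \<circ> b \<circ> finv w"
      have tr: "?r \<circ> finv w \<circ> (w \<circ> c \<circ> finv w) = ?r \<circ> c \<circ> finv w" for c
        by (simp add: fun_eq_iff finv_left[OF w])
      have tr2: "?r \<circ> b \<circ> finv w \<circ> ?a = ?r \<circ> b \<circ> a \<circ> finv w"
        by (simp add: fun_eq_iff finv_left[OF w])
      have 1: "\<chi> (?r \<circ> b \<circ> a \<circ> finv w) * \<chi> (?r \<circ> finv w) = \<chi> (?r \<circ> b \<circ> finv w) * \<chi> (?r \<circ> a \<circ> finv w)"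
        using rel[OF s nm[OF b] nm[OF a]] by (simp only: tr tr2)
      have 2: "\<chi> (?r \<circ> b \<circ> a) * \<chi> ?r = \<chi> (?r \<circ> b) * \<chi> (?r \<circ> a)" using rel[OF r b a] .
      show ?thesis using 1 2 unit[of "?r \<circ> b \<circ> a \<circ> finv w"] unit[of "?r \<circ> finv w"]
          unit[of "?r \<circ> b \<circ> finv w"] unit[of "?r \<circ> a \<circ> finv w"] unit[of "?r \<circ> b \<circ> a"] unit[of ?r]
          unit[of "?r \<circ> b"] unit[of "?r \<circ> a"] unfolding F_def by (elim disjE) simp_all
    qed
    have "4 dvd card {t \<in> ?T. F t}"
    proof (cases "\<forall>a\<in>A. F (?r \<circ> a) = F ?r")
      case True
      then have "F t = F ?r" if "t \<in> ?T" for t using root_orbE[OF that] by metis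
      then have "{t \<in> ?T. F t} = (if F ?r then ?T else {})" by auto
      then show ?thesis using T8 dvd_trans[of 4 8 "card ?T"] by simp
    next
      case False
      then obtain a where a: "a \<in> A" "F (?r \<circ> a) \<noteq> F ?r" by blast
      have aT: "t \<circ> a \<in> ?T \<and> F (t \<circ> a) = (\<not> F t)" if t: "t \<in> ?T" for t
      proof -
        obtain b where b: "b \<in> A" "t = ?r \<circ> b" using t by (rule root_orbE)
        have "?r \<circ> (b \<circ> a) \<in> ?T" using orbI[OF root_groupI[OF comp_in[OF b(1) a(1)]]] .
        then show ?thesis using mult[OF a(1) b(1)] a(2) b(2) by (auto simp: comp_assoc)
      qed
      have aa: "t \<circ> a \<circ> a = t" for t using sq[OF a(1)] by (simp add: fun_eq_iff)
      have "bij_betw (\<lambda>t. t \<circ> a) {t \<in> ?T. F t} {t \<in> ?T. \<not> F t}"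
        by (rule bij_betw_byWitness[where f' = "\<lambda>t. t \<circ> a"]) (use aT aa in auto)
      then have "card {t \<in> ?T. F t} = card {t \<in> ?T. \<not> F t}" by (rule bij_betw_same_card)
      moreover have "card {t \<in> ?T. F t} + card {t \<in> ?T. \<not> F t} = card ?T"
        using card_Int_Diff[OF finT, of "Collect F"] by (simp add: Int_def set_diff_eq)
      ultimately have "card ?T = 2 * card {t \<in> ?T. F t}" by simp
      then show ?thesis using T8 by presburger
    qed
    then show "4 dvd card {t \<in> ?T. \<chi> (t \<circ> finv w) \<noteq> \<chi> t}" by (simp add: F_def)
  qed
qed

end

section \<open>Saturated elementary abelian groups\<close>

text \<open>Equivalently, \<open>A\<close> contains everything that agrees on each single orbit with some element of \<open>A\<close>; so \<open>A\<close>
  is the direct product of regular groups on its orbits.\<close>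

locale saturated = elab_neg +
  assumes saturated: "w \<in> carrier (B n) \<Longrightarrow> (\<And>a x. a \<in> A \<Longrightarrow> w (a x) = a (w x)) \<Longrightarrow>
    (\<And>x. x \<in> pm n \<Longrightarrow> w x \<in> orb A x) \<Longrightarrow> w \<in> A"
begin

lemma saturated_local:
  assumes w: "w \<in> carrier (B n)" and loc: "\<And>x. x \<in> pm n \<Longrightarrow> \<exists>a\<in>A. \<forall>y\<in>orb A x. w y = a y"
  shows "w \<in> A"
proof (rule saturated[OF w])
  fix x assume "x \<in> pm n"
  then obtain a where a: "a \<in> A" "\<forall>y\<in>orb A x. w y = a y" using loc by metis
  then show "w x \<in> orb A x" using orb_self[of x] orbI[OF a(1), of x] by simp
next
  fix c x assume c: "c \<in> A"
  show "w (c x) = c (w x)"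
  proof (cases "x \<in> pm n")
    case True
    then obtain a where a: "a \<in> A" "\<forall>y\<in>orb A x. w y = a y" using loc by metis
    have "w (c x) = a (c x)" "w x = a x" using a(2) orbI[OF c, of x] orb_self[of x] by auto
    then show ?thesis using comm[OF a(1) c, of x] by simp
  next
    case False
    then show ?thesis using B_fix[OF w] B_fix[OF in_B[OF c]] by simp
  qed
qed

end

text \<open>Adjoins \<open>-1\<close> and then all elements that act on every orbit like an element of the group.\<close>

definition localize :: "nat \<Rightarrow> (int \<Rightarrow> int) set \<Rightarrow> (int \<Rightarrow> int) set" where
  "localize n E = {w \<in> carrier (B n). (\<forall>g\<in>E. \<forall>x. w (g x) = g (w x)) \<and>
     (\<forall>x. w x \<in> orb E x \<or> - w x \<in> orb E x)}"

context
  fixes n E assumes E: "elab E" and sub: "E \<subseteq> carrier (B n)"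
begin

interpretation E: elab E by (rule E)

lemma localizeE:
  assumes "w \<in> localize n E"
  obtains g s where "g \<in> E" "s = 1 \<or> s = -1" "w x = s * g x"
proof -
  have "w x \<in> orb E x \<or> - w x \<in> orb E x" using assms by (simp add: localize_def)
  then show thesis
  proof
    assume "w x \<in> orb E x"
    then obtain g where g: "g \<in> E" "w x = g x" by (rule orbE)
    show thesis by (rule that[OF g(1), of 1]) (simp_all add: g(2))
  next
    assume "- w x \<in> orb E x"
    then obtain g where g: "g \<in> E" "- w x = g x" by (rule orbE)
    show thesis by (rule that[OF g(1), of "-1"]) (simp_all add: g(2)[symmetric])
  qed
qed

lemma localize_comm: "w \<in> localize n E \<Longrightarrow> g \<in> E \<Longrightarrow> w (g x) = g (w x)"
  by (simp add: localize_def)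

lemma localize_B: "w \<in> localize n E \<Longrightarrow> w \<in> carrier (B n)"
  by (simp add: localize_def)

lemma odd_sign: "w \<in> carrier (B n) \<Longrightarrow> s = 1 \<or> s = -1 \<Longrightarrow> w (s * x) = s * w x" for s :: int
  using B_odd by auto

lemma localize_orb: "s = 1 \<or> s = -1 \<Longrightarrow> g \<in> E \<Longrightarrow> y = s * g x \<Longrightarrow> y \<in> orb E x \<or> - y \<in> orb E x"
  using orbI[of g E x] by auto

lemma subset_localize: "E \<subseteq> localize n E"
proof
  fix g assume g: "g \<in> E"
  show "g \<in> localize n E" unfolding localize_def
    using g sub E.comm[OF g] orbI[OF g] by auto
qed

text \<open>At a given point, each element of \<open>localize n E\<close> has the form \<open>\<plusminus>g\<close> with \<open>g \<in> E\<close>, and it commutes with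
  \<open>E\<close>. Hence any two of them commute and each is an involution, pointwise.\<close>

lemma saturated_localize: "saturated (localize n E) n"
proof
  show "id \<in> localize n E" using subset_localize E.id_in by blast
next
  fix v w assume vw: "v \<in> localize n E" "w \<in> localize n E"
  have comp: "v (w x) = t * s * h (g x)"
    if "g \<in> E" "h \<in> E" "s = 1 \<or> s = -1" "t = 1 \<or> t = -1" "v x = s * g x" "w x = t * h x" for g h s t x
  proof -
    have "v (w x) = t * h (v x)"
      using that(6) odd_sign[OF localize_B[OF vw(1)] that(4)] localize_comm[OF vw(1) that(2)] by simp
    also have "h (v x) = s * h (g x)" using that(5) odd_sign[OF _ that(3)] that(2) sub by auto
    finally show ?thesis by simp
  qed
  have comp': "w (v x) = t * s * h (g x)"
    if "g \<in> E" "h \<in> E" "s = 1 \<or> s = -1" "t = 1 \<or> t = -1" "v x = s * g x" "w x = t * h x" for g h s t x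
  proof -
    have "w (v x) = s * g (w x)"
      using that(5) odd_sign[OF localize_B[OF vw(2)] that(3)] localize_comm[OF vw(2) that(1)] by simp
    also have "g (w x) = t * g (h x)" using that(6) odd_sign[OF _ that(4)] that(1) sub by auto
    also have "g (h x) = h (g x)" by (rule E.comm[OF that(1,2)])
    finally show ?thesis by simp
  qed
  show "v (w x) = w (v x)" for x
  proof -
    obtain g s where g: "g \<in> E" "s = 1 \<or> s = -1" "v x = s * g x" by (rule localizeE[OF vw(1), of x])
    obtain h t where h: "h \<in> E" "t = 1 \<or> t = -1" "w x = t * h x" by (rule localizeE[OF vw(2), of x])
    show ?thesis using comp[OF g(1) h(1) g(2) h(2) g(3) h(3)] comp'[OF g(1) h(1) g(2) h(2) g(3) h(3)] by simp
  qed
  show "v \<circ> w \<in> localize n E" unfolding localize_def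
  proof (intro CollectI conjI ballI allI)
    show "v \<circ> w \<in> carrier (B n)" using B_comp localize_B[OF vw(1)] localize_B[OF vw(2)] by blast
    show "(v \<circ> w) (g x) = g ((v \<circ> w) x)" if "g \<in> E" for g x
      using localize_comm[OF vw(1) that] localize_comm[OF vw(2) that] by simp
    fix x
    obtain g s where g: "g \<in> E" "s = 1 \<or> s = -1" "v x = s * g x" by (rule localizeE[OF vw(1), of x])
    obtain h t where h: "h \<in> E" "t = 1 \<or> t = -1" "w x = t * h x" by (rule localizeE[OF vw(2), of x])
    show "(v \<circ> w) x \<in> orb E x \<or> - (v \<circ> w) x \<in> orb E x"
      by (rule localize_orb[OF _ E.comp_in[OF h(1) g(1)], of "t * s"])
        (use comp[OF g(1) h(1) g(2) h(2) g(3) h(3)] g(2) h(2) in auto)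
  qed
next
  fix w x assume w: "w \<in> localize n E"
  obtain g s where g: "g \<in> E" "s = 1 \<or> s = -1" "w x = s * g x" by (rule localizeE[OF w])
  have "w (w x) = s * g (w x)" using g odd_sign[OF localize_B[OF w] g(2)] localize_comm[OF w g(1)] by simp
  also have "g (w x) = s * g (g x)" using g odd_sign[OF _ g(2)] sub by auto
  also have "g (g x) = x" by (rule E.sq[OF g(1)])
  finally show "w (w x) = x" using g(2) by auto
next
  show "localize n E \<subseteq> carrier (B n)" by (auto simp: localize_def)
  have "neg_all n (g x) = g (neg_all n x)" if "g \<in> E" for g x
  proof -
    have gB: "g \<in> carrier (B n)" using that sub by blast
    show ?thesis using B_pm[OF gB] B_odd[OF gB] by (simp add: neg_all_def)
  qed
  moreover have "neg_all n x \<in> orb E x \<or> - neg_all n x \<in> orb E x" for x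
    using E.orb_self[of x] by (simp add: neg_all_def)
  ultimately show "neg_all n \<in> localize n E" unfolding localize_def using neg_all_B by simp
next
  fix w assume w: "w \<in> carrier (B n)" "\<And>a x. a \<in> localize n E \<Longrightarrow> w (a x) = a (w x)"
    "\<And>x. x \<in> pm n \<Longrightarrow> w x \<in> orb (localize n E) x"
  have "w x \<in> orb E x \<or> - w x \<in> orb E x" for x
  proof (cases "x \<in> pm n")
    case True
    obtain l where "l \<in> localize n E" "w x = l x" using w(3)[OF True] by (rule orbE)
    then show ?thesis by (simp add: localize_def)
  next
    case False
    then show ?thesis using B_fix[OF w(1)] E.orb_self[of x] by simp
  qed
  then show "w \<in> localize n E" unfolding localize_def using w(1,2) subset_localize by blast
qed

lemma orb_localize:
  assumes x: "x \<in> pm n" shows "orb (localize n E) x = orb E x \<union> uminus ` orb E x"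
proof -
  interpret L: saturated "localize n E" n by (rule saturated_localize)
  show ?thesis
  proof
    show "orb (localize n E) x \<subseteq> orb E x \<union> uminus ` orb E x"
    proof
      fix y assume "y \<in> orb (localize n E) x"
      then obtain l where l: "l \<in> localize n E" "y = l x" by (rule orbE)
      then have "y \<in> orb E x \<or> - y \<in> orb E x" by (simp add: localize_def)
      then show "y \<in> orb E x \<union> uminus ` orb E x" using image_eqI[of y uminus "- y"] by auto
    qed
    have "y \<in> orb (localize n E) x" if y: "y \<in> orb E x" for y
    proof -
      obtain g where g: "g \<in> E" "y = g x" using y by (rule orbE)
      then show ?thesis using orbI[of g "localize n E" x] subset_localize by blast
    qed
    moreover have "- y \<in> orb (localize n E) x" if "y \<in> orb (localize n E) x" for y
      using L.neg_orb[of y] L.orb_pm[OF x] L.orb_eq[OF that] that by auto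
    ultimately show "orb E x \<union> uminus ` orb E x \<subseteq> orb (localize n E) x" by auto
  qed
qed

end

section \<open>Orbit types\<close>

text \<open>Orbits are sets of signed points, which accounts for the division by 2.\<close>

definition orbit_type :: "nat \<Rightarrow> (int \<Rightarrow> int) set \<Rightarrow> nat multiset" where
  "orbit_type n A = image_mset (\<lambda>Q. card Q div 2) (mset_set (orb A ` pm n))"

lemma count_image_mset_set:
  assumes "finite S" shows "count (image_mset f (mset_set S)) c = card {s \<in> S. f s = c}"
proof -
  have "count (image_mset f (mset_set S)) c = size (filter_mset (\<lambda>y. y = c) (image_mset f (mset_set S)))"
    by (simp add: count_conv_size_mset eq_commute)
  also have "\<dots> = size (filter_mset (\<lambda>s. f s = c) (mset_set S))"
    by (simp add: filter_mset_image_mset)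
  finally show ?thesis using assms by simp
qed

text \<open>Matches the orbits of two groups of the same type with each other.\<close>

lemma image_mset_eq_bij:
  assumes S: "finite S" and T: "finite T" and eq: "image_mset f (mset_set S) = image_mset g (mset_set T)"
  shows "\<exists>p. bij_betw p S T \<and> (\<forall>s\<in>S. g (p s) = f s)"
proof -
  have "card {s \<in> S. f s = c} = card {t \<in> T. g t = c}" for c
    using count_image_mset_set[OF S, of f c] count_image_mset_set[OF T, of g c] eq by simp
  then have "\<exists>b. bij_betw b {s \<in> S. f s = c} {t \<in> T. g t = c}" for c
    using finite_same_card_bij[of "{s \<in> S. f s = c}" "{t \<in> T. g t = c}"] S T by simp
  then obtain b where b: "\<And>c. bij_betw (b c) {s \<in> S. f s = c} {t \<in> T. g t = c}" by metis
  define p where "p s = b (f s) s" for s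
  have p: "p s \<in> T \<and> g (p s) = f s" if "s \<in> S" for s
    using bij_betwE[OF b[of "f s"]] that by (auto simp: p_def)
  have "inj_on p S"
  proof (rule inj_onI)
    fix s t assume st: "s \<in> S" "t \<in> S" "p s = p t"
    then have "f s = f t" using p by metis
    then show "s = t" using bij_betw_imp_inj_on[OF b[of "f s"]] st by (auto simp: p_def dest: inj_onD)
  qed
  moreover have "t \<in> p ` S" if t: "t \<in> T" for t
  proof -
    have "t \<in> b (g t) ` {s \<in> S. f s = g t}" using bij_betw_imp_surj_on[OF b[of "g t"]] t by simp
    then obtain s where s: "t = b (g t) s" "s \<in> {s \<in> S. f s = g t}" by (rule imageE)
    then have "t = p s" by (simp add: p_def)
    then show ?thesis using s(2) by simp
  qed
  ultimately have "bij_betw p S T" using p by (auto simp: bij_betw_def)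
  then show ?thesis using p by blast
qed

lemma card_pm: "card (pm n) = 2 * n"
proof -
  have "pm n = {- int n..int n} - {0}" by (auto simp: pm_def)
  then show ?thesis by simp
qed

context elab_neg
begin

lemma card_orb_pow2:
  assumes x: "x \<in> pm n" shows "\<exists>k. card (orb A x) = 2 ^ Suc k"
proof -
  have "neg_all n x \<noteq> x" using x pm_nz[OF x] by (simp add: neg_apply)
  then obtain m where "m \<ge> 1" "card (orb A x) = 2 ^ m" using card_orb[OF finite_A neg_in] by blast
  then show ?thesis by (intro exI[of _ "m - 1"]) simp
qed

lemma orb_disjoint: "P \<in> orb A ` pm n \<Longrightarrow> Q \<in> orb A ` pm n \<Longrightarrow> z \<in> P \<Longrightarrow> z \<in> Q \<Longrightarrow> P = Q"
  by (elim imageE) (metis orb_eq)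

lemma admissible_orbit_type: "admissible n (orbit_type n A)"
proof -
  let ?O = "orb A ` pm n"
  have even: "2 dvd card Q" if Q: "Q \<in> ?O" for Q
  proof -
    obtain x where "x \<in> pm n" "Q = orb A x" using Q by blast
    then show ?thesis using card_orb_pow2[of x] by auto
  qed
  have "(\<Sum>Q\<in>?O. card Q) = card (\<Union>?O)"
    by (rule card_Union_disjoint[symmetric])
       (use orb_disjoint finite_orb in \<open>auto simp: pairwise_def disjnt_def\<close>)
  also have "\<Union>?O = pm n" using orb_pm orb_self by blast
  finally have "(\<Sum>Q\<in>?O. card Q) = 2 * n" by (simp add: card_pm)
  moreover have "(\<Sum>Q\<in>?O. card Q) = 2 * (\<Sum>Q\<in>?O. card Q div 2)"
    unfolding sum_distrib_left by (rule sum.cong) (use even in auto)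
  ultimately have "sum_mset (orbit_type n A) = n" by (simp add: orbit_type_def sum_unfold_sum_mset)
  moreover have "\<exists>k. p = 2 ^ k" if p: "p \<in># orbit_type n A" for p
  proof -
    obtain x where "x \<in> pm n" "p = card (orb A x) div 2" using p by (auto simp: orbit_type_def)
    then show ?thesis using card_orb_pow2[of x] by auto
  qed
  ultimately show ?thesis by (simp add: admissible_def)
qed

lemma mult2_orbit_type: "mult2 k (orbit_type n A) = card {Q \<in> orb A ` pm n. card Q = 2 ^ Suc k}"
proof -
  have "mult2 k (orbit_type n A) = card {Q \<in> orb A ` pm n. card Q div 2 = 2 ^ k}"
    unfolding mult2_def orbit_type_def by (rule count_image_mset_set) simp
  also have "{Q \<in> orb A ` pm n. card Q div 2 = 2 ^ k} = {Q \<in> orb A ` pm n. card Q = 2 ^ Suc k}"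
  proof (rule Collect_cong, rule conj_cong[OF refl])
    fix Q assume "Q \<in> orb A ` pm n"
    then obtain x where "x \<in> pm n" "Q = orb A x" by blast
    then show "card Q div 2 = 2 ^ k \<longleftrightarrow> card Q = 2 ^ Suc k" using card_orb_pow2[of x] by auto
  qed
  finally show ?thesis .
qed

lemma mult2_eq_0_iff: "mult2 k (orbit_type n A) = 0 \<longleftrightarrow> (\<forall>x\<in>pm n. card (orb A x) \<noteq> 2 ^ Suc k)"
  unfolding mult2_orbit_type by auto

end

text \<open>Coordinatising both orbits identifies them, in such a way that negation corresponds to the
  same vector on both sides.\<close>

lemma ex_equivariant:
  assumes A: "elab_neg A n" and A': "elab_neg A' n'" and x: "x \<in> pm n" and x': "x' \<in> pm n'"
    and card: "card (orb A x) = card (orb A' x')"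
  shows "\<exists>h. bij_betw h (orb A x) (orb A' x') \<and> (\<forall>y\<in>orb A x. h (- y) = - h y) \<and>
     (\<forall>a\<in>A. \<exists>a'\<in>A'. \<forall>y\<in>orb A x. h (a y) = a' (h y))"
proof -
  interpret A: elab_neg A n by (rule A)
  interpret A': elab_neg A' n' by (rule A')
  have "neg_all n x \<noteq> x" using x pm_nz[OF x] by (simp add: A.neg_apply)
  from A.ex_chart[OF A.finite_A A.neg_in this] obtain m \<phi> where
    e0: "e0 \<in> V m" and \<phi>: "\<phi> ` V m \<subseteq> A" "\<phi> e0 = neg_all n"
    "\<And>u v. u \<in> V m \<Longrightarrow> v \<in> V m \<Longrightarrow> \<phi> (vadd u v) = \<phi> u \<circ> \<phi> v" "bij_betw (\<lambda>v. \<phi> v x) (V m) (orb A x)"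
    by metis
  have "neg_all n' x' \<noteq> x'" using x' pm_nz[OF x'] by (simp add: A'.neg_apply)
  from A'.ex_chart[OF A'.finite_A A'.neg_in this] obtain m' \<phi>' where
    \<phi>': "\<phi>' ` V m' \<subseteq> A'" "\<phi>' e0 = neg_all n'"
    "\<And>u v. u \<in> V m' \<Longrightarrow> v \<in> V m' \<Longrightarrow> \<phi>' (vadd u v) = \<phi>' u \<circ> \<phi>' v" "bij_betw (\<lambda>v. \<phi>' v x') (V m') (orb A' x')"
    by metis
  have "(2::nat) ^ m = 2 ^ m'"
    using bij_betw_same_card[OF \<phi>(4)] bij_betw_same_card[OF \<phi>'(4)] card card_V[of m] card_V[of m'] by simp
  then have mm: "m' = m" by simp
  define h where "h y = \<phi>' (inv_into (V m) (\<lambda>v. \<phi> v x) y) x'" for y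
  have h: "h (\<phi> v x) = \<phi>' v x'" if "v \<in> V m" for v
    using inv_into_f_f[OF bij_betw_imp_inj_on[OF \<phi>(4)] that] by (simp add: h_def)
  have surj: "\<exists>v\<in>V m. y = \<phi> v x" if "y \<in> orb A x" for y
    using that bij_betw_imp_surj_on[OF \<phi>(4)] by auto
  have trans: "\<phi> u (\<phi> v x) = \<phi> (vadd u v) x" "\<phi>' u (\<phi>' v x') = \<phi>' (vadd u v) x'"
    if "u \<in> V m" "v \<in> V m" for u v using \<phi>(3)[OF that] \<phi>'(3) that mm by simp_all
  have "bij_betw (\<lambda>v. h (\<phi> v x)) (V m) (orb A' x')"
    using \<phi>'(4) mm by (subst bij_betw_cong[where g = "\<lambda>v. \<phi>' v x'"]) (simp_all add: h)
  then have bij: "bij_betw h (orb A x) (orb A' x')"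
    using bij_betw_comp_iff[OF \<phi>(4), of h] by (simp add: comp_def)
  have neg: "h (- y) = - h y" if y: "y \<in> orb A x" for y
  proof -
    obtain v where v: "v \<in> V m" "y = \<phi> v x" using surj[OF y] by blast
    have "y \<in> pm n" using A.orb_pm[OF x] y by blast
    then have "- y = \<phi> e0 y" using A.neg_apply \<phi>(2) by simp
    then have "h (- y) = \<phi>' e0 (h y)" using v trans[OF e0 v(1)] h[OF vadd_V[OF e0 v(1)]] h[OF v(1)] by simp
    moreover have "h y \<in> pm n'" using bij_betwE[OF bij] y A'.orb_pm[OF x'] by blast
    ultimately show ?thesis using \<phi>'(2) A'.neg_apply by simp
  qed
  have equi: "\<exists>a'\<in>A'. \<forall>y\<in>orb A x. h (a y) = a' (h y)" if a: "a \<in> A" for a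
  proof -
    obtain u where u: "u \<in> V m" "a x = \<phi> u x" using surj[OF orbI[OF a]] by metis
    have uA: "\<phi> u \<in> A" "\<phi>' u \<in> A'" using u(1) \<phi>(1) \<phi>'(1) mm by auto
    have "h (a y) = \<phi>' u (h y)" if y: "y \<in> orb A x" for y
    proof -
      obtain v where v: "v \<in> V m" "y = \<phi> v x" using surj[OF y] by blast
      have "a y = \<phi> u y" using A.agree_on_orb[OF a uA(1) u(2) y] .
      then show ?thesis using v trans[OF u(1) v(1)] h[OF vadd_V[OF u(1) v(1)]] h[OF v(1)] by simp
    qed
    then show ?thesis using uA(2) by blast
  qed
  show ?thesis using bij neg equi by blast
qed

section \<open>Conjugation\<close>

definition conj_by :: "(int \<Rightarrow> int) \<Rightarrow> (int \<Rightarrow> int) set \<Rightarrow> (int \<Rightarrow> int) set" where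
  "conj_by g A = (\<lambda>a. g \<circ> a \<circ> finv g) ` A"

lemma conj_set_B: "g \<in> carrier (B n) \<Longrightarrow> conj_set (B n) g A = conj_by g A"
  by (auto simp: conj_set_def conj_by_def l_coset_def r_coset_def inv_B)

lemma conj_by_id: "conj_by id A = A" by (simp add: conj_by_def)

lemma conj_by_comp: "g \<in> carrier (B n) \<Longrightarrow> h \<in> carrier (B n) \<Longrightarrow> conj_by g (conj_by h A) = conj_by (g \<circ> h) A"
  by (simp add: conj_by_def image_image finv_comp_distrib comp_assoc)

lemma conj_by_finv: "g \<in> carrier (B n) \<Longrightarrow> conj_by (finv g) (conj_by g A) = A"
  by (simp add: conj_by_comp[OF finv_B] finv_comp conj_by_id)

lemma conj_by_sub: "g \<in> carrier (B n) \<Longrightarrow> A \<subseteq> carrier (B n) \<Longrightarrow> conj_by g A \<subseteq> carrier (B n)"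
  using B_comp finv_B by (auto simp: conj_by_def)

lemma orb_conj_by: "g \<in> carrier (B n) \<Longrightarrow> orb (conj_by g A) (g x) = g ` orb A x"
  by (simp add: orb_def conj_by_def image_image finv_left)

lemma elab_conj_by: assumes A: "elab A" and g: "g \<in> carrier (B n)" shows "elab (conj_by g A)"
proof -
  interpret elab A by (rule A)
  show ?thesis
  proof
    show "id \<in> conj_by g A" unfolding conj_by_def by (rule image_eqI[OF _ id_in]) (simp add: comp_finv[OF g])
  next
    fix u v assume "u \<in> conj_by g A" "v \<in> conj_by g A"
    then obtain a b where ab: "a \<in> A" "b \<in> A" "u = g \<circ> a \<circ> finv g" "v = g \<circ> b \<circ> finv g"
      unfolding conj_by_def by (elim imageE)
    show "u \<circ> v \<in> conj_by g A" unfolding conj_by_def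
      by (rule image_eqI[OF _ comp_in[OF ab(1,2)]]) (simp add: ab fun_eq_iff finv_left[OF g])
    show "u (v x) = v (u x)" for x using comm[OF ab(1,2)] by (simp add: ab finv_left[OF g])
  next
    fix u assume "u \<in> conj_by g A"
    then obtain a where a: "a \<in> A" "u = g \<circ> a \<circ> finv g" unfolding conj_by_def by (elim imageE)
    show "u (u x) = x" for x using sq[OF a(1)] by (simp add: a finv_left[OF g] finv_right[OF g])
  qed
qed

lemma elab_neg_conj_by: assumes A: "elab_neg A n" and g: "g \<in> carrier (B n)" shows "elab_neg (conj_by g A) n"
proof -
  interpret elab_neg A n by (rule A)
  have "g \<circ> neg_all n \<circ> finv g = neg_all n"
    using B_pm[OF finv_B[OF g]] B_odd[OF g] finv_right[OF g] by (simp add: fun_eq_iff neg_all_def)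
  then have "neg_all n \<in> conj_by g A" unfolding conj_by_def using neg_in by (metis image_eqI)
  then show ?thesis
    using elab_conj_by[OF elab_axioms g] conj_by_sub[OF g sub] by (simp add: elab_neg_def elab_neg_axioms_def)
qed

lemma saturated_conj_by: assumes A: "saturated A n" and g: "g \<in> carrier (B n)" shows "saturated (conj_by g A) n"
proof -
  interpret saturated A n by (rule A)
  interpret C: elab_neg "conj_by g A" n by (rule elab_neg_conj_by[OF elab_neg_axioms g])
  show ?thesis
  proof
    fix w assume w: "w \<in> carrier (B n)" "\<And>a x. a \<in> conj_by g A \<Longrightarrow> w (a x) = a (w x)"
      "\<And>x. x \<in> pm n \<Longrightarrow> w x \<in> orb (conj_by g A) x"
    let ?v = "finv g \<circ> w \<circ> g"
    have "?v \<in> A"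
    proof (rule saturated)
      show "?v \<in> carrier (B n)" using w(1) g finv_B B_comp by metis
      fix a x assume a: "a \<in> A"
      have "g \<circ> a \<circ> finv g \<in> conj_by g A" using a by (simp add: conj_by_def)
      from w(2)[OF this, of "g x"] show "?v (a x) = a (?v x)"
        by (simp add: finv_left[OF g])
    next
      fix x assume "x \<in> pm n"
      then have "w (g x) \<in> g ` orb A x" using w(3)[of "g x"] B_pm[OF g] orb_conj_by[OF g, of A x] by simp
      then show "?v x \<in> orb A x" by (auto simp: finv_left[OF g])
    qed
    then have "g \<circ> ?v \<circ> finv g \<in> conj_by g A" by (simp add: conj_by_def)
    moreover have "g \<circ> ?v \<circ> finv g = w" by (simp add: fun_eq_iff finv_right[OF g])
    ultimately show "w \<in> conj_by g A" by simp
  qed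
qed

lemma card_image_B: "g \<in> carrier (B n) \<Longrightarrow> card (g ` Q) = card Q"
  using B_inj by (intro card_image inj_onI) blast

lemma orbit_type_conj_by:
  assumes g: "g \<in> carrier (B n)" shows "orbit_type n (conj_by g A) = orbit_type n A"
proof -
  have "pm n = g ` pm n" using permutes_image[OF B_permutes[OF g]] by simp
  then have "orb (conj_by g A) ` pm n = (\<lambda>x. orb (conj_by g A) (g x)) ` pm n" by (metis image_image)
  also have "\<dots> = (`) g ` orb A ` pm n" by (simp add: orb_conj_by[OF g] image_image)
  finally have orbs: "orb (conj_by g A) ` pm n = (`) g ` orb A ` pm n" .
  have "inj_on ((`) g) (orb A ` pm n)"
    using B_bij[OF g] by (intro inj_onI) (metis bij_is_inj inj_image_eq_iff)
  then show ?thesis unfolding orbit_type_def orbs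
    by (simp add: image_mset_mset_set[symmetric] multiset.map_comp comp_def card_image_B[OF g])
qed

text \<open>Two saturated groups with equally many orbits of each size are conjugate: the equivariant
  bijections between orbits glue to a signed permutation.\<close>

lemma saturated_conjugate:
  assumes A: "saturated A n" and A': "saturated A' n" and ty: "orbit_type n A = orbit_type n A'"
  shows "\<exists>f\<in>carrier (B n). conj_by f A = A'"
proof -
  interpret A: saturated A n by (rule A)
  interpret A': saturated A' n by (rule A')
  obtain p where p: "bij_betw p (orb A ` pm n) (orb A' ` pm n)"
    and pc: "\<And>Q. Q \<in> orb A ` pm n \<Longrightarrow> card (p Q) div 2 = card Q div 2"
    using image_mset_eq_bij[OF finite_imageI[OF finite_pm] finite_imageI[OF finite_pm] ty[unfolded orbit_type_def]]
    by blast
  define good where "good Q h \<longleftrightarrow> bij_betw h Q (p Q) \<and> (\<forall>y\<in>Q. h (- y) = - h y) \<and>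
     (\<forall>a\<in>A. \<exists>a'\<in>A'. \<forall>y\<in>Q. h (a y) = a' (h y))" for Q h
  have ex: "\<exists>h. good Q h" if Q: "Q \<in> orb A ` pm n" for Q
  proof -
    obtain x where x: "x \<in> pm n" "Q = orb A x" using Q by blast
    have "p Q \<in> orb A' ` pm n" using bij_betwE[OF p] Q by blast
    then obtain x' where x': "x' \<in> pm n" "p Q = orb A' x'" by blast
    have "card (orb A x) = card (orb A' x')"
      using A.card_orb_pow2[OF x(1)] A'.card_orb_pow2[OF x'(1)] pc[OF Q] x x' by auto
    then show ?thesis
      using ex_equivariant[OF A.elab_neg_axioms A'.elab_neg_axioms x(1) x'(1)] x(2) x'(2) by (simp add: good_def)
  qed
  have good: "good Q (SOME h. good Q h)" if "Q \<in> orb A ` pm n" for Q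
    by (rule someI_ex[where P = "good Q", OF ex[OF that]])
  define h where "h Q = (SOME h. good Q h)" for Q
  have h: "\<And>Q. Q \<in> orb A ` pm n \<Longrightarrow> bij_betw (h Q) Q (p Q)"
    "\<And>Q y. Q \<in> orb A ` pm n \<Longrightarrow> y \<in> Q \<Longrightarrow> h Q (- y) = - h Q y"
    "\<And>Q a. Q \<in> orb A ` pm n \<Longrightarrow> a \<in> A \<Longrightarrow> \<exists>a'\<in>A'. \<forall>y\<in>Q. h Q (a y) = a' (h Q y)"
    using good by (simp_all add: good_def h_def)
  define f where "f x = (if x \<in> pm n then h (orb A x) x else x)" for x
  have fQ: "f y = h (orb A x) y" if "x \<in> pm n" "y \<in> orb A x" for x y
    using A.orb_eq[OF that(2)] A.orb_pm[OF that(1)] that(2) by (auto simp: f_def)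
  have f_img: "f ` orb A x = p (orb A x)" if "x \<in> pm n" for x
    using fQ[OF that] bij_betw_imp_surj_on[OF h(1)[of "orb A x"]] that by (auto simp: image_iff)
  have p_orb: "p (orb A x) = orb A' (f x)" if x: "x \<in> pm n" for x
  proof -
    have "p (orb A x) \<in> orb A' ` pm n" using bij_betwE[OF p] x by blast
    then obtain x' where x': "p (orb A x) = orb A' x'" by blast
    have "f x \<in> orb A' x'" using f_img[OF x] A.orb_self[of x] x' by blast
    then show ?thesis using A'.orb_eq x' by simp
  qed
  have f_pm: "f x \<in> pm n" if x: "x \<in> pm n" for x
  proof -
    have "p (orb A x) \<in> orb A' ` pm n" using bij_betwE[OF p] x by blast
    then show ?thesis using f_img[OF x] A.orb_self[of x] A'.orb_pm by blast
  qed
  have "inj_on f (pm n)"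
  proof (rule inj_onI)
    fix x y assume xy: "x \<in> pm n" "y \<in> pm n" "f x = f y"
    then have "p (orb A x) = p (orb A y)" using p_orb by simp
    then have o: "orb A x = orb A y" using bij_betw_imp_inj_on[OF p] xy by (auto dest: inj_onD)
    have "h (orb A x) x = h (orb A x) y" using xy o by (simp add: f_def)
    then show "x = y" using bij_betw_imp_inj_on[OF h(1)[of "orb A x"]] A.orb_self o xy(1)
      by (metis imageI inj_onD)
  qed
  moreover have "f (- x) = - f x" for x
  proof (cases "x \<in> pm n")
    case True
    then have "f (- x) = h (orb A x) (- x)" using fQ[OF True A.neg_orb[OF True]] by simp
    also have "\<dots> = - h (orb A x) x" using h(2)[OF _ A.orb_self] True by blast
    finally show ?thesis using True by (simp add: f_def)
  qed (simp add: f_def)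
  ultimately have fB: "f \<in> carrier (B n)" using f_pm by (intro inj_in_B) (simp_all add: f_def)
  have "f \<circ> a \<circ> finv f \<in> A'" if a: "a \<in> A" for a
  proof (rule A'.saturated_local)
    show "f \<circ> a \<circ> finv f \<in> carrier (B n)" using fB A.in_B[OF a] finv_B B_comp by metis
    fix y assume y: "y \<in> pm n"
    let ?x = "finv f y"
    have x: "?x \<in> pm n" using B_pm[OF finv_B[OF fB]] y by simp
    have fx: "f ?x = y" by (rule finv_right[OF fB])
    obtain a' where a': "a' \<in> A'" "\<forall>z\<in>orb A ?x. h (orb A ?x) (a z) = a' (h (orb A ?x) z)"
      using h(3)[OF imageI[OF x] a] by metis
    have *: "(f \<circ> a \<circ> finv f) z = a' z" if z: "z \<in> orb A' y" for z
    proof -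
      have "z \<in> f ` orb A ?x" using z f_img[OF x] p_orb[OF x] fx by simp
      then obtain u where u: "u \<in> orb A ?x" "z = f u" by blast
      have "a u \<in> orb A ?x" using A.orb_eq[OF u(1)] orbI[OF a, of u] by simp
      have "(f \<circ> a \<circ> finv f) z = f (a u)" using u(2) by (simp add: finv_left[OF fB])
      also have "\<dots> = a' z" using a'(2) u fQ[OF x] \<open>a u \<in> orb A ?x\<close> by simp
      finally show ?thesis .
    qed
    show "\<exists>a'\<in>A'. \<forall>z\<in>orb A' y. (f \<circ> a \<circ> finv f) z = a' z" using * a'(1) by (intro bexI[of _ a']) simp_all
  qed
  then have cjA: "conj_by f A \<subseteq> A'" by (auto simp: conj_by_def)
  interpret C: saturated "conj_by f A" n by (rule saturated_conj_by[OF A fB])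
  have "a' \<in> conj_by f A" if a': "a' \<in> A'" for a'
  proof (rule C.saturated)
    show "a' \<in> carrier (B n)" using A'.in_B[OF a'] .
    show "a' (a x) = a (a' x)" if "a \<in> conj_by f A" for a x using A'.comm[OF a'] that cjA by blast
    fix y assume y: "y \<in> pm n"
    have x: "finv f y \<in> pm n" using B_pm[OF finv_B[OF fB]] y by simp
    have "orb (conj_by f A) y = orb A' y"
      using orb_conj_by[OF fB, of A "finv f y"] f_img[OF x] p_orb[OF x] by (simp add: finv_right[OF fB])
    then show "a' y \<in> orb (conj_by f A) y" using orbI[OF a'] by simp
  qed
  then show ?thesis using cjA fB by blast
qed

section \<open>The regular block\<close>

context
  fixes e :: "nat \<Rightarrow> nat \<Rightarrow> nat \<Rightarrow> bit" assumes e: "enumeration e"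
begin

text \<open>The signed permutation by which the vector \<open>v\<close> acts on the block.\<close>

abbreviation translation :: "nat \<Rightarrow> (nat \<Rightarrow> bit) \<Rightarrow> int \<Rightarrow> int" where
  "translation k v \<equiv> signed (regular e k v)"

lemma e_bij: "bij_betw (e k) {1..2 ^ k} (V k)"
  using e by (simp add: enumeration_def)

lemma regular_range:
  assumes v: "v \<in> V k" and i: "i \<in> {1..2 ^ k}"
  shows "regular e k v i \<in> {1..2 ^ k} \<and> e k (regular e k v i) = vadd v (e k i)"
proof -
  have "vadd v (e k i) \<in> e k ` {1..2 ^ k}"
    using vadd_V[OF v] bij_betwE[OF e_bij] i bij_betw_imp_surj_on[OF e_bij] by auto
  moreover have "regular e k v i = inv_into {1..2 ^ k} (e k) (vadd v (e k i))"
    using i by (simp add: regular_def vadd_def)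
  ultimately show ?thesis by (simp only: inv_into_into f_inv_into_f simp_thms)
qed

lemma regular_fix: "i \<notin> {1..2 ^ k} \<Longrightarrow> regular e k v i = i"
  unfolding regular_def by (rule if_not_P)

lemma regular_eqI:
  assumes "i \<in> {1..2 ^ k}" "j \<in> {1..2 ^ k}" "e k i = e k j" shows "i = j"
  using inj_onD[OF bij_betw_imp_inj_on[OF e_bij] assms(3) assms(1,2)] .

lemma vadd_assoc: "vadd (vadd u v) w = vadd u (vadd v w)"
  by (rule ext) (simp only: vadd_def add.assoc)

lemma vadd_comm: "vadd u v = vadd v u"
  by (rule ext) (simp only: vadd_def add.commute)

lemma vadd_self: "vadd u (vadd u v) = v"
proof
  fix j show "vadd u (vadd u v) j = v j" by (cases "u j") (simp_all add: vadd_def)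
qed

lemma vadd_zero: "vadd (\<lambda>_. 0) v = v"
  by (rule ext) (simp only: vadd_def add_0)

lemma regular_comp:
  assumes "u \<in> V k" "v \<in> V k"
  shows "regular e k u (regular e k v i) = regular e k (vadd u v) i"
proof (cases "i \<in> {1..2 ^ k}")
  case True
  have v: "regular e k v i \<in> {1..2 ^ k}" "e k (regular e k v i) = vadd v (e k i)"
    using regular_range[OF assms(2) True] by auto
  show ?thesis
    by (rule regular_eqI[of _ k])
       (use regular_range[OF assms(1) v(1)] regular_range[OF vadd_V[OF assms] True] v(2) in
        \<open>simp_all add: vadd_assoc\<close>)
next
  case False
  then show ?thesis by (simp only: regular_fix[OF False])
qed

lemma regular_zero: "regular e k (\<lambda>_. 0) i = i"
proof (cases "i \<in> {1..2 ^ k}")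
  case True
  have "(\<lambda>_. 0) \<in> V k" by (simp add: V_def)
  from regular_range[OF this True] show ?thesis
    using True by (intro regular_eqI[of _ k]) (simp_all only: vadd_zero)
next
  case False
  then show ?thesis by (simp only: regular_fix[OF False])
qed

lemma regular_eq_0: "v \<in> V k \<Longrightarrow> regular e k v i = 0 \<longleftrightarrow> i = 0"
  using regular_range[of v k i] regular_fix[of i k v] by (cases "i \<in> {1..2 ^ k}") auto

lemma translation_comp:
  assumes "u \<in> V k" "v \<in> V k"
  shows "translation k u (translation k v i) = translation k (vadd u v) i"
proof -
  have "nat \<bar>sgn i * int m\<bar> = (if i = 0 then 0 else m)" for m by (simp add: abs_mult)
  moreover have "sgn (sgn i * int m) = (if m = 0 then 0 else sgn i)" for m
    by (simp add: sgn_mult sgn_if)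
  moreover have "i \<noteq> 0 \<Longrightarrow> regular e k v (nat \<bar>i\<bar>) \<noteq> 0"
    using regular_eq_0[OF assms(2)] by simp
  ultimately show ?thesis by (cases "i = 0") (simp_all add: signed_def regular_comp[OF assms])
qed

lemma translation_zero: "translation k (\<lambda>_. 0) = id"
  by (simp add: signed_def regular_zero fun_eq_iff sgn_mult_abs)

lemma translation_odd: "translation k v (- i) = - translation k v i"
  by (simp add: signed_def)

lemma translation_B:
  assumes v: "v \<in> V k" shows "translation k v \<in> carrier (B (2 ^ k))"
proof -
  have vv: "vadd v v = (\<lambda>_. 0)" by (simp add: vadd_def)
  have "translation k v (translation k v i) = i" for i
    using translation_comp[OF v v, of i] by (simp add: vv translation_zero)
  moreover have "translation k v i = i" if "i \<notin> pm (2 ^ k)" for i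
  proof -
    have "nat \<bar>i\<bar> \<notin> {1..2 ^ k}"
      using that unfolding pm_def by (auto simp: le_nat_iff nat_le_iff)
    then have "regular e k v (nat \<bar>i\<bar>) = nat \<bar>i\<bar>" by (rule regular_fix)
    then show ?thesis by (simp add: signed_def sgn_mult_abs)
  qed
  ultimately show ?thesis using translation_odd by (rule involution_in_B)
qed

lemma C_block_eq: "C_block k = {id, neg_all (2 ^ k)}"
proof
  let ?N = "2 ^ k :: nat"
  interpret group "B ?N" by (rule group_B)
  have nn: "neg_all ?N \<circ> neg_all ?N = id" by (auto simp: neg_all_def fun_eq_iff)
  show "C_block k \<subseteq> {id, neg_all ?N}"
  proof
    fix w assume "w \<in> C_block k"
    then show "w \<in> {id, neg_all ?N}" unfolding C_block_def
    proof (induction rule: generate.induct)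
      case (inv h)
      then show ?case using inv_equality[of "neg_all ?N" "neg_all ?N"] neg_all_B nn by simp
    next
      case (eng h1 h2)
      then show ?case by (elim insertE emptyE) (simp_all only: B_mult nn comp_id id_comp insert_iff simp_thms)
    qed simp_all
  qed
  show "{id, neg_all ?N} \<subseteq> C_block k"
    unfolding C_block_def using generate.one[of "B ?N"] generate.incl[of "neg_all ?N" "{neg_all ?N}" "B ?N"] by simp
qed

lemma A_block_iff:
  "w \<in> A_block e k \<longleftrightarrow> (\<exists>v\<in>V k. w = translation k v \<or> w = neg_all (2 ^ k) \<circ> translation k v)"
  unfolding A_block_def C_block_eq set_mult_def by auto

text \<open>The factor from the centre is moved into the argument, as multiplication by \<open>s\<close>; this makes
  compositions easy to compute.\<close>

lemma A_blockE:
  assumes "w \<in> A_block e k"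
  obtains v s where "v \<in> V k" "s = 1 \<or> s = -1"
    "\<And>i. i \<in> pm (2 ^ k) \<Longrightarrow> w i = translation k v (s * i)"
proof -
  obtain v where v: "v \<in> V k" "w = translation k v \<or> w = neg_all (2 ^ k) \<circ> translation k v"
    using assms A_block_iff by blast
  from v(2) show thesis
  proof
    assume "w = translation k v"
    then show thesis by (intro that[OF v(1), of 1]) simp_all
  next
    assume w: "w = neg_all (2 ^ k) \<circ> translation k v"
    show thesis
    proof (rule that[OF v(1), of "-1"])
      fix i assume i: "i \<in> pm (2 ^ k)"
      then show "w i = translation k v (- 1 * i)"
        using B_pm[OF translation_B[OF v(1)]] by (simp add: w neg_all_def translation_odd)
    qed simp
  qed
qed

lemma A_blockI:
  assumes w: "w \<in> carrier (B (2 ^ k))" and v: "v \<in> V k" and s: "s = 1 \<or> s = -1"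
    and wi: "\<And>i. i \<in> pm (2 ^ k) \<Longrightarrow> w i = translation k v (s * i)"
  shows "w \<in> A_block e k"
proof -
  note tB = translation_B[OF v]
  have fx: "i \<notin> pm (2 ^ k) \<Longrightarrow> w i = i \<and> translation k v i = i" for i
    using B_fix[OF w] B_fix[OF tB] by simp
  from s show ?thesis
  proof
    assume "s = 1"
    then have "w = translation k v" using wi fx by (intro ext) (metis mult_1)
    then show ?thesis using v A_block_iff by blast
  next
    assume s1: "s = -1"
    have "w i = (neg_all (2 ^ k) \<circ> translation k v) i" for i
    proof (cases "i \<in> pm (2 ^ k)")
      case True
      then show ?thesis using wi[OF True] B_pm[OF tB] s1 by (simp add: neg_all_def translation_odd)
    next
      case False
      then show ?thesis using fx by (simp add: neg_all_def)
    qed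
    then show ?thesis using v A_block_iff by blast
  qed
qed

lemma A_block_B: "w \<in> A_block e k \<Longrightarrow> w \<in> carrier (B (2 ^ k))"
  using A_block_iff translation_B neg_all_B B_comp by metis

lemma elab_neg_A_block: "elab_neg (A_block e k) (2 ^ k)"
proof
  have z: "(\<lambda>_. 0) \<in> V k" by (simp add: V_def)
  show "id \<in> A_block e k" using A_block_iff z translation_zero by metis
  show "neg_all (2 ^ k) \<in> A_block e k" using A_block_iff z translation_zero comp_id by metis
  show "A_block e k \<subseteq> carrier (B (2 ^ k))" using A_block_B by blast
next
  fix a b assume ab: "a \<in> A_block e k" "b \<in> A_block e k"
  obtain u s where u: "u \<in> V k" "s = 1 \<or> s = -1" "\<And>i. i \<in> pm (2 ^ k) \<Longrightarrow> a i = translation k u (s * i)"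
    by (rule A_blockE[OF ab(1)]) blast
  obtain v t where v: "v \<in> V k" "t = 1 \<or> t = -1" "\<And>i. i \<in> pm (2 ^ k) \<Longrightarrow> b i = translation k v (t * i)"
    by (rule A_blockE[OF ab(2)]) blast
  have sg: "translation k x (r * i) = r * translation k x i" if "r = 1 \<or> r = -1" for r x i
    using that translation_odd by auto
  have pmb: "i \<in> pm (2 ^ k) \<Longrightarrow> b i \<in> pm (2 ^ k)" "i \<in> pm (2 ^ k) \<Longrightarrow> a i \<in> pm (2 ^ k)" for i
    using B_pm[OF A_block_B] ab by blast+
  have abi: "a (b i) = translation k (vadd u v) ((s * t) * i)" if "i \<in> pm (2 ^ k)" for i
    using u(3)[OF pmb(1)[OF that]] v(3)[OF that] translation_comp[OF u(1) v(1)]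
    by (simp add: sg[OF u(2)] sg[OF v(2)] mult.assoc)
  have bai: "b (a i) = translation k (vadd u v) ((s * t) * i)" if "i \<in> pm (2 ^ k)" for i
  proof -
    have st: "s * t = 1 \<or> s * t = -1" using u(2) v(2) by auto
    have "b (a i) = t * (s * translation k v (translation k u i))"
      using v(3)[OF pmb(2)[OF that]] u(3)[OF that] by (simp add: sg[OF u(2)] sg[OF v(2)])
    then show ?thesis unfolding translation_comp[OF v(1) u(1)] sg[OF st] vadd_comm[of v u] by simp
  qed
  show "a \<circ> b \<in> A_block e k"
  proof (rule A_blockI)
    show "a \<circ> b \<in> carrier (B (2 ^ k))" using A_block_B ab B_comp by blast
    show "vadd u v \<in> V k" using vadd_V u(1) v(1) .
    show "s * t = 1 \<or> s * t = -1" using u(2) v(2) by auto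
    show "(a \<circ> b) i = translation k (vadd u v) (s * t * i)" if "i \<in> pm (2 ^ k)" for i
      using abi[OF that] by simp
  qed
  show "a (b x) = b (a x)" for x
    using abi bai B_fix[OF A_block_B[OF ab(1)]] B_fix[OF A_block_B[OF ab(2)]] by (cases "x \<in> pm (2 ^ k)") auto
next
  fix a x assume a: "a \<in> A_block e k"
  obtain u s where u: "u \<in> V k" "s = 1 \<or> s = -1" "\<And>i. i \<in> pm (2 ^ k) \<Longrightarrow> a i = translation k u (s * i)"
    by (rule A_blockE[OF a]) blast
  show "a (a x) = x"
  proof (cases "x \<in> pm (2 ^ k)")
    case True
    have 1: "a (a x) = translation k u (s * a x)" using u(3) True B_pm[OF A_block_B[OF a]] by blast
    have 2: "a x = translation k u (s * x)" using u(3)[OF True] .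
    have vv: "vadd u u = (\<lambda>_. 0)" by (simp add: vadd_def)
    have 3: "translation k u (translation k u i) = i" for i
      using translation_comp[OF u(1) u(1), of i] by (simp add: vv translation_zero)
    from u(2) show ?thesis using 1 2 3 by (auto simp: translation_odd)
  next
    case False
    then show ?thesis using B_fix[OF A_block_B[OF a]] by simp
  qed
qed

lemma orb_A_block:
  assumes x: "x \<in> pm (2 ^ k)" shows "orb (A_block e k) x = pm (2 ^ k)"
proof
  interpret elab_neg "A_block e k" "2 ^ k" by (rule elab_neg_A_block)
  show "orb (A_block e k) x \<subseteq> pm (2 ^ k)" by (rule orb_pm[OF x])
  show "pm (2 ^ k) \<subseteq> orb (A_block e k) x"
  proof
    fix y assume y: "y \<in> pm (2 ^ k)"
    let ?i = "nat \<bar>x\<bar>" and ?j = "nat \<bar>y\<bar>"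
    have ij: "?i \<in> {1..2 ^ k}" "?j \<in> {1..2 ^ k}"
      using x y by (auto simp: pm_def nat_le_iff le_nat_iff)
    define v where "v = vadd (e k ?i) (e k ?j)"
    have eV: "e k ?i \<in> V k" "e k ?j \<in> V k" using bij_betwE[OF e_bij] ij by auto
    have v: "v \<in> V k" unfolding v_def using vadd_V[OF eV] .
    have "e k (regular e k v ?i) = e k ?j"
      using regular_range[OF v ij(1)] vadd_self[of "e k ?i" "e k ?j"] vadd_comm[of v "e k ?i"] by (simp add: v_def)
    then have "regular e k v ?i = ?j" using regular_range[OF v ij(1)] ij(2) by (intro regular_eqI[of _ k]) simp_all
    then have "translation k v x = sgn x * \<bar>y\<bar>" by (simp add: signed_def)
    then have t: "translation k v x = y \<or> translation k v x = - y"
      using pm_nz[OF x] by (auto simp: sgn_if abs_if)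
    have tA: "translation k v \<in> A_block e k" using A_block_iff v by blast
    have "translation k v x \<in> orb (A_block e k) x" by (rule orbI[OF tA])
    moreover have "- translation k v x \<in> orb (A_block e k) x"
      using neg_orb[of "translation k v x"] B_pm[OF translation_B[OF v]] x orb_apply[OF tA] by simp
    ultimately show "y \<in> orb (A_block e k) x" using t by auto
  qed
qed

lemma one_pm: "1 \<in> pm (2 ^ k)" by (simp add: pm_def)

text \<open>A transitive abelian group is its own centraliser.\<close>

lemma saturated_A_block: "saturated (A_block e k) (2 ^ k)"
proof -
  interpret elab_neg "A_block e k" "2 ^ k" by (rule elab_neg_A_block)
  show ?thesis
  proof
    fix w assume w: "w \<in> carrier (B (2 ^ k))" "\<And>a x. a \<in> A_block e k \<Longrightarrow> w (a x) = a (w x)"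
      "\<And>x. x \<in> pm (2 ^ k) \<Longrightarrow> w x \<in> orb (A_block e k) x"
    obtain a where a: "a \<in> A_block e k" "w 1 = a 1" using w(3)[OF one_pm] by (rule orbE)
    have "w x = a x" for x
    proof (cases "x \<in> pm (2 ^ k)")
      case True
      then have "x \<in> orb (A_block e k) 1" using orb_A_block[OF one_pm] by simp
      then obtain c where c: "c \<in> A_block e k" "x = c 1" by (rule orbE)
      then show ?thesis using w(2)[OF c(1), of 1] comm[OF a(1) c(1), of 1] a(2) by simp
    next
      case False
      then show ?thesis using B_fix[OF w(1)] B_fix[OF in_B[OF a(1)]] by simp
    qed
    then have "w = a" by (rule ext)
    then show "w \<in> A_block e k" using a(1) by simp
  qed
qed

lemma orbit_type_A_block: "orbit_type (2 ^ k) (A_block e k) = {#2 ^ k#}"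
proof -
  have "orb (A_block e k) ` pm (2 ^ k) = (\<lambda>_. pm (2 ^ k)) ` pm (2 ^ k)"
    by (rule image_cong[OF refl orb_A_block])
  also have "\<dots> = {pm (2 ^ k)}" by (rule image_constant[OF one_pm])
  finally have "orb (A_block e k) ` pm (2 ^ k) = {pm (2 ^ k)}" .
  then show ?thesis by (simp add: orbit_type_def card_pm)
qed

end

section \<open>Direct sums\<close>

text \<open>The embedding of the signed points of the second summand, compatible with negation, and its inverse.\<close>

definition shift :: "nat \<Rightarrow> int \<Rightarrow> int" where
  "shift a j = j + sgn j * int a"

definition unshift :: "nat \<Rightarrow> int \<Rightarrow> int" where
  "unshift a i = i - sgn i * int a"

text \<open>One step of the recursion that defines \<open>A_list\<close>.\<close>

definition direct_sum :: "nat \<Rightarrow> (int \<Rightarrow> int) set \<Rightarrow> (int \<Rightarrow> int) set \<Rightarrow> (int \<Rightarrow> int) set" where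
  "direct_sum a S T = {block_sum a u v | u v. u \<in> S \<and> v \<in> T}"

lemma unshift_shift: "unshift a (shift a j) = j"
  by (auto simp: unshift_def shift_def sgn_if)

lemma shift_unshift: "\<bar>i\<bar> > int a \<Longrightarrow> shift a (unshift a i) = i"
  by (auto simp: unshift_def shift_def sgn_if)

lemma abs_shift: "j \<noteq> 0 \<Longrightarrow> \<bar>shift a j\<bar> = \<bar>j\<bar> + int a"
  by (auto simp: shift_def sgn_if)

lemma shift_odd: "shift a (- j) = - shift a j"
  by (simp add: shift_def)

lemma unshift_odd: "unshift a (- j) = - unshift a j"
  by (simp add: unshift_def)

lemma shift_inj: "shift a i = shift a j \<longleftrightarrow> i = j"
  by (metis unshift_shift)

lemma unshift_nz: "\<bar>i\<bar> > int a \<Longrightarrow> unshift a i \<noteq> 0"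
  by (auto simp: unshift_def sgn_if)

lemma block_sum_low: "\<bar>i\<bar> \<le> int a \<Longrightarrow> block_sum a u v i = u i"
  by (simp add: block_sum_def)

lemma block_sum_shift:
  assumes "j \<noteq> 0" shows "block_sum a u v (shift a j) = shift a (v j)"
proof -
  have 1: "\<not> \<bar>shift a j\<bar> \<le> int a" using abs_shift[OF assms, of a] assms by simp
  have 2: "shift a j - sgn (shift a j) * int a = j" using unshift_shift[of a j] by (simp add: unshift_def)
  have "block_sum a u v (shift a j) = v j + sgn (v j) * int a"
    unfolding block_sum_def if_not_P[OF 1] 2 Let_def by (rule refl)
  then show ?thesis by (simp add: shift_def)
qed

lemma low_or_shift:
  obtains (low) "\<bar>i\<bar> \<le> int a" | (high) j where "j \<noteq> 0" "i = shift a j"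
  using shift_unshift[of a i] unshift_nz[of a i] by (metis not_le)

lemma B_low: assumes u: "u \<in> carrier (B a)" shows "\<bar>u i\<bar> \<le> int a \<longleftrightarrow> \<bar>i\<bar> \<le> int a"
proof -
  have "\<bar>i\<bar> \<le> int a \<longleftrightarrow> i = 0 \<or> i \<in> pm a" for i by (auto simp: pm_def)
  then show ?thesis using B_pm[OF u] B_nz[OF u] by metis
qed

lemma pm_sum: "pm (a + b) = pm a \<union> shift a ` pm b"
proof -
  have "i \<in> pm (a + b) \<longleftrightarrow> i \<in> pm a \<union> shift a ` pm b" for i
  proof (cases rule: low_or_shift[where i = i and a = a])
    case low
    have "i \<notin> shift a ` pm b" using low abs_shift[of _ a] by (force simp: pm_def)
    then show ?thesis using low by (auto simp: pm_def)
  next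
    case (high j)
    then show ?thesis using abs_shift[of j a] by (auto simp: pm_def shift_inj image_iff)
  qed
  then show ?thesis by blast
qed

lemma pm_sum_disjoint: "pm a \<inter> shift a ` pm b = {}"
  using abs_shift[of _ a] by (force simp: pm_def)

lemma block_sum_B:
  assumes u: "u \<in> carrier (B a)" and v: "v \<in> carrier (B b)"
  shows "block_sum a u v \<in> carrier (B (a + b))"
proof -
  let ?w = "block_sum a u v"
  have odd: "?w (- i) = - ?w i" for i
  proof (cases rule: low_or_shift[where i = i and a = a])
    case low
    then show ?thesis using B_odd[OF u] by (simp add: block_sum_low)
  next
    case (high j)
    then show ?thesis using B_odd[OF v] by (simp add: block_sum_shift shift_odd[symmetric])
  qed
  have maps: "?w i \<in> pm (a + b)" if "i \<in> pm (a + b)" for i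
  proof -
    from that consider "i \<in> pm a" | j where "j \<in> pm b" "i = shift a j" by (auto simp: pm_sum)
    then show ?thesis
    proof cases
      case 1
      then have "?w i = u i" by (intro block_sum_low) (simp add: pm_def)
      then show ?thesis using 1 B_pm[OF u] by (simp add: pm_sum)
    next
      case 2
      then show ?thesis using B_pm[OF v] pm_nz[OF 2(1)] by (simp add: block_sum_shift pm_sum)
    qed
  qed
  have "inj ?w"
  proof (rule injI)
    fix x y assume eq: "?w x = ?w y"
    show "x = y"
    proof (cases rule: low_or_shift[where i = x and a = a])
      case x: low
      show ?thesis
      proof (cases rule: low_or_shift[where i = y and a = a])
        case low
        then show ?thesis using x eq B_inj[OF u] by (simp add: block_sum_low)
      next
        case (high j)
        then have "\<bar>?w y\<bar> > int a" using abs_shift[of "v j" a] B_nz[OF v, of j] by (simp add: block_sum_shift)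
        moreover have "\<bar>?w x\<bar> \<le> int a" using x B_low[OF u] by (simp add: block_sum_low)
        ultimately show ?thesis using eq by simp
      qed
    next
      case x: (high i)
      have wx: "\<bar>?w x\<bar> > int a" using abs_shift[of "v i" a] B_nz[OF v, of i] x by (simp add: block_sum_shift)
      show ?thesis
      proof (cases rule: low_or_shift[where i = y and a = a])
        case low
        then have "\<bar>?w y\<bar> \<le> int a" using B_low[OF u] by (simp add: block_sum_low)
        then show ?thesis using wx eq by simp
      next
        case (high j)
        then show ?thesis using x eq B_inj[OF v] by (simp add: block_sum_shift shift_inj)
      qed
    qed
  qed
  then have "inj_on ?w (pm (a + b))" by (rule inj_on_subset) simp
  moreover have "?w i = i" if "i \<notin> pm (a + b)" for i
  proof (cases rule: low_or_shift[where i = i and a = a])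
    case low
    then show ?thesis using that B_fix[OF u] by (simp add: block_sum_low pm_sum)
  next
    case (high j)
    then have "j \<notin> pm b" using that by (auto simp: pm_sum)
    then show ?thesis using high B_fix[OF v] by (simp add: block_sum_shift)
  qed
  ultimately show ?thesis using maps odd by (intro inj_in_B)
qed

lemma block_sum_comp:
  assumes u': "u' \<in> carrier (B a)" and v': "v' \<in> carrier (B b)"
  shows "block_sum a u v (block_sum a u' v' i) = block_sum a (u \<circ> u') (v \<circ> v') i"
proof (cases rule: low_or_shift[where i = i and a = a])
  case low
  then show ?thesis using B_low[OF u'] by (simp add: block_sum_low)
next
  case (high j)
  then show ?thesis using B_nz[OF v', of j] by (simp add: block_sum_shift)
qed

lemma block_sum_id: "block_sum a id id = id"
proof
  fix i show "block_sum a id id i = id i"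
    by (cases rule: low_or_shift[where i = i and a = a]) (simp_all add: block_sum_low block_sum_shift)
qed

lemma block_sum_neg: "block_sum a (neg_all a) (neg_all b) = neg_all (a + b)"
proof
  fix i show "block_sum a (neg_all a) (neg_all b) i = neg_all (a + b) i"
  proof (cases rule: low_or_shift[where i = i and a = a])
    case low
    then show ?thesis by (simp add: block_sum_low neg_all_def pm_def)
  next
    case (high j)
    have "shift a j \<in> pm (a + b) \<longleftrightarrow> j \<in> pm b" using high abs_shift[of j a] by (auto simp: pm_def)
    then show ?thesis using high by (simp add: block_sum_shift neg_all_def shift_odd)
  qed
qed

lemma direct_sumI: "u \<in> S \<Longrightarrow> v \<in> T \<Longrightarrow> block_sum a u v \<in> direct_sum a S T"
  by (auto simp: direct_sum_def)

lemma direct_sumE: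
  assumes "w \<in> direct_sum a S T" obtains u v where "u \<in> S" "v \<in> T" "w = block_sum a u v"
  using assms unfolding direct_sum_def by blast

context
  fixes a b S T assumes S: "saturated S a" and T: "saturated T b"
begin

interpretation S: saturated S a by (rule S)
interpretation T: saturated T b by (rule T)

lemma orb_sum_low:
  assumes "x \<in> pm a" shows "orb (direct_sum a S T) x = orb S x"
proof -
  have "\<bar>x\<bar> \<le> int a" using assms by (simp add: pm_def)
  note l = block_sum_low[OF this]
  show ?thesis
  proof
    show "orb (direct_sum a S T) x \<subseteq> orb S x"
    proof
      fix y assume "y \<in> orb (direct_sum a S T) x"
      then obtain w where "w \<in> direct_sum a S T" "y = w x" by (rule orbE)
      then show "y \<in> orb S x" using orbI by (elim direct_sumE) (simp add: l)
    qed
    show "orb S x \<subseteq> orb (direct_sum a S T) x"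
    proof
      fix y assume "y \<in> orb S x"
      then obtain u where u: "u \<in> S" "y = u x" by (rule orbE)
      show "y \<in> orb (direct_sum a S T) x"
        using orbI[OF direct_sumI[OF u(1) T.id_in], of a x] by (simp add: l u(2))
    qed
  qed
qed

lemma orb_sum_high:
  assumes "j \<in> pm b" shows "orb (direct_sum a S T) (shift a j) = shift a ` orb T j"
proof
  note h = block_sum_shift[OF pm_nz[OF assms], of a]
  show "orb (direct_sum a S T) (shift a j) \<subseteq> shift a ` orb T j"
  proof
    fix y assume "y \<in> orb (direct_sum a S T) (shift a j)"
    then obtain w where w: "w \<in> direct_sum a S T" "y = w (shift a j)" by (rule orbE)
    obtain u v where uv: "u \<in> S" "v \<in> T" "w = block_sum a u v" using w(1) by (rule direct_sumE)
    show "y \<in> shift a ` orb T j" using orbI[OF uv(2), of j] uv(3) w(2) h by simp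
  qed
  show "shift a ` orb T j \<subseteq> orb (direct_sum a S T) (shift a j)"
  proof
    fix y assume "y \<in> shift a ` orb T j"
    then obtain z where z: "z \<in> orb T j" "y = shift a z" by blast
    obtain v where v: "v \<in> T" "z = v j" using z(1) by (rule orbE)
    show "y \<in> orb (direct_sum a S T) (shift a j)"
      using orbI[OF direct_sumI[OF S.id_in v(1)], of a "shift a j"] by (simp add: h z(2) v(2))
  qed
qed

lemma elab_neg_direct_sum: "elab_neg (direct_sum a S T) (a + b)"
proof
  show "id \<in> direct_sum a S T" using direct_sumI[OF S.id_in T.id_in, of a] by (simp add: block_sum_id)
  show "neg_all (a + b) \<in> direct_sum a S T"
    using direct_sumI[OF S.neg_in T.neg_in, of a] by (simp add: block_sum_neg)
  show "direct_sum a S T \<subseteq> carrier (B (a + b))"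
  proof
    fix w assume "w \<in> direct_sum a S T"
    then obtain u v where "u \<in> S" "v \<in> T" "w = block_sum a u v" by (rule direct_sumE)
    then show "w \<in> carrier (B (a + b))" using block_sum_B[OF S.in_B T.in_B] by simp
  qed
next
  fix w w' assume "w \<in> direct_sum a S T" "w' \<in> direct_sum a S T"
  obtain u v where uv: "u \<in> S" "v \<in> T" "w = block_sum a u v" using \<open>w \<in> _\<close> by (rule direct_sumE)
  obtain u' v' where uv': "u' \<in> S" "v' \<in> T" "w' = block_sum a u' v'" using \<open>w' \<in> _\<close> by (rule direct_sumE)
  have eq: "w (w' x) = block_sum a (u \<circ> u') (v \<circ> v') x" for x
    using block_sum_comp[OF S.in_B[OF uv'(1)] T.in_B[OF uv'(2)]] uv(3) uv'(3) by simp
  have eq': "w' (w x) = block_sum a (u' \<circ> u) (v' \<circ> v) x" for x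
    using block_sum_comp[OF S.in_B[OF uv(1)] T.in_B[OF uv(2)]] uv(3) uv'(3) by simp
  have "u \<circ> u' = u' \<circ> u" "v \<circ> v' = v' \<circ> v"
    using S.comm[OF uv(1) uv'(1)] T.comm[OF uv(2) uv'(2)] by (simp_all add: fun_eq_iff)
  then show "w (w' x) = w' (w x)" for x by (simp only: eq eq')
  have "w \<circ> w' = block_sum a (u \<circ> u') (v \<circ> v')" using eq by (simp add: fun_eq_iff)
  then show "w \<circ> w' \<in> direct_sum a S T"
    using direct_sumI[OF S.comp_in[OF uv(1) uv'(1)] T.comp_in[OF uv(2) uv'(2)]] by simp
next
  fix w x assume "w \<in> direct_sum a S T"
  then obtain u v where uv: "u \<in> S" "v \<in> T" "w = block_sum a u v" by (rule direct_sumE)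
  have "u \<circ> u = id" "v \<circ> v = id" using S.sq[OF uv(1)] T.sq[OF uv(2)] by (simp_all add: fun_eq_iff)
  then show "w (w x) = x"
    using block_sum_comp[OF S.in_B[OF uv(1)] T.in_B[OF uv(2)], of u v x] by (simp add: uv(3) block_sum_id)
qed

text \<open>An element that preserves the orbits of the sum preserves both sets of points, and its restrictions lie in
  the summands because they are saturated.\<close>

lemma saturated_direct_sum: "saturated (direct_sum a S T) (a + b)"
proof -
  interpret D: elab_neg "direct_sum a S T" "a + b" by (rule elab_neg_direct_sum)
  show ?thesis
  proof
    fix w assume w: "w \<in> carrier (B (a + b))"
      and wc: "\<And>d x. d \<in> direct_sum a S T \<Longrightarrow> w (d x) = d (w x)"
      and wo: "\<And>x. x \<in> pm (a + b) \<Longrightarrow> w x \<in> orb (direct_sum a S T) x"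
    have lowS: "w x \<in> orb S x" if "x \<in> pm a" for x
      using wo[of x] orb_sum_low[OF that] that by (simp add: pm_sum)
    have highT: "w (shift a j) \<in> shift a ` orb T j" if "j \<in> pm b" for j
      using wo[of "shift a j"] orb_sum_high[OF that] that by (simp add: pm_sum)
    define u where "u i = (if i \<in> pm a then w i else i)" for i
    define v where "v j = (if j \<in> pm b then unshift a (w (shift a j)) else j)" for j
    have u_pm: "u i \<in> pm a" if "i \<in> pm a" for i using lowS[OF that] S.orb_pm[OF that] that by (auto simp: u_def)
    have shv: "shift a (v j) = w (shift a j)" "v j \<in> orb T j" if j: "j \<in> pm b" for j
    proof -
      obtain z where "z \<in> orb T j" "w (shift a j) = shift a z" using highT[OF j] by blast
      then show "shift a (v j) = w (shift a j)" "v j \<in> orb T j" using j by (simp_all add: v_def unshift_shift)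
    qed
    have v_pm: "v j \<in> pm b" if "j \<in> pm b" for j using shv(2)[OF that] T.orb_pm[OF that] by blast
    have "inj_on u (pm a)" using B_inj[OF w] by (auto simp: u_def inj_on_def)
    then have uB: "u \<in> carrier (B a)" using u_pm B_odd[OF w] by (intro inj_in_B) (simp_all add: u_def)
    have "inj_on v (pm b)"
    proof (rule inj_onI)
      fix i j assume "i \<in> pm b" "j \<in> pm b" "v i = v j"
      then have "w (shift a i) = w (shift a j)" using shv(1) by metis
      then show "i = j" using B_inj[OF w] shift_inj by simp
    qed
    then have vB: "v \<in> carrier (B b)"
      using v_pm B_odd[OF w] by (intro inj_in_B) (simp_all add: v_def shift_odd unshift_odd)
    have "w = block_sum a u v"
    proof
      fix i show "w i = block_sum a u v i"
      proof (cases rule: low_or_shift[where i = i and a = a])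
        case low
        then have "i \<in> pm a \<or> i = 0" by (auto simp: pm_def)
        then show ?thesis using low B_nz[OF w] by (auto simp: block_sum_low u_def pm_def)
      next
        case (high j)
        show ?thesis
        proof (cases "j \<in> pm b")
          case True
          then show ?thesis using high shv(1) by (simp add: block_sum_shift)
        next
          case False
          then have "i \<notin> pm (a + b)" using high abs_shift[of j a] by (auto simp: pm_def)
          then show ?thesis using high False B_fix[OF w] by (simp add: block_sum_shift v_def)
        qed
      qed
    qed
    moreover have "u \<in> S"
    proof (rule S.saturated[OF uB])
      fix c x assume c: "c \<in> S"
      show "u (c x) = c (u x)"
      proof (cases "x \<in> pm a")
        case True
        have l: "\<bar>x\<bar> \<le> int a" "\<bar>w x\<bar> \<le> int a"
          using True u_pm[OF True] by (simp_all add: pm_def u_def)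
        show ?thesis using wc[OF direct_sumI[OF c T.id_in], of x] True B_pm[OF S.in_B[OF c]]
          by (simp add: block_sum_low l u_def)
      next
        case False
        then show ?thesis using B_fix[OF uB] B_fix[OF S.in_B[OF c]] by simp
      qed
    qed (use lowS in \<open>simp add: u_def\<close>)
    moreover have "v \<in> T"
    proof (rule T.saturated[OF vB])
      fix c j assume c: "c \<in> T"
      show "v (c j) = c (v j)"
      proof (cases "j \<in> pm b")
        case True
        have conj_by: "c j \<in> pm b" using B_pm[OF T.in_B[OF c]] True by simp
        have "shift a (v (c j)) = w (shift a (c j))" using shv(1)[OF conj_by] .
        also have "\<dots> = w (block_sum a id c (shift a j))" using pm_nz[OF True] by (simp add: block_sum_shift)
        also have "\<dots> = block_sum a id c (w (shift a j))" by (rule wc[OF direct_sumI[OF S.id_in c]])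
        also have "\<dots> = shift a (c (v j))"
          by (simp add: shv(1)[OF True, symmetric] block_sum_shift[OF pm_nz[OF v_pm[OF True]]])
        finally show ?thesis by (simp add: shift_inj)
      next
        case False
        then show ?thesis using B_fix[OF vB] B_fix[OF T.in_B[OF c]] by simp
      qed
    qed (use shv(2) in simp)
    ultimately show "w \<in> direct_sum a S T" using direct_sumI by simp
  qed
qed

lemma orbit_type_direct_sum:
  "orbit_type (a + b) (direct_sum a S T) = orbit_type a S + orbit_type b T"
proof -
  let ?D = "direct_sum a S T"
  let ?P = "orb S ` pm a" and ?Q = "orb T ` pm b"
  have "orb ?D ` pm a = ?P" using orb_sum_low by (intro image_cong) auto
  moreover have "orb ?D ` shift a ` pm b = (`) (shift a) ` ?Q"
    unfolding image_image using orb_sum_high by (intro image_cong) auto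
  ultimately have orbs: "orb ?D ` pm (a + b) = ?P \<union> (`) (shift a) ` ?Q"
    by (simp only: pm_sum image_Un)
  have empty: "R = {}" if "R \<in> ?P" "R \<in> (`) (shift a) ` ?Q" for R
  proof -
    have "R \<subseteq> pm a" using that(1) S.orb_pm by auto
    moreover have "R \<subseteq> shift a ` pm b" using that(2) T.orb_pm by auto
    ultimately show ?thesis using pm_sum_disjoint by blast
  qed
  have ne: "{} \<notin> ?P" using S.orb_self by auto
  have disj: "?P \<inter> (`) (shift a) ` ?Q = {}"
  proof (rule Int_emptyI)
    fix R assume R: "R \<in> ?P" "R \<in> (`) (shift a) ` ?Q"
    show False using empty[OF R] R(1) ne by simp
  qed
  have inj: "inj (shift a)" by (rule injI) (simp add: shift_inj)
  have inj': "inj_on ((`) (shift a)) ?Q" using inj by (intro inj_onI) (simp add: inj_image_eq_iff)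
  have c: "card (shift a ` Q) = card Q" for Q by (rule card_image) (rule inj_on_subset[OF inj], simp)
  have "orbit_type (a + b) ?D = orbit_type a S + image_mset (\<lambda>Q. card Q div 2) (mset_set ((`) (shift a) ` ?Q))"
    unfolding orbit_type_def orbs by (subst mset_set_Union) (use disj in auto)
  also have "image_mset (\<lambda>Q. card Q div 2) (mset_set ((`) (shift a) ` ?Q)) = orbit_type b T"
    unfolding orbit_type_def image_mset_mset_set[OF inj', symmetric] by (simp add: multiset.map_comp comp_def c)
  finally show ?thesis .
qed

end

lemma saturated_trivial: "saturated {id} 0" and orbit_type_trivial: "orbit_type 0 {id} = {#}"
proof -
  have pm0: "pm 0 = {}" by (auto simp: pm_def)
  have B0: "w = id" if "w \<in> carrier (B 0)" for w using that by (simp add: carrier_B pm0)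
  have "neg_all 0 = id" by (simp add: neg_all_def pm0 fun_eq_iff)
  then show "saturated {id} 0"
    using B0 id_B by (simp add: saturated_def elab_neg_def elab_def elab_neg_axioms_def saturated_axioms_def)
  show "orbit_type 0 {id} = {#}" by (simp add: orbit_type_def pm0)
qed

lemma saturated_A_list:
  assumes e: "enumeration e"
  shows "saturated (A_list e ks) (\<Sum>k\<leftarrow>ks. 2 ^ k) \<and>
     orbit_type (\<Sum>k\<leftarrow>ks. 2 ^ k) (A_list e ks) = mset (map (\<lambda>k. 2 ^ k) ks)"
proof (induction ks)
  case Nil
  then show ?case by (simp add: saturated_trivial orbit_type_trivial)
next
  case (Cons k ks)
  have "A_list e (k # ks) = direct_sum (2 ^ k) (A_block e k) (A_list e ks)"
    by (simp add: direct_sum_def)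
  then show ?case
    using saturated_direct_sum[OF saturated_A_block[OF e, of k] conjunct1[OF Cons]]
      orbit_type_direct_sum[OF saturated_A_block[OF e, of k] conjunct1[OF Cons]]
      orbit_type_A_block[OF e, of k] Cons by simp
qed

lemma saturated_A_part:
  assumes e: "enumeration e" and parts: "part_order parts" and \<pi>: "admissible n \<pi>"
  shows "saturated (A_part e parts \<pi>) n" and "orbit_type n (A_part e parts \<pi>) = \<pi>"
proof -
  have m: "mset (map (\<lambda>k. 2 ^ k) (parts \<pi>)) = \<pi>" using parts \<pi> by (auto simp: part_order_def)
  have "(\<Sum>k\<leftarrow>parts \<pi>. 2 ^ k) = sum_mset (mset (map (\<lambda>k. 2 ^ k :: nat) (parts \<pi>)))"
    by (simp only: sum_mset_sum_list)
  also have "\<dots> = n" unfolding m using \<pi> by (simp add: admissible_def)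
  finally have "(\<Sum>k\<leftarrow>parts \<pi>. 2 ^ k) = n" .
  then show "saturated (A_part e parts \<pi>) n" "orbit_type n (A_part e parts \<pi>) = \<pi>"
    using saturated_A_list[OF e, of "parts \<pi>"] m by (simp_all add: A_part_def)
qed

section \<open>Small orbits carry elements of sign -1\<close>

context saturated
begin

lemma orb_pm_eq: "y \<in> orb A x \<Longrightarrow> x \<in> pm n \<Longrightarrow> y \<in> pm n"
  using orb_pm by blast

lemma orb_neg: "y \<in> orb A x \<Longrightarrow> x \<in> pm n \<Longrightarrow> - y \<in> orb A x"
  using neg_orb[of y] orb_eq[of y x] orb_pm_eq[of y x] by simp

lemma orb_small:
  assumes x: "x \<in> pm n" and c: "card (orb A x) = 2 \<or> card (orb A x) = 4"
  obtains y where "y \<in> orb A x" "y \<noteq> x" "orb A x = {x, - x, y, - y}" "card (orb A x) = 2 \<longleftrightarrow> y = - x"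
proof -
  have x0: "x \<noteq> 0" using pm_nz[OF x] .
  have xs: "{x, - x} \<subseteq> orb A x" using orb_self[of x] neg_orb[OF x] by simp
  have c2: "card {x, - x} = 2" using x0 by simp
  from c show thesis
  proof
    assume 2: "card (orb A x) = 2"
    then have "orb A x = {x, - x}" using card_subset_eq[OF finite_orb xs] c2 by simp
    then have o: "orb A x = {x, - x, - x, - (- x)}" by auto
    show thesis by (rule that[OF _ _ o]) (use 2 xs x0 in simp_all)
  next
    assume 4: "card (orb A x) = 4"
    have "\<not> orb A x \<subseteq> {x, - x}" using card_mono[of "{x, - x}" "orb A x"] c2 4 by auto
    then obtain y where y: "y \<in> orb A x" "y \<noteq> x" "y \<noteq> - x" by blast
    have sub: "{x, - x, y, - y} \<subseteq> orb A x" using xs y(1) orb_neg[OF y(1) x] by simp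
    have "y \<noteq> 0" using pm_nz[OF orb_pm_eq[OF y(1) x]] .
    then have "card {x, - x, y, - y} = 4" using x0 y by auto
    then have "orb A x = {x, - x, y, - y}" using card_subset_eq[OF finite_orb sub] 4 by simp
    then show thesis using that[OF y(1,2)] y 4 by simp
  qed
qed

lemma orb_two: assumes x: "x \<in> pm n" and c: "card (orb A x) = 2" shows "orb A x = {x, - x}"
proof -
  obtain y where "orb A x = {x, - x, y, - y}" "card (orb A x) = 2 \<longleftrightarrow> y = - x"
    using orb_small[OF x disjI1[OF c]] by metis
  then show ?thesis using c by auto
qed

text \<open>On the orbit, this reflection agrees with the element that moves \<open>x\<close> to \<open>y\<close>. The case \<open>y = - x\<close> of an
  orbit of size 2 is included.\<close>

lemma rfl_in_A:
  assumes x: "x \<in> pm n" and y: "y \<in> orb A x" "y \<noteq> x" and o: "orb A x = {x, - x, y, - y}"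
  shows "rfl x y \<in> A"
proof (rule saturated_local)
  have ypm: "y \<in> pm n" using orb_pm_eq[OF y(1) x] .
  show "rfl x y \<in> carrier (B n)" by (rule rfl_in_B[OF x ypm])
  obtain c where c: "c \<in> A" "y = c x" using y(1) by (rule orbE)
  fix z assume z: "z \<in> pm n"
  show "\<exists>a\<in>A. \<forall>p\<in>orb A z. rfl x y p = a p"
  proof (cases "z \<in> orb A x")
    case True
    have "c y = x" using sq[OF c(1), of x] c(2) by simp
    then have "\<forall>p\<in>orb A x. rfl x y p = c p"
      using c(2) B_odd[OF in_B[OF c(1)]] pm_nz[OF x] pm_nz[OF ypm] unfolding o by (auto simp: rfl_def)
    then show ?thesis using c(1) orb_eq[OF True] by auto
  next
    case False
    have "p \<notin> orb A x" if "p \<in> orb A z" for p using orb_avoid[OF False that] .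
    then have "\<forall>p\<in>orb A z. rfl x y p = id p" unfolding o by (auto simp: rfl_def)
    then show ?thesis using id_in by blast
  qed
qed

lemma ex_small_reflection:
  assumes x: "x \<in> pm n" and c: "card (orb A x) = 2 \<or> card (orb A x) = 4"
  obtains s where "s \<in> A" "sgn_B n s = -1" "\<And>p. p \<notin> orb A x \<Longrightarrow> s p = p"
proof -
  obtain y where y: "y \<in> orb A x" "y \<noteq> x" "orb A x = {x, - x, y, - y}" using orb_small[OF x c] by blast
  show thesis
  proof (rule that)
    show "rfl x y \<in> A" using rfl_in_A[OF x y] .
    show "sgn_B n (rfl x y) = -1" using sgn_rfl[OF x orb_pm_eq[OF y(1) x]] y(2) by simp
    show "rfl x y p = p" if "p \<notin> orb A x" for p using that unfolding y(3) by (simp add: rfl_def)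
  qed
qed

lemma card_orb_big:
  assumes "x \<in> pm n" "card (orb A x) \<noteq> 2" "card (orb A x) \<noteq> 4"
  shows "8 \<le> card (orb A x)"
proof -
  obtain k where k: "card (orb A x) = 2 ^ Suc k" using card_orb_pow2[OF assms(1)] by blast
  have "k \<noteq> 0" "k \<noteq> 1" using k assms(2,3) by auto
  then have "3 \<le> Suc k" by simp
  then have "(2::nat) ^ 3 \<le> 2 ^ Suc k" by (rule power_increasing) simp
  then show ?thesis using k by simp
qed

lemma ex_sgn_neg_iff:
  "(\<exists>a\<in>A. sgn_B n a = -1) \<longleftrightarrow> (\<exists>x\<in>pm n. card (orb A x) = 2 \<or> card (orb A x) = 4)"
proof
  assume "\<exists>a\<in>A. sgn_B n a = -1"
  then obtain a where a: "a \<in> A" "sgn_B n a = -1" by blast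
  show "\<exists>x\<in>pm n. card (orb A x) = 2 \<or> card (orb A x) = 4"
  proof (rule ccontr)
    assume "\<not> ?thesis"
    then have "sgn_B n a = 1" using card_orb_big by (intro sgn_elem[OF a(1)]) blast
    then show False using a(2) by simp
  qed
next
  assume "\<exists>x\<in>pm n. card (orb A x) = 2 \<or> card (orb A x) = 4"
  then obtain x where x: "x \<in> pm n" "card (orb A x) = 2 \<or> card (orb A x) = 4" by blast
  then show "\<exists>a\<in>A. sgn_B n a = -1" using ex_small_reflection[OF x] by metis
qed

text \<open>Negates the orbit of \<open>x\<close> and fixes all other points. Elements of this kind detect the orbits: what
  commutes with \<open>neg_on x\<close> preserves the orbit of \<open>x\<close>.\<close>

definition neg_on :: "int \<Rightarrow> int \<Rightarrow> int" where
  "neg_on x z = (if z \<in> orb A x then - z else z)"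

lemma neg_on_in: assumes x: "x \<in> pm n" shows "neg_on x \<in> A"
proof (rule saturated_local)
  have neg: "- z \<in> orb A x \<longleftrightarrow> z \<in> orb A x" for z using orb_neg[of z x] orb_neg[of "- z" x] x by auto
  have invol: "neg_on x (neg_on x z) = z" for z using neg by (simp add: neg_on_def)
  show "neg_on x \<in> carrier (B n)"
    by (rule involution_in_B[OF invol]) (use orb_pm[OF x] neg in \<open>auto simp: neg_on_def\<close>)
  fix z assume z: "z \<in> pm n"
  show "\<exists>a\<in>A. \<forall>p\<in>orb A z. neg_on x p = a p"
  proof (cases "orb A z = orb A x")
    case True
    then have "\<forall>p\<in>orb A z. neg_on x p = neg_all n p" using orb_pm[OF x] by (auto simp: neg_on_def neg_all_def)
    then show ?thesis using neg_in by blast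
  next
    case False
    have "p \<notin> orb A x" if "p \<in> orb A z" for p using False orb_eq[OF that] orb_eq[of p x] by auto
    then have "\<forall>p\<in>orb A z. neg_on x p = id p" by (simp add: neg_on_def)
    then show ?thesis using id_in by blast
  qed
qed

lemma sgn_neg_on:
  assumes x: "x \<in> pm n" and c: "card (orb A x) \<noteq> 2" shows "sgn_B n (neg_on x) = 1"
proof (cases "card (orb A x) = 4")
  case True
  obtain y where y: "y \<in> orb A x" "orb A x = {x, - x, y, - y}" "card (orb A x) = 2 \<longleftrightarrow> y = - x" "y \<noteq> x"
    using orb_small[OF x disjI2[OF True]] by metis
  have ypm: "y \<in> pm n" using orb_pm_eq[OF y(1) x] .
  have nz: "x \<noteq> 0" "y \<noteq> 0" "y \<noteq> - x" using pm_nz x ypm y(3) c by auto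
  have "neg_on x = rfl x (- x) \<circ> rfl y (- y)"
    using nz y(4) by (auto simp: neg_on_def y(2) rfl_def fun_eq_iff)
  then show ?thesis
    using sgn_comp[OF rfl_in_B[of x n "- x"] rfl_in_B[of y n "- y"]] sgn_rfl[of x n "- x"] sgn_rfl[of y n "- y"]
      x ypm nz by simp
next
  case False
  show ?thesis
  proof (rule sgn_elem[OF neg_on_in[OF x]])
    fix i assume i: "i \<in> pm n"
    show "neg_on x i = i \<or> 8 \<le> card (orb A i)"
      using card_orb_big[OF x c False] orb_eq[of i x] by (auto simp: neg_on_def)
  qed
qed

end

section \<open>The even part of a saturated group\<close>

definition even_part :: "nat \<Rightarrow> (int \<Rightarrow> int) set \<Rightarrow> (int \<Rightarrow> int) set" where
  "even_part n A = A \<inter> carrier (Bplus n)"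

lemma even_part_iff: "A \<subseteq> carrier (B n) \<Longrightarrow> a \<in> even_part n A \<longleftrightarrow> a \<in> A \<and> sgn_B n a = 1"
  by (auto simp: even_part_def carrier_Bplus)

definition irrelevant_type :: "nat multiset \<Rightarrow> bool" where
  "irrelevant_type \<pi> \<longleftrightarrow> mult2 0 \<pi> = 2 \<and> mult2 1 \<pi> = 0"

context saturated
begin

lemma mem_even_part: "a \<in> even_part n A \<longleftrightarrow> a \<in> A \<and> sgn_B n a = 1"
  by (rule even_part_iff[OF sub])

lemma elab_even_part: "elab (even_part n A)"
proof
  show "id \<in> even_part n A" using id_in sgn_id by (simp add: mem_even_part)
  show "a \<circ> b \<in> even_part n A" if "a \<in> even_part n A" "b \<in> even_part n A" for a b
    using that comp_in sgn_comp[OF in_B in_B] by (simp add: mem_even_part)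
  show "a (b x) = b (a x)" if "a \<in> even_part n A" "b \<in> even_part n A" for a b x
    using that comm[of a b x] by (simp add: mem_even_part)
  show "a (a x) = x" if "a \<in> even_part n A" for a x using that sq[of a x] by (simp add: mem_even_part)
qed

lemma even_part_sub_B: "even_part n A \<subseteq> carrier (B n)"
  using mem_even_part in_B by blast

lemma orb_even_part_sub: "orb (even_part n A) x \<subseteq> orb A x"
  unfolding orb_def using mem_even_part by blast

text \<open>An odd element that fixes \<open>x\<close> corrects the sign of any element without changing its value at \<open>x\<close>.\<close>

lemma orb_even_part_eq:
  assumes b: "b \<in> A" "b x = x" "sgn_B n b = -1"
  shows "orb (even_part n A) x = orb A x"
proof
  show "orb A x \<subseteq> orb (even_part n A) x"
  proof
    fix y assume "y \<in> orb A x"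
    then obtain a where a: "a \<in> A" "y = a x" by (rule orbE)
    show "y \<in> orb (even_part n A) x"
    proof (cases "sgn_B n a = 1")
      case True
      then show ?thesis using orbI[of a "even_part n A" x] a by (simp add: mem_even_part)
    next
      case False
      then have "sgn_B n a = -1" using sgn_cases[OF in_B[OF a(1)]] by blast
      then have "a \<circ> b \<in> even_part n A"
        using comp_in[OF a(1) b(1)] sgn_comp[OF in_B[OF a(1)] in_B[OF b(1)]] b(3) by (simp add: mem_even_part)
      from orbI[OF this, of x] show ?thesis using a(2) b(2) by simp
    qed
  qed
qed (rule orb_even_part_sub)

text \<open>The exceptional situation: all reflections in \<open>A\<close> live on a single orbit, so that no odd element fixes a
  point of it.\<close>

definition special_at :: "int \<Rightarrow> bool" where
  "special_at x \<longleftrightarrow> x \<in> pm n \<and> card (orb A x) = 4 \<and>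
     (\<forall>z\<in>pm n. z \<notin> orb A x \<longrightarrow> 8 \<le> card (orb A z))"

text \<open>If some orbit of size 2 or 4 avoids \<open>x\<close>, its reflection is an odd element that fixes \<open>x\<close>. Otherwise the
  orbit of \<open>x\<close> has size 2 and is \<open>{x, - x}\<close>, or all elements are even, or \<open>x\<close> is special.\<close>

lemma orb_even_part_nonspecial:
  assumes ns: "\<not> (\<exists>x. special_at x)" and x: "x \<in> pm n"
  shows "orb A x = orb (even_part n A) x \<union> uminus ` orb (even_part n A) x"
proof -
  have sub1: "orb (even_part n A) x \<union> uminus ` orb (even_part n A) x \<subseteq> orb A x"
    using orb_even_part_sub[of x] orb_neg[OF _ x] by blast
  have selfx: "x \<in> orb (even_part n A) x" using elab.orb_self[OF elab_even_part] .
  have "orb A x \<subseteq> orb (even_part n A) x \<union> uminus ` orb (even_part n A) x"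
  proof (cases "card (orb A x) = 2")
    case True
    then show ?thesis using orb_two[OF x] selfx by auto
  next
    case False
    have "orb (even_part n A) x = orb A x"
    proof (cases "\<exists>z\<in>pm n. (card (orb A z) = 2 \<or> card (orb A z) = 4) \<and> x \<notin> orb A z")
      case True
      then obtain z where z: "z \<in> pm n" "card (orb A z) = 2 \<or> card (orb A z) = 4" "x \<notin> orb A z" by blast
      obtain s where s: "s \<in> A" "sgn_B n s = -1" "\<And>p. p \<notin> orb A z \<Longrightarrow> s p = p"
        using ex_small_reflection[OF z(1,2)] by blast
      show ?thesis using orb_even_part_eq[OF s(1) s(3)[OF z(3)] s(2)] .
    next
      case no: False
      have "\<not> (\<exists>z\<in>pm n. card (orb A z) = 2 \<or> card (orb A z) = 4)"
      proof
        assume "\<exists>z\<in>pm n. card (orb A z) = 2 \<or> card (orb A z) = 4"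
        then obtain z where z: "z \<in> pm n" "card (orb A z) = 2 \<or> card (orb A z) = 4" by blast
        then have "orb A x = orb A z" using no orb_eq by blast
        then have c4: "card (orb A x) = 4" using z False by simp
        have "8 \<le> card (orb A p)" if p: "p \<in> pm n" "p \<notin> orb A x" for p
        proof (rule ccontr)
          assume "\<not> 8 \<le> card (orb A p)"
          then have "card (orb A p) = 2 \<or> card (orb A p) = 4" using card_orb_big[OF p(1)] by blast
          then have "x \<in> orb A p" using no p(1) by blast
          then show False using orb_eq[of x p] orb_self[of p] p(2) by simp
        qed
        then show False using ns x c4 unfolding special_at_def by blast
      qed
      then have "sgn_B n a = 1" if "a \<in> A" for a
        using ex_sgn_neg_iff that sgn_cases[OF in_B[OF that]] by blast
      then have "even_part n A = A" using mem_even_part by blast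
      then show ?thesis by simp
    qed
    then show ?thesis by simp
  qed
  then show ?thesis using sub1 by (rule subset_antisym)
qed

text \<open>Off the special case, the even part determines the group: commuting with the even part and
  respecting its orbits up to sign already forces membership.\<close>

lemma localize_even_part_nonspecial:
  assumes ns: "\<not> (\<exists>x. special_at x)" shows "localize n (even_part n A) = A"
proof
  show "A \<subseteq> localize n (even_part n A)"
  proof
    fix a assume a: "a \<in> A"
    have "a x \<in> orb (even_part n A) x \<or> - a x \<in> orb (even_part n A) x" for x
    proof (cases "x \<in> pm n")
      case True
      have "a x \<in> orb (even_part n A) x \<union> uminus ` orb (even_part n A) x"
        using orbI[OF a, of x] orb_even_part_nonspecial[OF ns True] by simp
      then show ?thesis by auto
    next
      case False
      then show ?thesis using B_fix[OF in_B[OF a]] elab.orb_self[OF elab_even_part, of x] by simp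
    qed
    moreover have "a (g x) = g (a x)" if "g \<in> even_part n A" for g x
      using comm[OF a, of g x] that by (simp add: mem_even_part)
    ultimately show "a \<in> localize n (even_part n A)" unfolding localize_def using in_B[OF a] by blast
  qed
  show "localize n (even_part n A) \<subseteq> A"
  proof
    fix w assume w: "w \<in> localize n (even_part n A)"
    then have wB: "w \<in> carrier (B n)" by (simp add: localize_def)
    show "w \<in> A"
    proof (rule saturated[OF wB])
      fix x assume x: "x \<in> pm n"
      have "w x \<in> orb (even_part n A) x \<or> - w x \<in> orb (even_part n A) x" using w by (simp add: localize_def)
      then show "w x \<in> orb A x" using orb_even_part_sub[of x] orb_neg[of "- w x" x] x by auto
    next
      fix c x assume c: "c \<in> A"
      show "w (c x) = c (w x)"
      proof (cases "x \<in> pm n")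
        case True
        have "c x \<in> orb (even_part n A) x \<union> uminus ` orb (even_part n A) x"
          using orbI[OF c, of x] orb_even_part_nonspecial[OF ns True] by simp
        then have "c x \<in> orb (even_part n A) x \<or> - c x \<in> orb (even_part n A) x" by auto
        then obtain h t where h: "h \<in> even_part n A" "t = 1 \<or> t = -1" "c x = t * h x"
        proof
          assume "c x \<in> orb (even_part n A) x"
          then obtain h where h: "h \<in> even_part n A" "c x = h x" by (rule orbE)
          show thesis by (rule that[OF h(1), of 1]) (simp_all add: h(2))
        next
          assume "- c x \<in> orb (even_part n A) x"
          then obtain h where h: "h \<in> even_part n A" "- c x = h x" by (rule orbE)
          show thesis by (rule that[OF h(1), of "-1"]) (simp_all add: h(2)[symmetric])
        qed
        obtain g s where g: "g \<in> even_part n A" "s = 1 \<or> s = -1" "w x = s * g x"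
          by (rule localizeE[OF elab_even_part even_part_sub_B w])
        have hA: "h \<in> A" "g \<in> A" using h(1) g(1) by (simp_all add: mem_even_part)
        have odd: "f (r * z) = r * f z" if "f \<in> carrier (B n)" "r = 1 \<or> r = -1" for f r z
          using that B_odd[OF that(1)] by auto
        have "w (c x) = t * h (w x)"
          unfolding h(3) odd[OF wB h(2)] localize_comm[OF elab_even_part even_part_sub_B w h(1)] ..
        also have "\<dots> = t * (s * h (g x))" unfolding g(3) odd[OF in_B[OF hA(1)] g(2)] ..
        also have "\<dots> = s * (t * g (h x))" using comm[OF hA, of x] by simp
        also have "t * g (h x) = g (c x)" unfolding h(3) odd[OF in_B[OF hA(2)] h(2)] ..
        also have "g (c x) = c (g x)" by (rule comm[OF hA(2) c])
        also have "s * c (g x) = c (w x)" unfolding g(3) odd[OF in_B[OF c] g(2)] ..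
        finally show ?thesis .
      next
        case False
        then show ?thesis using B_fix[OF wB] B_fix[OF in_B[OF c]] by simp
      qed
    qed
  qed
qed

lemma special_orb:
  assumes sp: "special_at x"
  obtains y where "orb A x = {x, - x, y, - y}" "y \<in> orb A x" "y \<noteq> x" "y \<noteq> - x" "y \<in> pm n" "x \<in> pm n"
    "x \<noteq> 0" "y \<noteq> 0"
proof -
  have x: "x \<in> pm n" and c: "card (orb A x) = 4" using sp by (auto simp: special_at_def)
  obtain y where y: "y \<in> orb A x" "orb A x = {x, - x, y, - y}" "card (orb A x) = 2 \<longleftrightarrow> y = - x" "y \<noteq> x"
    using orb_small[OF x disjI2[OF c]] by metis
  have "y \<in> pm n" using orb_pm_eq[OF y(1) x] .
  then show thesis using that[OF y(2,1,4)] y(3) c x pm_nz by auto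
qed

text \<open>Up to an even element supported on the larger orbits, an element of \<open>A\<close> is determined by its value at
  \<open>x\<close>; negation is even, and the two reflections are odd.\<close>

lemma special_sgn:
  assumes sp: "special_at x" and a: "a \<in> A"
  shows "sgn_B n a = 1 \<longleftrightarrow> a x = x \<or> a x = - x"
proof -
  obtain y where y: "orb A x = {x, - x, y, - y}" "y \<in> orb A x" "y \<noteq> x" "y \<noteq> - x" "y \<in> pm n" "x \<in> pm n"
    "x \<noteq> 0" "y \<noteq> 0" by (rule special_orb[OF sp])
  have eq: "sgn_B n a = sgn_B n b" if b: "b \<in> A" "a x = b x" for b
  proof -
    have ab: "b \<circ> a \<in> A" using comp_in[OF b(1) a] .
    have "sgn_B n (b \<circ> a) = 1"
    proof (rule sgn_elem[OF ab])
      fix i assume i: "i \<in> pm n"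
      show "(b \<circ> a) i = i \<or> 8 \<le> card (orb A i)"
      proof (cases "i \<in> orb A x")
        case True
        then have "a i = b i" using agree_on_orb[OF a b] by simp
        then show ?thesis using sq[OF b(1), of i] by simp
      next
        case False
        then show ?thesis using sp i by (simp add: special_at_def)
      qed
    qed
    then show ?thesis using sgn_comp[OF in_B[OF b(1)] in_B[OF a]] sgn_cases[OF in_B[OF b(1)]]
      sgn_cases[OF in_B[OF a]] by auto
  qed
  have c: "card (orb A x) \<noteq> 2" using sp by (simp add: special_at_def)
  have o': "orb A x = {x, - x, - y, - (- y)}" using y(1) by auto
  have r1: "rfl x y \<in> A" "sgn_B n (rfl x y) = -1"
    using rfl_in_A[OF y(6,2,3,1)] sgn_rfl[OF y(6,5)] y(3) by auto
  have r2: "rfl x (- y) \<in> A" "sgn_B n (rfl x (- y)) = -1"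
    using rfl_in_A[OF y(6) _ _ o'] y sgn_rfl[of x n "- y"] by auto
  have "a x \<in> {x, - x, y, - y}" using orbI[OF a, of x] y(1) by simp
  moreover have "a x = x \<Longrightarrow> sgn_B n a = 1" using eq[OF id_in] sgn_id by simp
  moreover have "a x = - x \<Longrightarrow> sgn_B n a = 1"
    using eq[OF neg_on_in[OF y(6)]] sgn_neg_on[OF y(6) c] by (simp add: neg_on_def y(1))
  moreover have "a x = y \<Longrightarrow> sgn_B n a = -1" using eq[OF r1(1)] r1(2) by (simp add: rfl_def)
  moreover have "a x = - y \<Longrightarrow> sgn_B n a = -1" using eq[OF r2(1)] r2(2) by (simp add: rfl_def)
  ultimately show ?thesis using y(3,4,7,8) by auto
qed

lemma special_other: assumes sp: "special_at x" and y: "y \<in> orb A x" shows "special_at y"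
  using sp orb_eq[OF y] orb_pm_eq[OF y] by (simp add: special_at_def)

lemma special_orb_even_part:
  assumes sp: "special_at x" shows "orb (even_part n A) x = {x, - x}"
proof
  have x: "x \<in> pm n" and c: "card (orb A x) \<noteq> 2" using sp by (auto simp: special_at_def)
  show "orb (even_part n A) x \<subseteq> {x, - x}"
  proof
    fix z assume "z \<in> orb (even_part n A) x"
    then obtain a where "a \<in> even_part n A" "z = a x" by (rule orbE)
    then show "z \<in> {x, - x}" using special_sgn[OF sp, of a] by (simp add: mem_even_part)
  qed
  have "neg_on x \<in> even_part n A" using neg_on_in[OF x] sgn_neg_on[OF x c] by (simp add: mem_even_part)
  from orbI[OF this, of x] have "- x \<in> orb (even_part n A) x" using orb_self[of x] by (simp add: neg_on_def)
  then show "{x, - x} \<subseteq> orb (even_part n A) x" using elab.orb_self[OF elab_even_part, of x] by simp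
qed

lemma special_orb_even_part_other:
  assumes sp: "special_at x" and z: "z \<notin> orb A x" shows "orb (even_part n A) z = orb A z"
proof -
  have x: "x \<in> pm n" "card (orb A x) = 2 \<or> card (orb A x) = 4" using sp by (auto simp: special_at_def)
  obtain s where s: "s \<in> A" "sgn_B n s = -1" "\<And>p. p \<notin> orb A x \<Longrightarrow> s p = p"
    using ex_small_reflection[OF x] by blast
  show ?thesis using orb_even_part_eq[OF s(1) s(3)[OF z] s(2)] .
qed

lemma special_orb_set:
  assumes sp: "special_at x" shows "orb A x = {z \<in> pm n. card (orb (even_part n A) z) = 2}"
proof -
  have x: "x \<in> pm n" using sp by (simp add: special_at_def)
  have "card (orb (even_part n A) z) = 2" if "z \<in> orb A x" for z
    using special_orb_even_part[OF special_other[OF sp that]] pm_nz[OF orb_pm_eq[OF that x]] by simp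
  moreover have "card (orb (even_part n A) z) \<noteq> 2" if "z \<in> pm n" "z \<notin> orb A x" for z
  proof -
    have "8 \<le> card (orb A z)" using sp that by (simp add: special_at_def)
    then show ?thesis using special_orb_even_part_other[OF sp that(2)] by simp
  qed
  ultimately show ?thesis using orb_pm[OF x] by blast
qed

text \<open>The even part acts on the orbit of size 4 by \<open>\<plusminus>1\<close> only, so that this orbit falls apart into two orbits
  of size 2.\<close>

lemma special_localize_irrelevant:
  assumes sp: "special_at x" shows "irrelevant_type (orbit_type n (localize n (even_part n A)))"
proof -
  let ?L = "localize n (even_part n A)"
  interpret L: saturated ?L n by (rule saturated_localize[OF elab_even_part even_part_sub_B])
  obtain y where y: "orb A x = {x, - x, y, - y}" "y \<in> orb A x" "y \<noteq> x" "y \<noteq> - x" "y \<in> pm n" "x \<in> pm n"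
    "x \<noteq> 0" "y \<noteq> 0" by (rule special_orb[OF sp])
  have Lorb: "orb ?L z = orb (even_part n A) z \<union> uminus ` orb (even_part n A) z" if "z \<in> pm n" for z
    using orb_localize[OF elab_even_part even_part_sub_B that] .
  have Lx: "orb ?L z = {z, - z}" if "z \<in> orb A x" for z
    using Lorb[OF orb_pm_eq[OF that y(6)]] special_orb_even_part[OF special_other[OF sp that]] by auto
  have Lbig: "8 \<le> card (orb ?L z)" if z: "z \<in> pm n" "z \<notin> orb A x" for z
  proof -
    have "orb A z \<subseteq> orb ?L z" using Lorb[OF z(1)] special_orb_even_part_other[OF sp z(2)] by blast
    then have "card (orb A z) \<le> card (orb ?L z)" by (rule card_mono[OF L.finite_orb])
    moreover have "8 \<le> card (orb A z)" using sp z by (simp add: special_at_def)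
    ultimately show ?thesis by simp
  qed
  have cz: "card (orb ?L z) = 2" if "z \<in> orb A x" for z
    using Lx[OF that] pm_nz[OF orb_pm_eq[OF that y(6)]] by simp
  have "{Q \<in> orb ?L ` pm n. card Q = 2} = {orb ?L x, orb ?L y}"
  proof
    show "{Q \<in> orb ?L ` pm n. card Q = 2} \<subseteq> {orb ?L x, orb ?L y}"
    proof
      fix Q assume "Q \<in> {Q \<in> orb ?L ` pm n. card Q = 2}"
      then obtain z where z: "z \<in> pm n" "Q = orb ?L z" "card (orb ?L z) = 2" by blast
      then have "z \<in> orb A x" using Lbig[of z] by fastforce
      then have "Q = {z, - z}" "z \<in> {x, - x, y, - y}" using Lx[of z] z(2) y(1) by simp_all
      then show "Q \<in> {orb ?L x, orb ?L y}" using Lx[OF orb_self[of x]] Lx[OF y(2)] by auto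
    qed
    show "{orb ?L x, orb ?L y} \<subseteq> {Q \<in> orb ?L ` pm n. card Q = 2}"
      using y(5,6) cz[OF orb_self[of x]] cz[OF y(2)] by simp
  qed
  moreover have "orb ?L x \<noteq> orb ?L y" using Lx[OF orb_self[of x]] Lx[OF y(2)] y(3,4) by auto
  ultimately have "mult2 0 (orbit_type n ?L) = 2" unfolding L.mult2_orbit_type by simp
  moreover have "card (orb ?L z) \<noteq> 4" if "z \<in> pm n" for z
    using Lbig[OF that] cz[of z] by (cases "z \<in> orb A x") auto
  then have "mult2 1 (orbit_type n ?L) = 0" unfolding L.mult2_eq_0_iff by simp
  ultimately show ?thesis by (simp add: irrelevant_type_def)
qed

end

text \<open>The special case cannot occur for only one of the two groups, since the localisation of the common even
  part is the other group or has irrelevant type. If it occurs for both, the orbit of size 4 is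
  recognised as the set of points with an orbit of size 2 under the even part, and either group is
  generated by the even part and a reflection on that set.\<close>

lemma even_part_determines:
  assumes A: "saturated A n" and A': "saturated A' n"
    and r: "\<not> irrelevant_type (orbit_type n A)" and r': "\<not> irrelevant_type (orbit_type n A')"
    and eq: "even_part n A = even_part n A'"
  shows "A = A'"
proof -
  interpret A: saturated A n by (rule A)
  interpret A': saturated A' n by (rule A')
  have sp: "(\<exists>x. A.special_at x) \<longleftrightarrow> (\<exists>x. A'.special_at x)"
    using A.special_localize_irrelevant A'.special_localize_irrelevant
      A.localize_even_part_nonspecial A'.localize_even_part_nonspecial r r' eq by metis
  show ?thesis
  proof (cases "\<exists>x. A.special_at x")
    case False
    then show ?thesis using sp A.localize_even_part_nonspecial A'.localize_even_part_nonspecial eq by metis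
  next
    case True
    then obtain x where x: "A.special_at x" by blast
    obtain x' where x': "A'.special_at x'" using True sp by blast
    have o: "orb A x = orb A' x'" using A.special_orb_set[OF x] A'.special_orb_set[OF x'] eq by simp
    then have o': "orb A' x = orb A x" using A'.orb_eq[of x x'] A.orb_self[of x] by simp
    obtain y where y: "orb A x = {x, - x, y, - y}" "y \<in> orb A x" "y \<noteq> x" "y \<noteq> - x" "y \<in> pm n" "x \<in> pm n"
      "x \<noteq> 0" "y \<noteq> 0" by (rule A.special_orb[OF x])
    let ?s = "rfl x y"
    have s: "?s \<in> A" "?s \<in> A'"
      using A.rfl_in_A[OF y(6,2,3,1)] A'.rfl_in_A[OF y(6)] y o' by auto
    have ss: "?s \<circ> (?s \<circ> a) = a" for a using A.sq[OF s(1)] by (simp add: fun_eq_iff)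
    have sg: "sgn_B n ?s = -1" using sgn_rfl[OF y(6,5)] y(3) by simp
    \<comment> \<open>Odd elements of \<open>C\<close> become even after multiplication by the common reflection.\<close>
    have half: "a \<in> D" if C: "saturated C n" and D: "saturated D n" and h: "even_part n C = even_part n D"
      and sC: "?s \<in> C" and sD: "?s \<in> D" and a: "a \<in> C" for C D a
    proof -
      interpret C: saturated C n by (rule C)
      interpret D: saturated D n by (rule D)
      show "a \<in> D"
      proof (cases "sgn_B n a = 1")
        case True
        then show ?thesis using a h C.mem_even_part D.mem_even_part by blast
      next
        case False
        then have "sgn_B n a = -1" using sgn_cases[OF C.in_B[OF a]] by blast
        then have "?s \<circ> a \<in> even_part n C"
          using C.comp_in[OF sC a] sgn_comp[OF C.in_B[OF sC] C.in_B[OF a]] sg by (simp add: C.mem_even_part)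
        then have "?s \<circ> a \<in> D" using h D.mem_even_part by blast
        then show ?thesis using D.comp_in[OF sD, of "?s \<circ> a"] ss[of a] by simp
      qed
    qed
    show ?thesis using half[OF A A' eq s] half[OF A' A eq[symmetric] s(2,1)] by blast
  qed
qed

context saturated
begin

text \<open>Composing with the reflection that negates \<open>q\<close> would give an element of \<open>A\<close> that fixes the orbit of size
  4 pointwise, hence an even one, although \<open>w\<close> is even and the reflection is odd.\<close>

lemma special_no_half_flip:
  assumes sp: "special_at p" and o: "orb A p = {p, - p, q, - q}" and q: "q \<in> pm n"
    and w: "w \<in> carrier (B n)" "sgn_B n w = 1" and wp: "w p = p" "w q = - q"
    and loc: "\<And>z. z \<in> pm n \<Longrightarrow> z \<notin> orb A p \<Longrightarrow> \<exists>a\<in>A. \<forall>i\<in>orb A z. w i = a i"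
  shows False
proof -
  let ?s = "rfl q (- q)" let ?k = "rfl q (- q) \<circ> w"
  have q0: "q \<noteq> 0" "- q \<in> pm n" using pm_nz[OF q] q by auto
  have sB: "?s \<in> carrier (B n)" using rfl_in_B[OF q q0(2)] .
  have p0: "p \<noteq> 0" using sp pm_nz[of p n] by (simp add: special_at_def)
  have c4: "card (orb A p) = 4" using sp by (simp add: special_at_def)
  have "False" if "p = q \<or> p = - q"
  proof -
    have "orb A p = {p, - p}" unfolding o using that by (elim disjE) auto
    then show False using c4 p0 by simp
  qed
  then have pq: "p \<noteq> q" "p \<noteq> - q" by blast+
  have kB: "?k \<in> carrier (B n)" using B_comp[OF sB w(1)] .
  have "?k p = p" "?k q = q" using wp pq by (simp_all add: rfl_def)
  then have kfix: "?k i = i" if "i \<in> orb A p" for i using that B_odd[OF kB] unfolding o by auto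
  have kA: "?k \<in> A"
  proof (rule saturated_local[OF kB])
    fix z assume z: "z \<in> pm n"
    show "\<exists>a\<in>A. \<forall>i\<in>orb A z. ?k i = a i"
    proof (cases "z \<in> orb A p")
      case True
      then have "\<forall>i\<in>orb A z. ?k i = id i" using kfix orb_eq[OF True] by simp
      then show ?thesis using id_in by blast
    next
      case False
      obtain a where a: "a \<in> A" "\<forall>i\<in>orb A z. w i = a i" using loc[OF z False] by blast
      have "?k i = a i" if i: "i \<in> orb A z" for i
      proof -
        have "a i \<in> orb A z" using orbI[OF a(1), of i] orb_eq[OF i] by simp
        then have "a i \<notin> orb A p" by (rule orb_avoid[OF False])
        then show ?thesis using a(2) i unfolding o by (simp add: rfl_def)
      qed
      then show ?thesis using a(1) by blast
    qed
  qed
  have "sgn_B n ?k = 1"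
  proof (rule sgn_elem[OF kA])
    fix i assume "i \<in> pm n"
    then show "?k i = i \<or> 8 \<le> card (orb A i)" using kfix[of i] sp by (auto simp: special_at_def)
  qed
  moreover have "sgn_B n ?k = -1" using sgn_comp[OF sB w(1)] w(2) sgn_rfl[OF q q0(2)] q0(1) by simp
  ultimately show False by simp
qed

text \<open>Let \<open>w\<close> be an element of a larger group. It preserves the orbits of size at least 4 because it commutes
  with \<open>neg_on x\<close>. Suppose it interchanges two orbits of size 2. Relevance provides a third orbit that
  carries a reflection; the product of this reflection with one on the first orbit is even, but does
  not commute with \<open>w\<close>. So \<open>w\<close> preserves all orbits. Off the special case this puts \<open>w\<close> into the
  localisation of the even part, which is \<open>A\<close>. In the special case the restriction of \<open>w\<close> to the orbit
  of size 4 is an involution, and it agrees with an element of \<open>A\<close> unless it negates exactly one of two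
  coordinates; the latter is excluded by its sign.\<close>

lemma even_part_maximal:
  assumes rel: "\<not> irrelevant_type (orbit_type n A)"
    and F: "elab F" and FB: "F \<subseteq> carrier (Bplus n)" and sup: "even_part n A \<subseteq> F"
  shows "F \<subseteq> even_part n A"
proof
  interpret F: elab F by (rule F)
  fix w assume w: "w \<in> F"
  have wB: "w \<in> carrier (B n)" and ws: "sgn_B n w = 1" using w FB carrier_Bplus by blast+
  have wc: "w (h z) = h (w z)" if "h \<in> even_part n A" for h z using F.comm[OF w, of h z] sup that by blast
  have wnz: "w z \<noteq> 0" if "z \<in> pm n" for z using B_nz[OF wB, of z] pm_nz[OF that] by simp
  have step1: "w x \<in> orb A x" if x: "x \<in> pm n" and c: "card (orb A x) \<noteq> 2" for x
  proof (rule ccontr)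
    assume no: "w x \<notin> orb A x"
    have "neg_on x \<in> even_part n A" using neg_on_in[OF x] sgn_neg_on[OF x c] by (simp add: mem_even_part)
    from wc[OF this, of x] have "w (- x) = w x" using no orb_self[of x] by (simp add: neg_on_def)
    then show False using B_odd[OF wB] wnz[OF x] by simp
  qed
  have step2: "w x \<in> orb A x" if x: "x \<in> pm n" and c: "card (orb A x) = 2" for x
  proof (rule ccontr)
    assume no: "w x \<notin> orb A x"
    let ?y = "w x"
    have wy: "w ?y = x" using F.sq[OF w] .
    have ypm: "?y \<in> pm n" using B_pm[OF wB] x by simp
    have cy: "card (orb A ?y) = 2"
    proof (rule ccontr)
      assume "card (orb A ?y) \<noteq> 2"
      from step1[OF ypm this] have "orb A x = orb A ?y" using wy orb_eq[of x ?y] by simp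
      then show False using no orb_self[of ?y] by simp
    qed
    have diff: "orb A x \<noteq> orb A ?y" using no orb_self[of ?y] by auto
    have "\<exists>z\<in>pm n. (card (orb A z) = 2 \<or> card (orb A z) = 4) \<and> x \<notin> orb A z \<and> ?y \<notin> orb A z"
    proof (rule ccontr)
      assume none: "\<not> ?thesis"
      have xy: "orb A z = orb A x \<or> orb A z = orb A ?y" if "z \<in> pm n" "card (orb A z) = 2 \<or> card (orb A z) = 4" for z
        using none that orb_eq[of x z] orb_eq[of ?y z] by auto
      have "{Q \<in> orb A ` pm n. card Q = 2} = {orb A x, orb A ?y}"
      proof
        show "{Q \<in> orb A ` pm n. card Q = 2} \<subseteq> {orb A x, orb A ?y}"
        proof
          fix Q assume "Q \<in> {Q \<in> orb A ` pm n. card Q = 2}"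
          then obtain z where "z \<in> pm n" "Q = orb A z" "card (orb A z) = 2" by blast
          then show "Q \<in> {orb A x, orb A ?y}" using xy[of z] by simp
        qed
        show "{orb A x, orb A ?y} \<subseteq> {Q \<in> orb A ` pm n. card Q = 2}" using x ypm c cy by simp
      qed
      then have "mult2 0 (orbit_type n A) = 2" unfolding mult2_orbit_type using diff by simp
      moreover have "card (orb A z) \<noteq> 4" if z: "z \<in> pm n" for z
      proof
        assume "card (orb A z) = 4"
        then show False using xy[OF z] c cy by auto
      qed
      then have "mult2 1 (orbit_type n A) = 0" unfolding mult2_eq_0_iff by simp
      ultimately show False using rel by (simp add: irrelevant_type_def)
    qed
    then obtain z where z: "z \<in> pm n" "card (orb A z) = 2 \<or> card (orb A z) = 4" "x \<notin> orb A z" "?y \<notin> orb A z"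
      by blast
    obtain s where s: "s \<in> A" "sgn_B n s = -1" "\<And>p. p \<notin> orb A z \<Longrightarrow> s p = p"
      using ex_small_reflection[OF z(1,2)] by blast
    obtain r where r: "r \<in> A" "sgn_B n r = -1" "\<And>p. p \<notin> orb A x \<Longrightarrow> r p = p"
      using ex_small_reflection[OF x disjI1[OF c]] by blast
    have "r x \<noteq> x"
    proof
      assume rx: "r x = x"
      have "r p = id p" for p
      proof (cases "p \<in> orb A x")
        case True
        show ?thesis by (rule agree_on_orb[OF r(1) id_in _ True]) (simp add: rx)
      qed (simp add: r(3))
      then have "r = id" by (rule ext)
      then show False using r(2) sgn_id by simp
    qed
    then have rx: "r x = - x" using orbI[OF r(1), of x] orb_two[OF x c] by auto
    have rs: "r \<circ> s \<in> even_part n A"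
      using comp_in[OF r(1) s(1)] sgn_comp[OF in_B[OF r(1)] in_B[OF s(1)]] r(2) s(2) by (simp add: mem_even_part)
    have "w ((r \<circ> s) x) = (r \<circ> s) ?y" using wc[OF rs] .
    then have "- ?y = ?y" using s(3)[OF z(3)] s(3)[OF z(4)] rx r(3)[OF no] B_odd[OF wB, of x] by simp
    then show False using wnz[OF x] by simp
  qed
  have wo: "w x \<in> orb A x" if "x \<in> pm n" for x using step1[OF that] step2[OF that] by blast
  have "w \<in> A"
  proof (cases "\<exists>x. special_at x")
    case False
    have "w x \<in> orb (even_part n A) x \<or> - w x \<in> orb (even_part n A) x" for x
    proof (cases "x \<in> pm n")
      case True
      have "w x \<in> orb (even_part n A) x \<union> uminus ` orb (even_part n A) x"
        using wo[OF True] orb_even_part_nonspecial[OF False True] by simp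
      then show ?thesis by auto
    next
      case out: False
      then show ?thesis using B_fix[OF wB] elab.orb_self[OF elab_even_part, of x] by simp
    qed
    then have "w \<in> localize n (even_part n A)" unfolding localize_def using wB wc by simp
    then show ?thesis using localize_even_part_nonspecial[OF False] by simp
  next
    case True
    then obtain x where sp: "special_at x" by blast
    obtain y where y: "orb A x = {x, - x, y, - y}" "y \<in> orb A x" "y \<noteq> x" "y \<noteq> - x" "y \<in> pm n" "x \<in> pm n"
      "x \<noteq> 0" "y \<noteq> 0" by (rule special_orb[OF sp])
    have oy: "orb A y = orb A x" by (rule orb_eq[OF y(2)])
    have loc: "\<exists>a\<in>A. \<forall>i\<in>orb A z. w i = a i" if z: "z \<in> pm n" "z \<notin> orb A x" for z
    proof -
      have oz: "orb (even_part n A) z = orb A z" by (rule special_orb_even_part_other[OF sp z(2)])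
      then have "w z \<in> orb (even_part n A) z" using wo[OF z(1)] by simp
      then obtain h where h: "h \<in> even_part n A" "w z = h z" by (rule orbE)
      have hA: "h \<in> A" using h(1) by (simp add: mem_even_part)
      have "w i = h i" if "i \<in> orb A z" for i
      proof -
        have "i \<in> orb (even_part n A) z" using oz that by simp
        then obtain g where g: "g \<in> even_part n A" "i = g z" by (rule orbE)
        then have "g \<in> A" by (simp add: mem_even_part)
        then show ?thesis using wc[OF g(1), of z] h(2) g(2) comm[OF hA, of g z] by simp
      qed
      then show ?thesis using hA by blast
    qed
    have here: "\<exists>a\<in>A. w x = a x \<and> w y = a y"
    proof -
      have wx: "w x \<in> {x, - x, y, - y}" using wo[OF y(6)] y(1) by simp
      have wy: "w y \<in> {x, - x, y, - y}" using wo[OF y(5)] y(1) oy by simp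
      have ww: "w (w i) = i" for i using F.sq[OF w] .
      have odd: "w (- i) = - w i" for i using B_odd[OF wB] .
      obtain b where b: "b \<in> A" "y = b x" using y(2) by (rule orbE)
      have bb: "b y = x" using sq[OF b(1), of x] b(2) by simp
      have nb: "neg_all n \<circ> b \<in> A" using comp_in[OF neg_in b(1)] .
      have neg: "neg_all n x = - x" "neg_all n y = - y" using neg_apply y(5,6) by auto
      have inj: "w x = w y \<Longrightarrow> False" "w x = - w y \<Longrightarrow> False"
        using B_inj[OF wB, of x y] B_inj[OF wB, of x "- y"] odd[of y] y(3,4) by auto
      consider "w x = x" "w y = y" | "w x = - x" "w y = - y" | "w x = x" "w y = - y" | "w x = - x" "w y = y"
        | "w x = y" "w y = x" | "w x = - y" "w y = - x"
        using wx wy inj ww[of x] odd[of y] by (auto simp: minus_equation_iff)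
      then show ?thesis
      proof cases
        case 1
        then show ?thesis using id_in by (intro bexI[of _ id]) simp_all
      next
        case 2
        then show ?thesis using neg neg_in by (intro bexI[of _ "neg_all n"]) simp_all
      next
        case 3
        then show ?thesis using special_no_half_flip[OF sp y(1,5) wB ws 3 loc] by simp
      next
        case 4
        have o2: "orb A y = {y, - y, x, - x}" using y(1) oy by auto
        have loc': "\<And>z. z \<in> pm n \<Longrightarrow> z \<notin> orb A y \<Longrightarrow> \<exists>a\<in>A. \<forall>i\<in>orb A z. w i = a i"
          using loc oy by simp
        show ?thesis
          using special_no_half_flip[OF special_other[OF sp y(2)] o2 y(6) wB ws 4(2,1) loc'] by simp
      next
        case 5
        then show ?thesis using b bb by (intro bexI[of _ b]) simp_all
      next
        case 6
        then show ?thesis using b(2) bb neg nb by (intro bexI[of _ "neg_all n \<circ> b"]) simp_all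
      qed
    qed
    show ?thesis
    proof (rule saturated_local[OF wB])
      fix z assume z: "z \<in> pm n"
      show "\<exists>a\<in>A. \<forall>i\<in>orb A z. w i = a i"
      proof (cases "z \<in> orb A x")
        case True
        obtain a where a: "a \<in> A" "w x = a x" "w y = a y" using here by blast
        have "w i = a i" if "i \<in> orb A z" for i
          using that a B_odd[OF wB] B_odd[OF in_B[OF a(1)]] unfolding orb_eq[OF True] y(1) by auto
        then show ?thesis using a(1) by blast
      next
        case False
        then show ?thesis using loc[OF z] by simp
      qed
    qed
  qed
  then show "w \<in> even_part n A" using ws by (simp add: mem_even_part)
qed

end

lemma rfl_conj: "w \<in> carrier (B n) \<Longrightarrow> w (rfl i j k) = rfl (w i) (w j) (w k)"
  by (simp add: rfl_def B_odd[symmetric] B_inj)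

lemma rfl_neg: "i \<noteq> 0 \<Longrightarrow> j \<noteq> 0 \<Longrightarrow> rfl (- i) (- j) k = rfl i j k"
  by (auto simp: rfl_def)

context saturated
begin

text \<open>On an orbit of size 8, modulo sign, \<open>A\<close> is the regular four-group on 4 points. A transposition
  of two of these points is affine, so it normalises the four-group; it is a single reflection.\<close>

lemma ex_normalizing_reflection:
  assumes x: "x \<in> pm n" and c8: "card (orb A x) = 8"
  shows "\<exists>s\<in>carrier (B n). sgn_B n s = -1 \<and> conj_by s A = A"
proof -
  have x0: "x \<noteq> 0" using pm_nz[OF x] .
  have nz: "p \<noteq> 0" if "p \<in> orb A x" for p using pm_nz[OF orb_pm_eq[OF that x]] .
  have xs: "{x, - x} \<subseteq> orb A x" using orb_self[of x] neg_orb[OF x] by simp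
  have "\<not> orb A x \<subseteq> {x, - x}" using card_mono[of "{x, - x}" "orb A x"] x0 c8 by auto
  then obtain y where y: "y \<in> orb A x" "y \<noteq> x" "y \<noteq> - x" by blast
  have "card {x, - x, y, - y} \<le> 4"
    by (intro card_insert_le_m1) simp_all
  then have "\<not> orb A x \<subseteq> {x, - x, y, - y}" using card_mono[of "{x, - x, y, - y}" "orb A x"] c8 by auto
  then obtain z where z: "z \<in> orb A x" "z \<noteq> x" "z \<noteq> - x" "z \<noteq> y" "z \<noteq> - y" by blast
  obtain b where b: "b \<in> A" "y = b x" using y(1) by (rule orbE)
  obtain c where c: "c \<in> A" "z = c x" using z(1) by (rule orbE)
  note bo = B_odd[OF in_B[OF b(1)]] and co = B_odd[OF in_B[OF c(1)]]
  define u where "u = b z"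
  have u: "u \<in> orb A x" using orbI[OF b(1), of z] orb_eq[OF z(1)] by (simp add: u_def)
  have bv: "b x = y" "b y = x" "b z = u" "b u = z"
    using b(2) sq[OF b(1)] by (simp_all add: u_def)
  have cv: "c x = z" "c z = x" "c y = u" "c u = y"
    using c(2) b(2) sq[OF c(1)] comm[OF b(1) c(1), of x] comm[OF c(1) b(1), of z] by (simp_all add: u_def)
  have ux: "u \<noteq> x" "u \<noteq> - x" using bv(4) bv(1) bo[of x] z(4,5) by auto
  have uy: "u \<noteq> y" "u \<noteq> - y" using bv(4) bv(2) bo[of y] z(2,3) by auto
  have xz: "x \<in> orb A z" using orb_eq[OF z(1)] orb_self[of x] by simp
  have "b z \<noteq> z"
  proof
    assume "b z = z"
    then have "b x = id x" using agree_on_orb[OF b(1) id_in _ xz] by simp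
    then show False using bv(1) y(2) by simp
  qed
  moreover have "b z \<noteq> - z"
  proof
    assume "b z = - z"
    then have "b z = neg_all n z" using neg_apply[OF orb_pm_eq[OF z(1) x]] by simp
    then have "b x = neg_all n x" by (rule agree_on_orb[OF b(1) neg_in _ xz])
    then show False using bv(1) y(3) neg_apply[OF x] by simp
  qed
  ultimately have uz: "u \<noteq> z" "u \<noteq> - z" by (simp_all add: u_def)
  have ne4: "p \<noteq> q \<and> - p \<noteq> q \<and> p \<noteq> - q \<and> - p \<noteq> - q \<and> q \<noteq> p \<and> - q \<noteq> p \<and> q \<noteq> - p \<and> - q \<noteq> - p"
    if "q \<noteq> p" "q \<noteq> - p" for p q :: int using that by auto
  note ne = ne4[OF y(2,3)] ne4[OF z(2,3)] ne4[OF z(4,5)] ne4[OF ux] ne4[OF uy] ne4[OF uz]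
  have n0: "y \<noteq> 0" "z \<noteq> 0" "u \<noteq> 0" using nz y(1) z(1) u by auto
  have "distinct [x, - x, y, - y, z, - z, u, - u]" using ne x0 n0 by simp
  then have "card {x, - x, y, - y, z, - z, u, - u} = 8"
    using distinct_card[of "[x, - x, y, - y, z, - z, u, - u]"] by simp
  moreover have "{x, - x, y, - y, z, - z, u, - u} \<subseteq> orb A x"
    using xs y(1) z(1) u orb_neg[OF _ x] by simp
  ultimately have o: "orb A x = {x, - x, y, - y, z, - z, u, - u}"
    using card_subset_eq[OF finite_orb] c8 by metis
  let ?s = "rfl y z"
  have ypm: "y \<in> pm n" "z \<in> pm n" using orb_pm_eq[OF _ x] y(1) z(1) by auto
  have sB: "?s \<in> carrier (B n)" using rfl_in_B[OF ypm] .
  note so = B_odd[OF sB]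
  have sv: "?s x = x" "?s u = u" "?s y = z" "?s z = y" using ne by (auto simp: rfl_def)
  have sfix: "?s p = p" if "p \<notin> orb A x" for p using that unfolding o by (auto simp: rfl_def)
  have sorb: "?s p \<in> orb A x" if "p \<in> orb A x" for p
    using that sv so unfolding o by auto
  have ss: "?s (?s p) = p" for p using rfl_rfl n0 by simp
  \<comment> \<open>The conjugate of \<open>d\<close> by the reflection agrees on the orbit with an element of \<open>A\<close>.\<close>
  define P where "P d \<longleftrightarrow> (\<exists>d'\<in>A. \<forall>p\<in>orb A x. ?s (d (?s p)) = d' p)" for d
  have PI: "P d" if d: "d \<in> A" "d' \<in> A" and v: "?s (d x) = d' x" "?s (d z) = d' y" "?s (d y) = d' z" "?s (d u) = d' u"
    for d d'
  proof -
    have "?s (d (?s p)) = d' p" if p: "p \<in> orb A x" for p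
      using p v sv so B_odd[OF in_B[OF d(1)]] B_odd[OF in_B[OF d(2)]] unfolding o by auto
    then show ?thesis unfolding P_def using d(2) by blast
  qed
  have Pid: "P id" by (rule PI[OF id_in id_in]) (simp_all add: sv)
  \<comment> \<open>Conjugation by the reflection interchanges \<open>b\<close> and \<open>c\<close>.\<close>
  have Pb: "P b" by (rule PI[OF b(1) c(1)]) (simp_all add: sv bv cv)
  have Pc: "P c" by (rule PI[OF c(1) b(1)]) (simp_all add: sv bv cv)
  have bc: "b \<circ> c \<in> A" using comp_in[OF b(1) c(1)] .
  have Pbc: "P (b \<circ> c)" by (rule PI[OF bc bc]) (simp_all add: sv bv cv)
  have Pneg: "P (neg_all n \<circ> d)" if d: "P d" "d \<in> A" for d
  proof -
    obtain d' where d': "d' \<in> A" "\<forall>p\<in>orb A x. ?s (d (?s p)) = d' p" using d(1) unfolding P_def by blast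
    have "?s ((neg_all n \<circ> d) (?s p)) = (neg_all n \<circ> d') p" if p: "p \<in> orb A x" for p
    proof -
      have pp: "p \<in> pm n" using orb_pm_eq[OF p x] .
      have "d (?s p) \<in> pm n" "d' p \<in> pm n" using B_pm[OF in_B[OF d(2)]] B_pm[OF sB] B_pm[OF in_B[OF d'(1)]] pp by auto
      then show ?thesis using d'(2) p so by (simp add: neg_apply)
    qed
    then show ?thesis unfolding P_def using comp_in[OF neg_in d'(1)] by blast
  qed
  have Pagree: "P a" if a: "a \<in> A" "d \<in> A" "a x = d x" "P d" for a d
    using a(4) agree_on_orb[OF a(1-3) sorb] unfolding P_def by simp
  have PA: "P a" if a: "a \<in> A" for a
  proof -
    have "a x \<in> orb A x" using orbI[OF a] .
    then consider "a x = x" | "a x = y" | "a x = z" | "a x = u" | "a x = - x" | "a x = - y" | "a x = - z" | "a x = - u"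
      unfolding o by blast
    then show ?thesis
    proof cases
      case 1 show ?thesis by (rule Pagree[OF a id_in _ Pid]) (simp add: 1)
    next
      case 2 show ?thesis by (rule Pagree[OF a b(1) _ Pb]) (simp add: 2 bv)
    next
      case 3 show ?thesis by (rule Pagree[OF a c(1) _ Pc]) (simp add: 3 cv)
    next
      case 4 show ?thesis by (rule Pagree[OF a bc _ Pbc]) (simp add: 4 bv cv)
    next
      case 5 show ?thesis
        by (rule Pagree[OF a comp_in[OF neg_in id_in] _ Pneg[OF Pid id_in]]) (simp add: 5 neg_apply x)
    next
      case 6 show ?thesis
        by (rule Pagree[OF a comp_in[OF neg_in b(1)] _ Pneg[OF Pb b(1)]]) (simp add: 6 bv neg_apply ypm)
    next
      case 7 show ?thesis
        by (rule Pagree[OF a comp_in[OF neg_in c(1)] _ Pneg[OF Pc c(1)]]) (simp add: 7 cv neg_apply ypm)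
    next
      case 8 show ?thesis
        by (rule Pagree[OF a comp_in[OF neg_in bc] _ Pneg[OF Pbc bc]])
           (simp add: 8 bv cv neg_apply orb_pm_eq[OF u x])
    qed
  qed
  have fs: "finv ?s = ?s" using inv_rfl n0 by simp
  have conj: "?s \<circ> a \<circ> ?s \<in> A" if a: "a \<in> A" for a
  proof (rule saturated_local)
    show "?s \<circ> a \<circ> ?s \<in> carrier (B n)" using B_comp[OF B_comp[OF sB in_B[OF a]] sB] .
    fix t assume t: "t \<in> pm n"
    show "\<exists>d\<in>A. \<forall>p\<in>orb A t. (?s \<circ> a \<circ> ?s) p = d p"
    proof (cases "t \<in> orb A x")
      case True
      then show ?thesis using PA[OF a] orb_eq[OF True] by (simp add: P_def)
    next
      case False
      have out: "p \<notin> orb A x" if "p \<in> orb A t" for p using orb_avoid[OF False that] .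
      have "(?s \<circ> a \<circ> ?s) p = a p" if p: "p \<in> orb A t" for p
      proof -
        have "a p \<in> orb A t" using orbI[OF a, of p] orb_eq[OF p] by simp
        then show ?thesis using sfix out p by simp
      qed
      then show ?thesis using a by blast
    qed
  qed
  have sub': "conj_by ?s A \<subseteq> A" using conj unfolding conj_by_def fs by auto
  have "?s \<circ> ?s = id" using ss by (simp add: fun_eq_iff)
  then have "conj_by ?s (conj_by ?s A) = A" using conj_by_comp[OF sB sB] conj_by_id by simp
  moreover have "conj_by ?s (conj_by ?s A) \<subseteq> conj_by ?s A" using sub' unfolding conj_by_def by blast
  ultimately have "conj_by ?s A = A" using sub' by simp
  moreover have "sgn_B n ?s = -1" using sgn_rfl[OF ypm] z(4) by simp
  ultimately show ?thesis using sB by blast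
qed

lemma elem_normalizes:
  assumes a: "a \<in> A" shows "conj_by a A = A"
proof -
  have "a \<circ> b \<circ> finv a = b" if "b \<in> A" for b
    using comm[OF a that] finv_right[OF in_B[OF a]] by (simp add: fun_eq_iff)
  then show ?thesis by (simp add: conj_by_def)
qed

lemma ex_sgn_neg_normalizing_iff:
  "(\<exists>w\<in>carrier (B n). conj_by w A = A \<and> sgn_B n w = -1) \<longleftrightarrow>
     (\<exists>x\<in>pm n. card (orb A x) = 2 \<or> card (orb A x) = 4 \<or> card (orb A x) = 8)"
proof
  assume "\<exists>w\<in>carrier (B n). conj_by w A = A \<and> sgn_B n w = -1"
  then obtain w where w: "w \<in> carrier (B n)" "conj_by w A = A" "sgn_B n w = -1" by blast
  show "\<exists>x\<in>pm n. card (orb A x) = 2 \<or> card (orb A x) = 4 \<or> card (orb A x) = 8"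
  proof (rule ccontr)
    assume none: "\<not> ?thesis"
    have "sgn_B n w = 1"
    proof (rule sgn_normalizing[OF w(1)])
      show "w \<circ> a \<circ> finv w \<in> A" if "a \<in> A" for a
        using w(2) imageI[OF that, of "\<lambda>a. w \<circ> a \<circ> finv w"] unfolding conj_by_def by simp
      fix i assume i: "i \<in> pm n"
      obtain k where k: "card (orb A i) = 2 ^ Suc k" using card_orb_pow2[OF i] by blast
      have "k \<noteq> 0" "k \<noteq> 1" "k \<noteq> 2" using k none i by auto
      then have "4 \<le> Suc k" by simp
      then have "(2::nat) ^ 4 \<le> 2 ^ Suc k" by (rule power_increasing) simp
      then show "16 \<le> card (orb A i)" using k by simp
    qed
    then show False using w(3) by simp
  qed
next
  assume "\<exists>x\<in>pm n. card (orb A x) = 2 \<or> card (orb A x) = 4 \<or> card (orb A x) = 8"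
  then obtain x where x: "x \<in> pm n" "card (orb A x) = 2 \<or> card (orb A x) = 4 \<or> card (orb A x) = 8" by blast
  show "\<exists>w\<in>carrier (B n). conj_by w A = A \<and> sgn_B n w = -1"
  proof (cases "card (orb A x) = 8")
    case True
    then show ?thesis using ex_normalizing_reflection[OF x(1)] by blast
  next
    case False
    then obtain a where a: "a \<in> A" "sgn_B n a = -1" using x ex_sgn_neg_iff by blast
    then show ?thesis using elem_normalizes[OF a(1)] in_B[OF a(1)] by blast
  qed
qed

lemma even_part_conj_by: assumes g: "g \<in> carrier (B n)" shows "even_part n (conj_by g A) = conj_by g (even_part n A)"
proof -
  have C: "conj_by g A \<subseteq> carrier (B n)" using conj_by_sub[OF g sub] .
  have "w \<in> even_part n (conj_by g A) \<longleftrightarrow> w \<in> conj_by g (even_part n A)" for w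
  proof
    assume "w \<in> even_part n (conj_by g A)"
    then have w: "w \<in> conj_by g A" "sgn_B n w = 1" using even_part_iff[OF C] by auto
    obtain a where a: "w = g \<circ> a \<circ> finv g" "a \<in> A" using w(1) unfolding conj_by_def by (rule imageE)
    have "a \<in> even_part n A" using a w(2) sgn_conj[OF g in_B[OF a(2)]] by (simp add: mem_even_part)
    then show "w \<in> conj_by g (even_part n A)" unfolding conj_by_def a(1) by (rule imageI)
  next
    assume "w \<in> conj_by g (even_part n A)"
    then obtain a where a: "w = g \<circ> a \<circ> finv g" "a \<in> even_part n A" unfolding conj_by_def by (rule imageE)
    have aA: "a \<in> A" "sgn_B n a = 1" using a(2) by (simp_all add: mem_even_part)
    have "w \<in> conj_by g A" unfolding conj_by_def a(1) using aA(1) by (rule imageI)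
    then show "w \<in> even_part n (conj_by g A)" using even_part_iff[OF C] sgn_conj[OF g in_B[OF aA(1)]] aA(2) a(1) by simp
  qed
  then show ?thesis by blast
qed

lemma normalizes_even_part_iff:
  assumes rel: "\<not> irrelevant_type (orbit_type n A)" and g: "g \<in> carrier (B n)"
  shows "conj_by g (even_part n A) = even_part n A \<longleftrightarrow> conj_by g A = A"
proof
  assume "conj_by g (even_part n A) = even_part n A"
  then have "even_part n (conj_by g A) = even_part n A" using even_part_conj_by[OF g] by simp
  then show "conj_by g A = A"
    using even_part_determines[OF saturated_conj_by[OF saturated_axioms g] saturated_axioms] rel orbit_type_conj_by[OF g] by simp
next
  assume "conj_by g A = A"
  then show "conj_by g (even_part n A) = even_part n A" using even_part_conj_by[OF g] by simp
qed

end

text \<open>By maximality, \<open>E\<close> is the even part of every saturated group that contains it, and \<open>localize n E\<close> is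
  such a group. If its type is irrelevant, let \<open>x\<close> and \<open>y\<close> represent the two orbits of size 2. Even elements
  act on \<open>x\<close> and \<open>y\<close> by the same sign, hence commute with the reflection that interchanges \<open>x\<close> and \<open>y\<close>.
  Adjoining this reflection before localising merges the two orbits into one of size 4.\<close>

lemma maximal_is_even_part:
  assumes E: "elab E" "E \<subseteq> carrier (Bplus n)"
    and mx: "\<And>F. elab F \<Longrightarrow> F \<subseteq> carrier (Bplus n) \<Longrightarrow> E \<subseteq> F \<Longrightarrow> F = E"
  shows "\<exists>A. saturated A n \<and> \<not> irrelevant_type (orbit_type n A) \<and> even_part n A = E"
proof -
  have evenE: "even_part n C = E" if C: "saturated C n" "E \<subseteq> C" for C
  proof (rule mx)
    interpret C: saturated C n by (rule C)
    show "elab (even_part n C)" by (rule C.elab_even_part)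
    show "even_part n C \<subseteq> carrier (Bplus n)" by (simp add: even_part_def)
    show "E \<subseteq> even_part n C" using C(2) E(2) by (simp add: even_part_def)
  qed
  have EB: "E \<subseteq> carrier (B n)" using E(2) carrier_Bplus by blast
  let ?A = "localize n E"
  have sat: "saturated ?A n" by (rule saturated_localize[OF E(1) EB])
  interpret A: saturated ?A n by (rule sat)
  have h: "even_part n ?A = E" using evenE[OF sat subset_localize[OF E(1) EB]] .
  show ?thesis
  proof (cases "irrelevant_type (orbit_type n ?A)")
    case False
    then show ?thesis using sat h by blast
  next
    case True
    then have "card {Q \<in> orb ?A ` pm n. card Q = 2} = 2" and no4: "\<forall>z\<in>pm n. card (orb ?A z) \<noteq> 4"
      using A.mult2_orbit_type[of 0] A.mult2_eq_0_iff[of 1] by (simp_all add: irrelevant_type_def)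
    then obtain Q R where QR: "{Q \<in> orb ?A ` pm n. card Q = 2} = {Q, R}" "Q \<noteq> R" by (auto simp: card_2_iff)
    have "Q \<in> orb ?A ` pm n \<and> card Q = 2" "R \<in> orb ?A ` pm n \<and> card R = 2" using QR(1) by blast+
    then obtain x y where x: "x \<in> pm n" "Q = orb ?A x" "card (orb ?A x) = 2"
      and y: "y \<in> pm n" "R = orb ?A y" "card (orb ?A y) = 2" by blast
    note ox = A.orb_two[OF x(1,3)] and oy = A.orb_two[OF y(1,3)]
    have nz: "x \<noteq> 0" "y \<noteq> 0" using pm_nz x(1) y(1) by auto
    have xy: "x \<noteq> y" "x \<noteq> - y" using QR(2) x(2) y(2) ox oy by auto
    have big: "z \<in> {x, - x} \<or> z \<in> {y, - y} \<or> 8 \<le> card (orb ?A z)" if z: "z \<in> pm n" for z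
    proof (cases "card (orb ?A z) = 2")
      case True
      then have "orb ?A z = Q \<or> orb ?A z = R" using QR(1) z by blast
      then show ?thesis using A.orb_self[of z] x(2) y(2) ox oy by auto
    next
      case False
      then show ?thesis using A.card_orb_big[OF z] no4 z by blast
    qed
    \<comment> \<open>Otherwise composing with the reflection that negates \<open>q\<close> gives an odd element of \<open>localize n E\<close>
      that moves only points of the large orbits.\<close>
    have no_flip: False if a: "a \<in> ?A" "sgn_B n a = 1" and p: "a p = p" "a q = - q"
      and pq: "p = x \<and> q = y \<or> p = y \<and> q = x" for a p q
    proof -
      have qp: "q \<in> pm n" "orb ?A q = {q, - q, - q, - (- q)}" "q \<noteq> 0" "- q \<in> pm n" "- q \<in> orb ?A q" "- q \<noteq> q"
        using pq x y ox oy nz by auto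
      have rA: "rfl q (- q) \<in> ?A" using A.rfl_in_A[OF qp(1,5,6,2)] .
      have kA: "rfl q (- q) \<circ> a \<in> ?A" using A.comp_in[OF rA a(1)] .
      have pq': "p \<noteq> q" "p \<noteq> - q" using pq xy by auto
      have "(rfl q (- q) \<circ> a) p = p" "(rfl q (- q) \<circ> a) q = q" using p pq' by (simp_all add: rfl_def)
      then have k: "(rfl q (- q) \<circ> a) i = i" if "i \<in> {p, - p, q, - q}" for i
        using that B_odd[OF A.in_B[OF kA], of p] B_odd[OF A.in_B[OF kA], of q] by auto
      have "sgn_B n (rfl q (- q) \<circ> a) = 1"
      proof (rule A.sgn_elem[OF kA])
        fix i assume "i \<in> pm n"
        then have "i \<in> {p, - p, q, - q} \<or> 8 \<le> card (orb ?A i)" using big[of i] pq by auto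
        then show "(rfl q (- q) \<circ> a) i = i \<or> 8 \<le> card (orb ?A i)" using k by blast
      qed
      moreover have "sgn_B n (rfl q (- q) \<circ> a) = -1"
        using sgn_comp[OF A.in_B[OF rA] A.in_B[OF a(1)]] a(2) sgn_rfl[OF qp(1,4)] qp(6) by simp
      ultimately show False by simp
    qed
    let ?s = "rfl x y"
    have sB: "?s \<in> carrier (B n)" using rfl_in_B[OF x(1) y(1)] .
    have comm: "?s (a i) = a (?s i)" if a: "a \<in> E" for a i
    proof -
      have aA: "a \<in> ?A" "sgn_B n a = 1" using a h A.mem_even_part by auto
      have ax: "a x = x \<or> a x = - x" using orbI[OF aA(1), of x] ox by simp
      have ay: "a y = y \<or> a y = - y" using orbI[OF aA(1), of y] oy by simp
      have "a x = x \<and> a y = y \<or> a x = - x \<and> a y = - y"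
        using ax ay no_flip[OF aA, of x y] no_flip[OF aA, of y x] by blast
      then have "rfl (a x) (a y) k = rfl x y k" for k using rfl_neg nz by auto
      then show ?thesis using rfl_conj[OF A.in_B[OF aA(1)], of x y i] by simp
    qed
    let ?E = "E \<union> (\<lambda>a. ?s \<circ> a) ` E"
    have E': "elab ?E" by (rule elab_adjoin[OF E(1)]) (use rfl_rfl nz comm in simp_all)
    have EB': "?E \<subseteq> carrier (B n)" using EB B_comp[OF sB] by blast
    let ?C = "localize n ?E"
    have satC: "saturated ?C n" by (rule saturated_localize[OF E' EB'])
    interpret C: saturated ?C n by (rule satC)
    have hC: "even_part n ?C = E" using evenE[OF satC] subset_localize[OF E' EB'] by blast
    have oE: "orb ?E x \<subseteq> {x, - x, y, - y}"
    proof
      fix z assume "z \<in> orb ?E x"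
      then obtain a where a: "a \<in> ?E" "z = a x" by (rule orbE)
      have sx: "?s x = y" "?s (- x) = - y" using nz by (auto simp: rfl_def)
      have ex: "a x = x \<or> a x = - x" if "a \<in> E" for a
        using orbI[of a ?A x] that h A.mem_even_part ox by auto
      from a(1) show "z \<in> {x, - x, y, - y}"
      proof
        assume "a \<in> E" then show ?thesis using ex a(2) by auto
      next
        assume "a \<in> (\<lambda>a. ?s \<circ> a) ` E"
        then obtain a' where "a = ?s \<circ> a'" "a' \<in> E" by (rule imageE)
        then show ?thesis using ex[of a'] a(2) sx by auto
      qed
    qed
    have "?s \<in> ?E" using image_eqI[of ?s "\<lambda>a. ?s \<circ> a" id E] elab.id_in[OF E(1)] by simp
    from orbI[OF this, of x] have yE: "y \<in> orb ?E x" by (simp add: rfl_def)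
    have oC: "orb ?C x = orb ?E x \<union> uminus ` orb ?E x" using orb_localize[OF E' EB' x(1)] .
    have "{x, - x, y, - y} \<subseteq> orb ?C x"
      using yE C.orb_self[of x] C.orb_neg[OF _ x(1)] oC by simp
    moreover have "orb ?C x \<subseteq> {x, - x, y, - y}" using oC oE by auto
    ultimately have "orb ?C x = {x, - x, y, - y}" by (rule subset_antisym[rotated])
    moreover have "distinct [x, - x, y, - y]" using xy nz by auto
    ultimately have "card (orb ?C x) = 4" using distinct_card[of "[x, - x, y, - y]"] by simp
    then have "mult2 1 (orbit_type n ?C) \<noteq> 0" using C.mult2_eq_0_iff[of 1] x(1) by auto
    then show ?thesis using satC hC by (auto simp: irrelevant_type_def)
  qed
qed

section \<open>Translation to the group-theoretic notions\<close>

lemma subgroup_Bplus: "subgroup (carrier (Bplus n)) (B n)"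
proof -
  have "group_hom (B n) sign_img (sgn_B n)"
    using group_B sign_img_is_group is_sgn_sgn_B[of n] by (simp add: group_hom_def group_hom_axioms_def is_sgn_def)
  from group_hom.subgroup_kernel[OF this] show ?thesis by (simp add: Bplus_def)
qed

lemma Bplus_eq: "Bplus n = (B n)\<lparr>carrier := carrier (Bplus n)\<rparr>"
  by (simp add: Bplus_def)

lemma Bplus_mult [simp]: "w \<otimes>\<^bsub>Bplus n\<^esub> v = w \<circ> v" by (simp add: Bplus_def)

lemma Bplus_one [simp]: "\<one>\<^bsub>Bplus n\<^esub> = id" by (simp add: Bplus_def)

lemma Bplus_B: "w \<in> carrier (Bplus n) \<Longrightarrow> w \<in> carrier (B n)"
  by (simp add: carrier_Bplus)

lemma inv_Bplus: "w \<in> carrier (Bplus n) \<Longrightarrow> inv\<^bsub>Bplus n\<^esub> w = finv w"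
  using group.m_inv_consistent[OF group_B subgroup_Bplus] inv_B Bplus_B Bplus_eq by metis

lemma elem_ab_Bplus_iff: "elem_ab_2_subgroup (Bplus n) E \<longleftrightarrow> elab E \<and> E \<subseteq> carrier (Bplus n)"
proof
  assume E: "elem_ab_2_subgroup (Bplus n) E"
  then have sg: "subgroup E (Bplus n)" by (simp add: elem_ab_2_subgroup_def)
  have "elab E"
  proof
    show "id \<in> E" using subgroup.one_closed[OF sg] by simp
    show "a \<circ> b \<in> E" if "a \<in> E" "b \<in> E" for a b using subgroup.m_closed[OF sg that] by simp
    show "a (b x) = b (a x)" if "a \<in> E" "b \<in> E" for a b x
      using E that by (simp add: elem_ab_2_subgroup_def) (metis comp_apply)
    show "a (a x) = x" if "a \<in> E" for a x
    proof -
      have "a [^]\<^bsub>Bplus n\<^esub> (2::nat) = id" using E that by (simp add: elem_ab_2_subgroup_def)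
      then have "a \<circ> a = id" by (simp add: numeral_2_eq_2 nat_pow_def)
      then show ?thesis by (metis comp_apply id_apply)
    qed
  qed
  then show "elab E \<and> E \<subseteq> carrier (Bplus n)" using subgroup.subset[OF sg] by simp
next
  assume E: "elab E \<and> E \<subseteq> carrier (Bplus n)"
  interpret elab E using E by simp
  have finv: "finv a = a" if "a \<in> E" for a
    by (rule inv_unique_comp) (simp_all add: fun_eq_iff sq[OF that])
  have "subgroup E (Bplus n)"
  proof
    show "E \<subseteq> carrier (Bplus n)" using E by simp
    show "a \<otimes>\<^bsub>Bplus n\<^esub> b \<in> E" if "a \<in> E" "b \<in> E" for a b using comp_in[OF that] by simp
    show "\<one>\<^bsub>Bplus n\<^esub> \<in> E" using id_in by simp
    show "inv\<^bsub>Bplus n\<^esub> a \<in> E" if a: "a \<in> E" for a using inv_Bplus[of a n] finv[OF a] a E by auto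
  qed
  moreover have "a \<circ> b = b \<circ> a" if "a \<in> E" "b \<in> E" for a b using comm[OF that] by (simp add: fun_eq_iff)
  moreover have "a [^]\<^bsub>Bplus n\<^esub> (2::nat) = id" if "a \<in> E" for a
    using sq[OF that] by (simp add: numeral_2_eq_2 nat_pow_def fun_eq_iff)
  ultimately show "elem_ab_2_subgroup (Bplus n) E" by (simp add: elem_ab_2_subgroup_def)
qed

lemma conj_set_Bplus: "g \<in> carrier (Bplus n) \<Longrightarrow> conj_set (Bplus n) g H = conj_by g H"
  by (auto simp: conj_set_def conj_by_def l_coset_def r_coset_def inv_Bplus)

lemma conj_class_B: "conj_class (B n) H = (\<lambda>g. conj_by g H) ` carrier (B n)"
  unfolding conj_class_def by (rule image_cong) (simp_all add: conj_set_B)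

lemma conj_class_Bplus: "conj_class (Bplus n) H = (\<lambda>g. conj_by g H) ` carrier (Bplus n)"
  unfolding conj_class_def by (rule image_cong) (simp_all add: conj_set_Bplus)

lemma normalizer_B:
  assumes "H \<subseteq> carrier (B n)" shows "normalizer (B n) H = {g \<in> carrier (B n). conj_by g H = H}"
  using assms conj_set_B unfolding normalizer_def stabilizer_def conj_set_def by auto

lemma normalizer_Bplus:
  assumes "H \<subseteq> carrier (Bplus n)" shows "normalizer (Bplus n) H = {g \<in> carrier (Bplus n). conj_by g H = H}"
  using assms conj_set_Bplus unfolding normalizer_def stabilizer_def conj_set_def by auto

text \<open>The cosets of the even part are the nonempty fibres of the sign.\<close>

lemma subgroup_index_even_part:
  assumes K: "K \<subseteq> carrier (B n)" "id \<in> K" "\<And>a b. a \<in> K \<Longrightarrow> b \<in> K \<Longrightarrow> a \<circ> b \<in> K" "\<And>a. a \<in> K \<Longrightarrow> finv a \<in> K"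
  shows "subgroup_index (B n) K {k \<in> K. sgn_B n k = 1} = (if \<exists>k\<in>K. sgn_B n k = -1 then 2 else 1)"
proof -
  define part where "part s = {k \<in> K. sgn_B n k = s}" for s
  let ?H = "{k \<in> K. sgn_B n k = 1}"
  have coset: "?H #>\<^bsub>B n\<^esub> a = part (sgn_B n a)" if a: "a \<in> K" for a
  proof -
    have aB: "a \<in> carrier (B n)" using a K(1) by blast
    have "k \<in> (\<lambda>h. h \<circ> a) ` ?H \<longleftrightarrow> k \<in> part (sgn_B n a)" for k
    proof
      assume "k \<in> (\<lambda>h. h \<circ> a) ` ?H"
      then obtain h where h: "k = h \<circ> a" "h \<in> ?H" by (rule imageE)
      have "h \<in> carrier (B n)" using h(2) K(1) by blast
      then show "k \<in> part (sgn_B n a)" using h K(3)[OF _ a] sgn_comp[OF _ aB] by (simp add: part_def)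
    next
      assume "k \<in> part (sgn_B n a)"
      then have k: "k \<in> K" "sgn_B n k = sgn_B n a" by (simp_all add: part_def)
      have kB: "k \<in> carrier (B n)" using k(1) K(1) by blast
      have "sgn_B n (k \<circ> finv a) = 1"
        using sgn_comp[OF kB finv_B[OF aB]] sgn_finv[OF aB] k(2) sgn_cases[OF aB] by auto
      then have "k \<circ> finv a \<in> ?H" using K(3)[OF k(1) K(4)[OF a]] by simp
      moreover have "k = (k \<circ> finv a) \<circ> a" by (simp add: comp_assoc finv_comp[OF aB])
      ultimately show "k \<in> (\<lambda>h. h \<circ> a) ` ?H" by (intro image_eqI[where x = "k \<circ> finv a"])
    qed
    then have "(\<lambda>h. h \<circ> a) ` ?H = part (sgn_B n a)" by blast
    then show ?thesis by (auto simp: r_coset_def)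
  qed
  have "rcosets\<^bsub>(B n)\<lparr>carrier := K\<rparr>\<^esub> ?H = (\<Union>a\<in>K. {part (sgn_B n a)})"
    unfolding RCOSETS_def by (simp add: coset)
  also have "\<dots> = part ` (sgn_B n ` K)" by auto
  finally have idx: "subgroup_index (B n) K ?H = card (part ` (sgn_B n ` K))" by (simp add: subgroup_index_def)
  have one: "1 \<in> sgn_B n ` K" using imageI[OF K(2), of "sgn_B n"] by (simp add: sgn_id)
  have inj: "inj_on part (sgn_B n ` K)"
  proof (rule inj_onI)
    fix s t assume "s \<in> sgn_B n ` K" "t \<in> sgn_B n ` K" "part s = part t"
    then obtain k where "k \<in> K" "sgn_B n k = s" by blast
    then have "k \<in> part t" using \<open>part s = part t\<close> by (auto simp: part_def)
    then show "s = t" using \<open>sgn_B n k = s\<close> by (simp add: part_def)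
  qed
  have sub: "sgn_B n ` K \<subseteq> {1, -1}" using sgn_cases K(1) by blast
  show ?thesis
  proof (cases "\<exists>k\<in>K. sgn_B n k = -1")
    case True
    then have "-1 \<in> sgn_B n ` K" by (metis imageI)
    then have "sgn_B n ` K = {1, -1}" using one sub by blast
    then show ?thesis using True idx card_image[OF inj] by simp
  next
    case False
    then have "sgn_B n ` K = {1}" using one sub by blast
    then show ?thesis using False idx by simp
  qed
qed

text \<open>An odd conjugating element becomes even after composition with an odd element that normalises \<open>H\<close>.\<close>

lemma conj_class_fusion:
  assumes g: "g \<in> carrier (B n)" "conj_by g H = H" "sgn_B n g = -1"
  shows "conj_class (B n) H = conj_class (Bplus n) H"
proof
  show "conj_class (Bplus n) H \<subseteq> conj_class (B n) H"
    unfolding conj_class_B conj_class_Bplus using Bplus_B by blast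
  show "conj_class (B n) H \<subseteq> conj_class (Bplus n) H"
  proof
    fix K assume "K \<in> conj_class (B n) H"
    then obtain w where w: "K = conj_by w H" "w \<in> carrier (B n)" unfolding conj_class_B by (rule imageE)
    show "K \<in> conj_class (Bplus n) H"
    proof (cases "sgn_B n w = 1")
      case True
      then show ?thesis unfolding conj_class_Bplus w(1) using w(2) by (intro imageI) (simp add: carrier_Bplus)
    next
      case False
      then have "sgn_B n (w \<circ> g) = 1" using sgn_comp[OF w(2) g(1)] g(3) sgn_cases[OF w(2)] by auto
      then have "w \<circ> g \<in> carrier (Bplus n)" using B_comp[OF w(2) g(1)] by (simp add: carrier_Bplus)
      moreover have "K = conj_by (w \<circ> g) H" using conj_by_comp[OF w(2) g(1), of H] g(2) w(1) by simp
      ultimately show ?thesis unfolding conj_class_Bplus by (intro image_eqI[where x = "w \<circ> g"])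
    qed
  qed
qed

lemma conj_class_Bplus_conj:
  assumes w: "w \<in> carrier (Bplus n)" shows "conj_class (Bplus n) (conj_by w H) = conj_class (Bplus n) H"
proof -
  have B: "u \<in> carrier (Bplus n) \<Longrightarrow> v \<in> carrier (Bplus n) \<Longrightarrow> u \<circ> v \<in> carrier (Bplus n)" for u v
    by (simp add: carrier_Bplus B_comp sgn_comp)
  have iw: "finv w \<in> carrier (Bplus n)" using w finv_B sgn_finv by (simp add: carrier_Bplus)
  have 1: "conj_by u (conj_by w H) = conj_by (u \<circ> w) H" if "u \<in> carrier (Bplus n)" for u
    using conj_by_comp[OF Bplus_B[OF that] Bplus_B[OF w]] .
  have 2: "conj_by u H = conj_by (u \<circ> finv w) (conj_by w H)" if "u \<in> carrier (Bplus n)" for u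
    using conj_by_comp[OF Bplus_B[OF B[OF that iw]] Bplus_B[OF w], of H] finv_comp[OF Bplus_B[OF w]]
    by (simp add: comp_assoc)
  show ?thesis unfolding conj_class_Bplus
  proof
    show "(\<lambda>g. conj_by g (conj_by w H)) ` carrier (Bplus n) \<subseteq> (\<lambda>g. conj_by g H) ` carrier (Bplus n)"
      using 1 B[OF _ w] by (intro image_subsetI) simp
    show "(\<lambda>g. conj_by g H) ` carrier (Bplus n) \<subseteq> (\<lambda>g. conj_by g (conj_by w H)) ` carrier (Bplus n)"
      using 2 B[OF _ iw] by (intro image_subsetI) (metis imageI)
  qed
qed

text \<open>If all elements that normalise \<open>H\<close> are even, then so are all elements that conjugate \<open>H\<close> to
  a given group, or none of them.\<close>

lemma conj_class_splits:
  assumes s: "s \<in> carrier (B n)" "sgn_B n s = -1"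
    and N: "\<And>g. g \<in> carrier (B n) \<Longrightarrow> conj_by g H = H \<Longrightarrow> sgn_B n g = 1"
  shows "conj_class (Bplus n) ` conj_class (B n) H =
      {conj_class (Bplus n) H, conj_class (Bplus n) (conj_by s H)}"
    and "conj_class (Bplus n) H \<noteq> conj_class (Bplus n) (conj_by s H)"
proof -
  have idP: "id \<in> carrier (Bplus n)" by (simp add: carrier_Bplus id_B sgn_id)
  have cls: "conj_class (Bplus n) (conj_by w H) \<in> {conj_class (Bplus n) H, conj_class (Bplus n) (conj_by s H)}"
    if w: "w \<in> carrier (B n)" for w
  proof (cases "sgn_B n w = 1")
    case True
    then show ?thesis using conj_class_Bplus_conj[of w n H] w by (simp add: carrier_Bplus)
  next
    case False
    let ?v = "w \<circ> finv s"
    have "sgn_B n ?v = 1"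
      using False sgn_cases[OF w] sgn_comp[OF w finv_B[OF s(1)]] sgn_finv[OF s(1)] s(2) by auto
    then have v: "?v \<in> carrier (Bplus n)" using B_comp[OF w finv_B[OF s(1)]] by (simp add: carrier_Bplus)
    have "conj_by ?v (conj_by s H) = conj_by w H"
      using conj_by_comp[OF Bplus_B[OF v] s(1), of H] finv_comp[OF s(1)] by (simp add: comp_assoc)
    then show ?thesis using conj_class_Bplus_conj[OF v, of "conj_by s H"] by simp
  qed
  show "conj_class (Bplus n) ` conj_class (B n) H =
      {conj_class (Bplus n) H, conj_class (Bplus n) (conj_by s H)}"
  proof
    show "conj_class (Bplus n) ` conj_class (B n) H \<subseteq>
        {conj_class (Bplus n) H, conj_class (Bplus n) (conj_by s H)}"
      unfolding conj_class_B image_image using cls by (rule image_subsetI)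
    have "H \<in> conj_class (B n) H" unfolding conj_class_B using image_eqI[OF _ id_B, of H "\<lambda>g. conj_by g H"] by (simp add: conj_by_id)
    moreover have "conj_by s H \<in> conj_class (B n) H" unfolding conj_class_B using s(1) by (rule imageI)
    ultimately show "{conj_class (Bplus n) H, conj_class (Bplus n) (conj_by s H)} \<subseteq>
        conj_class (Bplus n) ` conj_class (B n) H" by simp
  qed
  show "conj_class (Bplus n) H \<noteq> conj_class (Bplus n) (conj_by s H)"
  proof
    assume eq: "conj_class (Bplus n) H = conj_class (Bplus n) (conj_by s H)"
    have "H \<in> conj_class (Bplus n) H"
      unfolding conj_class_Bplus using image_eqI[OF _ idP, of H "\<lambda>g. conj_by g H"] by (simp add: conj_by_id)
    then have "H \<in> (\<lambda>g. conj_by g (conj_by s H)) ` carrier (Bplus n)" using eq unfolding conj_class_Bplus[of n "conj_by s H"] by simp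
    then obtain v where v: "H = conj_by v (conj_by s H)" "v \<in> carrier (Bplus n)" by (rule imageE)
    have vB: "v \<in> carrier (B n)" "sgn_B n v = 1" using v(2) by (simp_all add: carrier_Bplus)
    have "conj_by (v \<circ> s) H = H" using conj_by_comp[OF vB(1) s(1), of H] v(1) by simp
    then have "sgn_B n (v \<circ> s) = 1" by (rule N[OF B_comp[OF vB(1) s(1)]])
    then show False using sgn_comp[OF vB(1) s(1)] vB(2) s(2) by simp
  qed
qed

lemma s0_B: assumes "n \<ge> 1" shows "s0 \<in> carrier (B n)" and "sgn_B n s0 = -1"
proof -
  have s: "s0 = rfl 1 (- 1)" by (auto simp: s0_def rfl_def transpose_def fun_eq_iff)
  have "1 \<in> pm n" "-1 \<in> pm n" using assms by (auto simp: pm_def)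
  then show "s0 \<in> carrier (B n)" "sgn_B n s0 = -1"
    using rfl_in_B[of 1 n "-1"] sgn_rfl[of 1 n "-1"] s by auto
qed

lemma normalizing_closed:
  assumes K: "K = {g \<in> carrier (B n). conj_by g H = H}"
  shows "K \<subseteq> carrier (B n)" "id \<in> K" "\<And>a b. a \<in> K \<Longrightarrow> b \<in> K \<Longrightarrow> a \<circ> b \<in> K" "\<And>a. a \<in> K \<Longrightarrow> finv a \<in> K"
proof -
  show "K \<subseteq> carrier (B n)" "id \<in> K" using K by (auto simp: id_B conj_by_id)
  show "a \<circ> b \<in> K" if "a \<in> K" "b \<in> K" for a b
    using that conj_by_comp[of a n b H] B_comp[of a n b] by (simp add: K)
  show "finv a \<in> K" if "a \<in> K" for a
    using that conj_by_finv[of a n H] finv_B[of a n] by (simp add: K)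
qed

theorem proposition5p11:
  fixes n :: nat
    and e :: "nat \<Rightarrow> nat \<Rightarrow> nat \<Rightarrow> bit"
    and parts :: "nat multiset \<Rightarrow> nat list"
  assumes n: "n \<ge> 1"
    and e: "enumeration e"
    and parts: "part_order parts"
  shows
    "(\<forall>\<pi>. admissible n \<pi> \<longrightarrow>
        subgroup_index (B n) (A_part e parts \<pi>) (A_hat e parts n \<pi>) =
          (if mult2 0 \<pi> = 0 \<and> mult2 1 \<pi> = 0 then 1 else 2)) \<and>
     (\<forall>E. max_elem_ab_2_subgroup (Bplus n) E \<longrightarrow>
        (\<exists>!\<pi>. relevant n \<pi> \<and> E \<in> conj_class (B n) (A_hat e parts n \<pi>))) \<and>
     (\<forall>\<pi>. relevant n \<pi> \<longrightarrow> max_elem_ab_2_subgroup (Bplus n) (A_hat e parts n \<pi>)) \<and>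
     (\<forall>\<pi>. relevant n \<pi> \<longrightarrow>
        normalizer (B n) (A_hat e parts n \<pi>) = normalizer (B n) (A_part e parts \<pi>)) \<and>
     (\<forall>\<pi>. relevant n \<pi> \<longrightarrow>
        subgroup_index (B n) (normalizer (B n) (A_hat e parts n \<pi>))
            (normalizer (Bplus n) (A_hat e parts n \<pi>)) =
          (if mult2 0 \<pi> = 0 \<and> mult2 1 \<pi> = 0 \<and> mult2 2 \<pi> = 0 then 1 else 2)) \<and>
     (\<forall>\<pi>. relevant n \<pi> \<longrightarrow>
        (if mult2 0 \<pi> = 0 \<and> mult2 1 \<pi> = 0 \<and> mult2 2 \<pi> = 0
         then conj_class (Bplus n) ` conj_class (B n) (A_hat e parts n \<pi>) =
                {conj_class (Bplus n) (A_hat e parts n \<pi>),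
                 conj_class (Bplus n) (conj_set (B n) s0 (A_hat e parts n \<pi>))} \<and>
              conj_class (Bplus n) (A_hat e parts n \<pi>) \<noteq>
                conj_class (Bplus n) (conj_set (B n) s0 (A_hat e parts n \<pi>))
         else conj_class (B n) (A_hat e parts n \<pi>) = conj_class (Bplus n) (A_hat e parts n \<pi>)))"
proof -
  let ?A = "A_part e parts" and ?H = "A_hat e parts n"
  have rel: "relevant n \<pi> \<longleftrightarrow> admissible n \<pi> \<and> \<not> irrelevant_type \<pi>" for \<pi>
    by (simp add: relevant_def irrelevant_type_def)
  have H_even: "?H \<pi> = even_part n (?A \<pi>)" for \<pi> by (simp add: A_hat_def even_part_def)
  have sat: "saturated (?A \<pi>) n" and ty: "orbit_type n (?A \<pi>) = \<pi>" if "admissible n \<pi>" for \<pi>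
    using saturated_A_part[OF e parts that] by auto
  have satB: "?A \<pi> \<subseteq> carrier (B n)" if "admissible n \<pi>" for \<pi>
    using sat[OF that] by (simp add: saturated_def elab_neg_def elab_neg_axioms_def)
  have HP: "?H \<pi> \<subseteq> carrier (Bplus n)" for \<pi> by (simp add: A_hat_def)
  have HB: "?H \<pi> \<subseteq> carrier (B n)" for \<pi> using HP[of \<pi>] Bplus_B by blast
  have p24: "(2::nat) ^ Suc 0 = 2" "(2::nat) ^ Suc 1 = 4" "(2::nat) ^ Suc 2 = 8" by simp_all
  have odd_elem: "(\<exists>a\<in>?A \<pi>. sgn_B n a = -1) \<longleftrightarrow> \<not> (mult2 0 \<pi> = 0 \<and> mult2 1 \<pi> = 0)"
    if adm: "admissible n \<pi>" for \<pi>
  proof -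
    interpret S: saturated "?A \<pi>" n by (rule sat[OF adm])
    show ?thesis using S.ex_sgn_neg_iff S.mult2_eq_0_iff[of 0] S.mult2_eq_0_iff[of 1]
      unfolding ty[OF adm] p24 by blast
  qed
  have odd_norm: "(\<exists>w\<in>carrier (B n). conj_by w (?H \<pi>) = ?H \<pi> \<and> sgn_B n w = -1) \<longleftrightarrow>
      \<not> (mult2 0 \<pi> = 0 \<and> mult2 1 \<pi> = 0 \<and> mult2 2 \<pi> = 0)" if r: "relevant n \<pi>" for \<pi>
  proof -
    have adm: "admissible n \<pi>" and nirr: "\<not> irrelevant_type \<pi>" using r rel by auto
    interpret S: saturated "?A \<pi>" n by (rule sat[OF adm])
    have "(\<exists>w\<in>carrier (B n). conj_by w (?H \<pi>) = ?H \<pi> \<and> sgn_B n w = -1) \<longleftrightarrow>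
        (\<exists>w\<in>carrier (B n). conj_by w (?A \<pi>) = ?A \<pi> \<and> sgn_B n w = -1)"
      using S.normalizes_even_part_iff nirr ty[OF adm] unfolding H_even by auto
    then show ?thesis using S.ex_sgn_neg_normalizing_iff
        S.mult2_eq_0_iff[of 0] S.mult2_eq_0_iff[of 1] S.mult2_eq_0_iff[of 2]
      unfolding ty[OF adm] p24 by blast
  qed
  have part1: "subgroup_index (B n) (?A \<pi>) (?H \<pi>) = (if mult2 0 \<pi> = 0 \<and> mult2 1 \<pi> = 0 then 1 else 2)"
    if adm: "admissible n \<pi>" for \<pi>
  proof -
    interpret S: saturated "?A \<pi>" n by (rule sat[OF adm])
    have "?H \<pi> = {k \<in> ?A \<pi>. sgn_B n k = 1}" unfolding H_even using S.mem_even_part by blast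
    then show ?thesis
      using subgroup_index_even_part[OF S.sub S.id_in S.comp_in] S.finv_eq odd_elem[OF adm] by simp
  qed
  have part2a: "\<exists>!\<pi>. relevant n \<pi> \<and> E \<in> conj_class (B n) (?H \<pi>)" if E: "max_elem_ab_2_subgroup (Bplus n) E" for E
  proof -
    have "\<exists>C. saturated C n \<and> \<not> irrelevant_type (orbit_type n C) \<and> even_part n C = E"
    proof (rule maximal_is_even_part)
      show "elab E" "E \<subseteq> carrier (Bplus n)"
        using E by (simp_all add: max_elem_ab_2_subgroup_def elem_ab_Bplus_iff)
      show "F = E" if "elab F" "F \<subseteq> carrier (Bplus n)" "E \<subseteq> F" for F
        using E that by (simp add: max_elem_ab_2_subgroup_def elem_ab_Bplus_iff)
    qed
    then obtain C where C: "saturated C n" "\<not> irrelevant_type (orbit_type n C)" "even_part n C = E" by blast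
    interpret C: saturated C n by (rule C)
    let ?\<pi> = "orbit_type n C"
    have adm: "admissible n ?\<pi>" by (rule C.admissible_orbit_type)
    obtain f where f: "f \<in> carrier (B n)" "conj_by f (?A ?\<pi>) = C"
      using saturated_conjugate[OF sat[OF adm] C(1)] ty[OF adm] by auto
    have "E = conj_by f (?H ?\<pi>)" using saturated.even_part_conj_by[OF sat[OF adm] f(1)] f(2) C(3) H_even by simp
    then have ex: "relevant n ?\<pi> \<and> E \<in> conj_class (B n) (?H ?\<pi>)"
      using rel adm C(2) f(1) unfolding conj_class_B by (simp add: image_iff) blast
    have "\<rho> = ?\<pi>" if \<rho>: "relevant n \<rho> \<and> E \<in> conj_class (B n) (?H \<rho>)" for \<rho>
    proof -
      have adm': "admissible n \<rho>" "\<not> irrelevant_type \<rho>" using \<rho> rel by auto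
      have "E \<in> (\<lambda>g. conj_by g (?H \<rho>)) ` carrier (B n)" using \<rho> conj_class_B by simp
      then obtain g where g: "E = conj_by g (?H \<rho>)" "g \<in> carrier (B n)" by (rule imageE)
      have "even_part n (conj_by g (?A \<rho>)) = even_part n C"
        using saturated.even_part_conj_by[OF sat[OF adm'(1)] g(2)] g(1) C(3) H_even by simp
      then have "conj_by g (?A \<rho>) = C"
        using even_part_determines[OF saturated_conj_by[OF sat[OF adm'(1)] g(2)] C(1)] C(2) adm'(2)
          orbit_type_conj_by[OF g(2)] ty[OF adm'(1)] by simp
      then show ?thesis using orbit_type_conj_by[OF g(2)] ty[OF adm'(1)] by metis
    qed
    then show ?thesis using ex by blast
  qed
  have part2b: "max_elem_ab_2_subgroup (Bplus n) (?H \<pi>)" if r: "relevant n \<pi>" for \<pi>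
  proof -
    have adm: "admissible n \<pi>" and nirr: "\<not> irrelevant_type \<pi>" using r rel by auto
    interpret S: saturated "?A \<pi>" n by (rule sat[OF adm])
    have "F = ?H \<pi>" if F: "elab F" "F \<subseteq> carrier (Bplus n)" "?H \<pi> \<subseteq> F" for F
      using S.even_part_maximal[OF _ F(1,2)] nirr ty[OF adm] F(3) unfolding H_even by (simp add: subset_antisym)
    then show ?thesis using S.elab_even_part HP[of \<pi>]
      by (simp add: max_elem_ab_2_subgroup_def elem_ab_Bplus_iff H_even)
  qed
  have part3: "normalizer (B n) (?H \<pi>) = normalizer (B n) (?A \<pi>)" if r: "relevant n \<pi>" for \<pi>
  proof -
    have adm: "admissible n \<pi>" and nirr: "\<not> irrelevant_type \<pi>" using r rel by auto
    have "conj_by g (?H \<pi>) = ?H \<pi> \<longleftrightarrow> conj_by g (?A \<pi>) = ?A \<pi>" if "g \<in> carrier (B n)" for g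
      using saturated.normalizes_even_part_iff[OF sat[OF adm] _ that] nirr ty[OF adm] H_even by simp
    then show ?thesis unfolding normalizer_B[OF HB] normalizer_B[OF satB[OF adm]] by blast
  qed
  have part4: "subgroup_index (B n) (normalizer (B n) (?H \<pi>)) (normalizer (Bplus n) (?H \<pi>)) =
      (if mult2 0 \<pi> = 0 \<and> mult2 1 \<pi> = 0 \<and> mult2 2 \<pi> = 0 then 1 else 2)" if r: "relevant n \<pi>" for \<pi>
  proof -
    define K where "K = {g \<in> carrier (B n). conj_by g (?H \<pi>) = ?H \<pi>}"
    have N: "normalizer (B n) (?H \<pi>) = K" using normalizer_B[OF HB] by (simp add: K_def)
    have "normalizer (Bplus n) (?H \<pi>) = {k \<in> K. sgn_B n k = 1}"
      unfolding normalizer_Bplus[OF HP] K_def carrier_Bplus by blast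
    moreover have "(\<exists>k\<in>K. sgn_B n k = -1) \<longleftrightarrow> \<not> (mult2 0 \<pi> = 0 \<and> mult2 1 \<pi> = 0 \<and> mult2 2 \<pi> = 0)"
      using odd_norm[OF r] unfolding K_def by blast
    ultimately show ?thesis
      unfolding N using subgroup_index_even_part[OF normalizing_closed[OF K_def]] by simp
  qed
  have part5: "if mult2 0 \<pi> = 0 \<and> mult2 1 \<pi> = 0 \<and> mult2 2 \<pi> = 0
         then conj_class (Bplus n) ` conj_class (B n) (?H \<pi>) =
                {conj_class (Bplus n) (?H \<pi>), conj_class (Bplus n) (conj_set (B n) s0 (?H \<pi>))} \<and>
              conj_class (Bplus n) (?H \<pi>) \<noteq> conj_class (Bplus n) (conj_set (B n) s0 (?H \<pi>))
         else conj_class (B n) (?H \<pi>) = conj_class (Bplus n) (?H \<pi>)" if r: "relevant n \<pi>" for \<pi>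
  proof (cases "mult2 0 \<pi> = 0 \<and> mult2 1 \<pi> = 0 \<and> mult2 2 \<pi> = 0")
    case True
    have N: "sgn_B n g = 1" if "g \<in> carrier (B n)" "conj_by g (?H \<pi>) = ?H \<pi>" for g
      using odd_norm[OF r] True that sgn_cases[OF that(1)] by blast
    show ?thesis
      using True conj_class_splits[OF s0_B[OF n] N] by (simp only: conj_set_B[OF s0_B(1)[OF n]] if_True simp_thms)
  next
    case False
    then obtain w where w: "w \<in> carrier (B n)" "conj_by w (?H \<pi>) = ?H \<pi>" "sgn_B n w = -1" using odd_norm[OF r] by blast
    show ?thesis unfolding if_not_P[OF False] by (rule conj_class_fusion[OF w])
  qed
  show ?thesis using part1 part2a part2b part3 part4 part5 by (intro conjI allI impI)
qed

end
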